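(* Let $\mathfrak o$ be a compact discrete valuation ring with residue field of cardinality $q$. For $C\subseteq[n]$ put $C^*=\{n-i+1:i\in C\}$, $x_C$-notation as below. Then, as formal power series, \[ \mathsf{HS}_{n,\mathfrak o}(\mathbf x,\mathbf y)=\mathsf{HLS}_n\Bigl(q^{-1},\bigl(q^{\sigma_n(C)}\,x_{\#C}\,\mathbf y_{C^*}\bigr)_{\varnothing\neq C\subseteq[n]}\Bigr). \]
   Context: Hall–Littlewood–Schubert series: Let $[n]=\{1,\dots,n\}$. $\mathrm{SSYT}_n$ is the set of semistandard Young tableaux with entries in $[n]$ (including the empty one); a tableau is identified with its sequence of columns $(C_1,\dots,C_\ell)$, $C_j\subseteq[n]$ the set of entries of column $j$, and $T_{ij}$ is the entry in row $i$, column $j$. $T$ is reduced if its columns are pairwise distinct; $\mathrm{rSSYT}_n$ is the finite set of reduced tableaux. For cells $(i,j),(i,j+1)$ both in $T$, $\mathrm{Leg}^+_T(i,j)=C_j\cap\{T_{ij},\dots,T_{i,j+1}\}$ if $T_{i,j+1}\notin C_j$, else $\varnothing$ ($\varnothing$ if a cell is missing). $\Phi_T(Y)=\prod_{\mathrm{Leg}^+_T(i,j)\neq\varnothing}(1-Y^{\#\mathrm{Leg}^+_T(i,j)})$. For variables $\mathbf X=(X_C)_{\varnothing\ne C\subseteq[n]}$, $\mathsf{HLS}_n(Y,\mathbf X)=\sum_{T\in\mathrm{rSSYT}_n}\Phi_T(Y)\prod_{C\in T}\frac{X_C}{1-X_C}$; $\mathsf{HLS}_n(Y,(f_C)_C)$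 denotes the substitution $X_C\mapsto f_C$. Schubert dimension: $\sigma_n(C)=\sum_{i\in[n]\setminus C}i-\binom{n-\#C+1}{2}$. $\mathfrak o$ has maximal ideal $\mathfrak p$ and valuation $v_{\mathfrak p}$. For a lattice (finite-index submodule) $\Lambda\le\mathfrak o^n$, $\lambda(\Lambda)$ is the partition with $\mathfrak o^n/\Lambda\cong\bigoplus_i\mathfrak o/\mathfrak p^{\lambda_i}$, and $\mathrm{inc}(\lambda)=(\lambda_1-\lambda_2,\dots,\lambda_{n-1}-\lambda_n,\lambda_n)$. The Hermite composition $\delta(\Lambda)=(\delta_1,\dots,\delta_n)\in\mathbb N_0^n$ is the vector of valuations of the diagonal entries of any upper-triangular matrix in $\mathrm{Mat}_n(\mathfrak o)$ whose rows (as coordinate vectors in the standard basis) generate $\Lambda$; it is independent of the choice. With variables $\mathbf x=(x_1,\dots,x_n)$, $\mathbf y=(y_1,\dots,y_n)$, monomials $\mathbf x^{a}=\prod x_i^{a_i}$, $\mathbf y_C=\prod_{i\in C}y_i$, the Hermite–Smith series is $\mathsf{HS}_{n,\mathfrak o}(\mathbf x,\mathbf y)=\sum_{\Lambda\le\mathfrak o^n}\mathbf x^{\mathrm{inc}(\lambda(\Lambda))}\mathbf y^{\delta(\Lambda)}$. *)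

theory Defs
  imports "HOL-Analysis.Analysis" "HOL-Library.Function_Algebras"
begin

text \<open>The ring \<o> is the type 'a (an integral domain); v is the normalized discrete
  valuation on its nonzero elements, and \<o> is its valuation ring: v is multiplicative,
  ultrametric, surjective onto the naturals, and a divides b whenever v a \<le> v b.
  The value v 0 is irrelevant (never used).\<close>

definition discrete_valuation_ring :: "('a::idom \<Rightarrow> nat) \<Rightarrow> bool" where
  "discrete_valuation_ring v \<longleftrightarrow>
     (\<forall>a b. a \<noteq> 0 \<longrightarrow> b \<noteq> 0 \<longrightarrow> v (a * b) = v a + v b) \<and>
     (\<forall>a b. a \<noteq> 0 \<longrightarrow> b \<noteq> 0 \<longrightarrow> a + b \<noteq> 0 \<longrightarrow> min (v a) (v b) \<le> v (a + b)) \<and>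
     (\<forall>k. \<exists>a. a \<noteq> 0 \<and> v a = k) \<and>
     (\<forall>a b. a \<noteq> 0 \<longrightarrow> b \<noteq> 0 \<longrightarrow> v a \<le> v b \<longrightarrow> a dvd b)"

definition pow_ideal :: "('a::idom \<Rightarrow> nat) \<Rightarrow> nat \<Rightarrow> 'a set" where
  "pow_ideal v k = {c. c = 0 \<or> k \<le> v c}"

definition residue_field :: "('a::idom \<Rightarrow> nat) \<Rightarrow> 'a set set" where
  "residue_field v = UNIV // {(a, b). a - b \<in> pow_ideal v 1}"

definition padic_topology :: "('a::idom \<Rightarrow> nat) \<Rightarrow> 'a topology" where
  "padic_topology v = topology_generated_by {{b. b - a \<in> pow_ideal v k} | a k. True}"

definition free_mod :: "nat \<Rightarrow> (nat \<Rightarrow> 'a::idom) set" where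
  "free_mod n = {f. \<forall>i. i \<notin> {1..n} \<longrightarrow> f i = 0}"

definition smult_vec :: "'a::idom \<Rightarrow> (nat \<Rightarrow> 'a) \<Rightarrow> (nat \<Rightarrow> 'a)" where
  "smult_vec c f = (\<lambda>i. c * f i)"

definition submodule :: "nat \<Rightarrow> (nat \<Rightarrow> 'a::idom) set \<Rightarrow> bool" where
  "submodule n L \<longleftrightarrow> L \<subseteq> free_mod n \<and> 0 \<in> L \<and>
     (\<forall>f\<in>L. \<forall>g\<in>L. f + g \<in> L) \<and> (\<forall>c. \<forall>f\<in>L. smult_vec c f \<in> L)"

definition lattice :: "nat \<Rightarrow> (nat \<Rightarrow> 'a::idom) set \<Rightarrow> bool" where
  "lattice n L \<longleftrightarrow> submodule n L \<and>
     finite (free_mod n // {(f, g). f \<in> free_mod n \<and> g \<in> free_mod n \<and> f - g \<in> L})"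

definition mod_linear :: "nat \<Rightarrow> ((nat \<Rightarrow> 'a::idom) \<Rightarrow> (nat \<Rightarrow> 'a)) \<Rightarrow> bool" where
  "mod_linear n \<psi> \<longleftrightarrow> \<psi> ` free_mod n \<subseteq> free_mod n \<and>
     (\<forall>f\<in>free_mod n. \<forall>g\<in>free_mod n. \<psi> (f + g) = \<psi> f + \<psi> g) \<and>
     (\<forall>c. \<forall>f\<in>free_mod n. \<psi> (smult_vec c f) = smult_vec c (\<psi> f))"

text \<open>D_lam = \<oplus> \<p>^(lam i), so that \<o>^n / D_lam = \<oplus> \<o>/\<p>^(lam i).\<close>
definition diag_sub :: "('a::idom \<Rightarrow> nat) \<Rightarrow> nat \<Rightarrow> (nat \<Rightarrow> nat) \<Rightarrow> (nat \<Rightarrow> 'a) set" where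
  "diag_sub v n lam = {w \<in> free_mod n. \<forall>i\<in>{1..n}. w i \<in> pow_ideal v (lam i)}"

text \<open>lam is a partition (at most n parts, indexed 1..n, zero elsewhere) with
  \<o>^n/L \<cong> \<oplus>_i \<o>/\<p>^(lam i): there is a linear map \<psi> : \<o>^n \<rightarrow> \<o>^n inducing a
  surjection \<o>^n \<rightarrow> \<o>^n/D_lam whose kernel is L (first isomorphism theorem).\<close>
definition elem_div_type :: "('a::idom \<Rightarrow> nat) \<Rightarrow> nat \<Rightarrow> (nat \<Rightarrow> 'a) set \<Rightarrow> (nat \<Rightarrow> nat) \<Rightarrow> bool" where
  "elem_div_type v n L lam \<longleftrightarrow>
     (\<forall>i. i \<notin> {1..n} \<longrightarrow> lam i = 0) \<and> (\<forall>i\<in>{1..<n}. lam (Suc i) \<le> lam i) \<and>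
     (\<exists>\<psi>. mod_linear n \<psi> \<and>
        (\<forall>w\<in>free_mod n. \<exists>u\<in>free_mod n. w - \<psi> u \<in> diag_sub v n lam) \<and>
        {u \<in> free_mod n. \<psi> u \<in> diag_sub v n lam} = L)"

definition lattice_type :: "('a::idom \<Rightarrow> nat) \<Rightarrow> nat \<Rightarrow> (nat \<Rightarrow> 'a) set \<Rightarrow> (nat \<Rightarrow> nat)" where
  "lattice_type v n L = (THE lam. elem_div_type v n L lam)"

definition inc :: "nat \<Rightarrow> (nat \<Rightarrow> nat) \<Rightarrow> (nat \<Rightarrow> nat)" where
  "inc n lam = (\<lambda>i. if i \<in> {1..n} then lam i - lam (Suc i) else 0)"

definition hermite_comp_of :: "('a::idom \<Rightarrow> nat) \<Rightarrow> nat \<Rightarrow> (nat \<Rightarrow> 'a) set \<Rightarrow> (nat \<Rightarrow> nat) \<Rightarrow> bool" where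
  "hermite_comp_of v n L d \<longleftrightarrow>
     (\<forall>i. i \<notin> {1..n} \<longrightarrow> d i = 0) \<and>
     (\<exists>A :: nat \<Rightarrow> nat \<Rightarrow> 'a.
        (\<forall>i\<in>{1..n}. A i \<in> free_mod n) \<and>
        (\<forall>i\<in>{1..n}. \<forall>j<i. A i j = 0) \<and>
        L = {(\<lambda>j. \<Sum>i\<in>{1..n}. c i * A i j) | c. True} \<and>
        (\<forall>i\<in>{1..n}. d i = v (A i i)))"

definition hermite_comp :: "('a::idom \<Rightarrow> nat) \<Rightarrow> nat \<Rightarrow> (nat \<Rightarrow> 'a) set \<Rightarrow> (nat \<Rightarrow> nat)" where
  "hermite_comp v n L = (THE d. hermite_comp_of v n L d)"

text \<open>A monomial x^a y^d is the pair of exponent functions (a, d); a series is the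
  function assigning to each monomial its coefficient.\<close>
type_synonym mon = "(nat \<Rightarrow> nat) \<times> (nat \<Rightarrow> nat)"
type_synonym ser = "mon \<Rightarrow> real"

definition ser_one :: ser where
  "ser_one m = (if m = (0, 0) then 1 else 0)"

definition ser_mult :: "ser \<Rightarrow> ser \<Rightarrow> ser" where
  "ser_mult F G = (\<lambda>(a, d). \<Sum>(a1, d1) \<in> {(a1, d1). a1 \<le> a \<and> d1 \<le> d}.
      F (a1, d1) * G (a - a1, d - d1))"

definition ser_prod_list :: "ser list \<Rightarrow> ser" where
  "ser_prod_list Fs = foldr ser_mult Fs ser_one"

definition mon_deg :: "mon \<Rightarrow> nat" where
  "mon_deg m = (\<Sum>i\<in>{i. fst m i \<noteq> 0}. fst m i) + (\<Sum>i\<in>{i. snd m i \<noteq> 0}. snd m i)"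

text \<open>For a series F without constant term, F/(1-F) = \<Sum>_{k\<ge>1} F^k
  (only k \<le> total degree contributes to a given coefficient).\<close>
definition ser_frac :: "ser \<Rightarrow> ser" where
  "ser_frac F = (\<lambda>m. \<Sum>k\<in>{1..mon_deg m}. ((ser_mult F ^^ k) ser_one) m)"

definition mon_ser :: "real \<Rightarrow> mon \<Rightarrow> ser" where
  "mon_ser c m = (\<lambda>m'. if m' = m then c else 0)"

definition HS :: "('a::idom \<Rightarrow> nat) \<Rightarrow> nat \<Rightarrow> ser" where
  "HS v n = (\<lambda>m. real (card {L :: (nat \<Rightarrow> 'a) set. lattice n L \<and>
                   (inc n (lattice_type v n L), hermite_comp v n L) = m}))"

text \<open>A tableau is the list of its columns (as sets); entry i (1-based) of column C.\<close>
definition entry :: "nat set \<Rightarrow> nat \<Rightarrow> nat" where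
  "entry C i = sorted_list_of_set C ! (i - 1)"

definition ssyt :: "nat \<Rightarrow> nat set list \<Rightarrow> bool" where
  "ssyt n T \<longleftrightarrow> (\<forall>C\<in>set T. C \<noteq> {} \<and> C \<subseteq> {1..n}) \<and>
     (\<forall>j. Suc j < length T \<longrightarrow> card (T ! Suc j) \<le> card (T ! j) \<and>
        (\<forall>i\<in>{1..card (T ! Suc j)}. entry (T ! j) i \<le> entry (T ! Suc j) i))"

definition rSSYT :: "nat \<Rightarrow> nat set list set" where
  "rSSYT n = {T. ssyt n T \<and> distinct T}"

text \<open>Leg^+_T(i,j) for cells (i,j),(i,j+1) (j is 0-based into the column list).\<close>
definition leg_plus :: "nat set list \<Rightarrow> nat \<Rightarrow> nat \<Rightarrow> nat set" where
  "leg_plus T i j =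
     (if Suc j < length T \<and> 1 \<le> i \<and> i \<le> card (T ! j) \<and> i \<le> card (T ! Suc j)
         \<and> entry (T ! Suc j) i \<notin> T ! j
      then T ! j \<inter> {entry (T ! j) i .. entry (T ! Suc j) i} else {})"

definition Phi :: "nat set list \<Rightarrow> real \<Rightarrow> real" where
  "Phi T Y = (\<Prod>(i, j) \<in> {(i, j). leg_plus T i j \<noteq> {}}. 1 - Y ^ card (leg_plus T i j))"

text \<open>HLS_n(Y, (f_C)_C): X_C/(1-X_C) is replaced by f_C/(1-f_C).\<close>
definition HLS :: "nat \<Rightarrow> real \<Rightarrow> (nat set \<Rightarrow> ser) \<Rightarrow> ser" where
  "HLS n Y f = (\<lambda>m. \<Sum>T\<in>rSSYT n. Phi T Y * ser_prod_list (map (\<lambda>C. ser_frac (f C)) T) m)"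

definition sigma :: "nat \<Rightarrow> nat set \<Rightarrow> int" where
  "sigma n C = int (\<Sum>i\<in>{1..n} - C. i) - int ((n - card C + 1) choose 2)"

definition star_set :: "nat \<Rightarrow> nat set \<Rightarrow> nat set" where
  "star_set n C = (\<lambda>i. n - i + 1) ` C"

definition xvar :: "nat \<Rightarrow> (nat \<Rightarrow> nat)" where
  "xvar k = (\<lambda>i. if i = k then 1 else 0)"

definition yset :: "nat set \<Rightarrow> (nat \<Rightarrow> nat)" where
  "yset C = (\<lambda>i. if i \<in> C then 1 else 0)"

end

theory Submission
  imports Defs
begin

text \<open>
  Let \<open>\<pi>\<close> be a uniformizer. To a lattice \<open>L\<close> attach its saturation
  \<open>sat L = {f. \<pi> f \<in> L}\<close>, which removes the first column of the type of \<open>L\<close>, and the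
  set \<open>col L\<close> of the indices at which the Hermite compositions of \<open>L\<close> and \<open>sat L\<close> differ. Iterating
  until \<open>\<o>\<^sup>n\<close> is reached yields a sequence \<open>C\<^sub>1, C\<^sub>2, \<dots>\<close> of nonempty column sets that determines
  both the Hermite composition (by counting the columns containing an index) and the type (by
  counting the columns of a given size).

  Given \<open>B\<close>, a lattice \<open>L\<close> with \<open>sat L = B\<close> is the same as a subspace of the vector space
  \<open>B / \<pi> B\<close> that meets the kernel \<open>K\<close> of the reduction map \<open>B / \<pi> B \<rightarrow> (\<o>/\<pi>)\<^sup>n\<close> trivially;
  along the coordinate flag, \<open>K\<close> jumps exactly in \<open>col B\<close> and the subspace exactly outside \<open>col L\<close>.
  Building the subspace up along the flag shows that the number of such \<open>L\<close> with \<open>col L = C\<close> is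
  the product over \<open>k \<notin> C\<close> of \<open>q^a - q^b\<close> (if \<open>k \<in> col B\<close>) or \<open>q^a\<close>, where \<open>a\<close> and \<open>b\<close> count the
  elements of \<open>C\<close> and of \<open>col B\<close> that precede \<open>k\<close> in the flag. Pulling out the powers \<open>q^a\<close>
  leaves \<open>q^\<sigma>(C)\<close> times the leg factors of the pair of adjacent columns, and the product vanishes
  unless this pair is semistandard.
\<close>

section \<open>Indices of additive subgroups\<close>

text \<open>Why complements appear: \<open>L\<close> has saturation \<open>B\<close> exactly when
  \<open>L\<close> lies between unif \<open>B\<close> and \<open>B\<close> and every vector of
  \<open>L\<close> divisible by \<open>unif\<close> in the free module lies in unif
  \<open>B\<close>. The vectors of \<open>B\<close> divisible in this sense form unif
  \<open>sat B\<close>, which is the kernel K; it jumps at \<open>col B\<close> because the lead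
  exponent of \<open>sat B\<close> is smaller by one exactly there. So the size of a fibre depends
  on \<open>B\<close> only through \<open>col B\<close>, and the count for a whole sequence is a
  product over adjacent pairs.

  Why indices are reversed: upper-triangular matrices lead to a flag that is built up from index n
  downwards, whereas tableau columns are compared from their small entries on.

  Why sequences and not tableaux: X/(1-X) sums over all multiplicities k >= 1, so a reduced tableau
  with multiplicities is a sequence with adjacent repetitions. A repeated column contributes the
  weight 1, hence both series can be compared, coefficient by coefficient, as sums over sequences.

  Quotient spaces never occur as such; everything is read from the ideals \<open>lead L i\<close> of
  submodules of the free module.\<close>

definition add_subgroup :: "'b::ab_group_add set \<Rightarrow> bool" where
  "add_subgroup A \<longleftrightarrow> 0 \<in> A \<and> (\<forall>x\<in>A. \<forall>y\<in>A. x - y \<in> A)"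

definition coset :: "'b::ab_group_add set \<Rightarrow> 'b \<Rightarrow> 'b set" where
  "coset A b = (\<lambda>s. b + s) ` A"

definition index :: "'b::ab_group_add set \<Rightarrow> 'b set \<Rightarrow> nat" where
  "index B A = card (coset A ` B)"

lemma add_subgroup_add: "add_subgroup A \<Longrightarrow> x \<in> A \<Longrightarrow> y \<in> A \<Longrightarrow> x + y \<in> A"
  unfolding add_subgroup_def
  by (metis add.commute diff_0 diff_minus_eq_add)

lemma add_subgroup_diff: "add_subgroup A \<Longrightarrow> x \<in> A \<Longrightarrow> y \<in> A \<Longrightarrow> x - y \<in> A"
  unfolding add_subgroup_def by blast

lemma coset_eq_iff:
  assumes "add_subgroup A"
  shows "coset A x = coset A y \<longleftrightarrow> x - y \<in> A"
proof
  assume "coset A x = coset A y"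
  moreover have "x \<in> coset A x"
    using assms by (auto simp: coset_def add_subgroup_def image_iff intro!: bexI[of _ 0])
  ultimately obtain s where "s \<in> A" "x = y + s" by (auto simp: coset_def)
  then show "x - y \<in> A" by simp
next
  assume h: "x - y \<in> A"
  have h': "y - x \<in> A"
    using assms h unfolding add_subgroup_def by (metis diff_0 minus_diff_eq)
  have sub: "coset A u \<subseteq> coset A w" if "u - w \<in> A" for u w
  proof
    fix z assume "z \<in> coset A u"
    then obtain s where s: "s \<in> A" "z = u + s" by (auto simp: coset_def)
    have "z = w + ((u - w) + s)" using s by simp
    then show "z \<in> coset A w"
      using add_subgroup_add[OF assms that s(1)] unfolding coset_def by blast
  qed
  show "coset A x = coset A y" using sub[OF h] sub[OF h'] by blast
qed

text \<open>Takes the place of the isomorphism theorems: coset counts of different quotients are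
  compared by checking which pairs of elements get identified.\<close>

lemma bij_betw_images_same_kernel:
  assumes "\<And>x y. x \<in> X \<Longrightarrow> y \<in> X \<Longrightarrow> f x = f y \<longleftrightarrow> g x = g y"
  shows "\<exists>h. bij_betw h (f ` X) (g ` X)"
proof -
  let ?h = "\<lambda>z. g (inv_into X f z)"
  have e: "?h (f x) = g x" if "x \<in> X" for x
    using assms[of "inv_into X f (f x)" x] that by (simp add: f_inv_into_f inv_into_into)
  have "bij_betw ?h (f ` X) (g ` X)"
    unfolding bij_betw_def
  proof
    show "inj_on ?h (f ` X)" using e assms by (auto simp: inj_on_def)
    show "?h ` f ` X = g ` X" using e by (force simp: image_iff)
  qed
  then show ?thesis by blast
qed

lemma card_images_same_kernel:
  assumes "\<And>x y. x \<in> X \<Longrightarrow> y \<in> X \<Longrightarrow> f x = f y \<longleftrightarrow> g x = g y"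
  shows "card (f ` X) = card (g ` X)"
  using bij_betw_images_same_kernel[of X f g] assms bij_betw_same_card by blast

lemma finite_images_same_kernel:
  assumes "\<And>x y. x \<in> X \<Longrightarrow> y \<in> X \<Longrightarrow> f x = f y \<longleftrightarrow> g x = g y"
  shows "finite (f ` X) \<longleftrightarrow> finite (g ` X)"
  using bij_betw_images_same_kernel[of X f g] assms bij_betw_finite by blast

lemma index_self: "add_subgroup A \<Longrightarrow> index A A = 1"
proof -
  assume A: "add_subgroup A"
  have "coset A ` A = {coset A 0}"
    using A coset_eq_iff[OF A] by (auto simp: add_subgroup_def image_iff)
  then show ?thesis by (simp add: index_def)
qed

text \<open>Both quotients may be infinite here: \<^const>\<open>card\<close> turns the product
  of an infinite set with a nonempty one into 0 on both sides.\<close>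

lemma index_hom:
  fixes f :: "'b::ab_group_add \<Rightarrow> 'c::ab_group_add"
  assumes B: "add_subgroup B" and A: "add_subgroup A" and AB: "A \<subseteq> B"
    and f: "\<And>x y. x \<in> B \<Longrightarrow> y \<in> B \<Longrightarrow> f (x - y) = f x - f y"
  shows "index B A = index (f ` B) (f ` A) * index (B \<inter> f -` {0}) (A \<inter> f -` {0})"
proof -
  let ?K = "f -` {0}"
  have f0: "f 0 = 0" using f[of 0 0] B by (simp add: add_subgroup_def)
  have fadd: "f (x + y) = f x + f y" if "x \<in> B" "y \<in> B" for x y
  proof -
    have "0 - y \<in> B" using B that by (auto simp: add_subgroup_def)
    then have "f (x - (0 - y)) = f x - (f 0 - f y)"
      using f that B by (metis add_subgroup_def)
    then show ?thesis by (simp add: f0)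
  qed
  have fA: "add_subgroup (f ` A)"
    unfolding add_subgroup_def
  proof (intro conjI ballI)
    show "0 \<in> f ` A" using A f0 by (auto simp: add_subgroup_def image_iff intro!: bexI[of _ 0])
    fix x y assume "x \<in> f ` A" "y \<in> f ` A"
    then obtain a b where ab: "a \<in> A" "b \<in> A" "x = f a" "y = f b" by auto
    then have "x - y = f (a - b)" using f[of a b] AB by (simp add: subset_iff)
    then show "x - y \<in> f ` A" using ab add_subgroup_diff[OF A] by auto
  qed
  have AK: "add_subgroup (A \<inter> ?K)"
    using A AB f0 by (auto simp: add_subgroup_def f subset_iff)
  \<comment> \<open>\<open>rep\<close> and \<open>rep0\<close> choose representatives for the
    quotient of the images and for that of the kernels; their sums hit every coset of
    \<open>A\<close> once, although \<open>rep\<close> is not additive.\<close>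
  define rep where "rep Y = (SOME b. b \<in> B \<and> coset (f ` A) (f b) = Y)" for Y
  define rep0 where "rep0 Z = (SOME b. b \<in> B \<inter> ?K \<and> coset (A \<inter> ?K) b = Z)" for Z
  have rep: "rep Y \<in> B \<and> coset (f ` A) (f (rep Y)) = Y" if "Y \<in> coset (f ` A) ` f ` B" for Y
    unfolding rep_def by (rule someI_ex) (use that in auto)
  have rep0: "rep0 Z \<in> B \<inter> ?K \<and> coset (A \<inter> ?K) (rep0 Z) = Z"
    if "Z \<in> coset (A \<inter> ?K) ` (B \<inter> ?K)" for Z
    unfolding rep0_def by (rule someI_ex) (use that in auto)
  let ?g = "\<lambda>(Y, Z). coset A (rep Y + rep0 Z)"
  let ?S = "(coset (f ` A) ` f ` B) \<times> (coset (A \<inter> ?K) ` (B \<inter> ?K))"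
  have "bij_betw ?g ?S (coset A ` B)"
    unfolding bij_betw_def
  proof
    show "inj_on ?g ?S"
    proof (rule inj_onI)
      fix s t assume s: "s \<in> ?S" and t: "t \<in> ?S" and eq: "?g s = ?g t"
      obtain Y Z Y' Z' where [simp]: "s = (Y, Z)" "t = (Y', Z')" by (cases s, cases t)
      have r: "rep Y \<in> B" "rep Y' \<in> B" "rep0 Z \<in> B" "rep0 Z' \<in> B"
        "f (rep0 Z) = 0" "f (rep0 Z') = 0" "coset (f ` A) (f (rep Y)) = Y"
        "coset (f ` A) (f (rep Y')) = Y'"
        "coset (A \<inter> ?K) (rep0 Z) = Z" "coset (A \<inter> ?K) (rep0 Z') = Z'"
        using rep[of Y] rep[of Y'] rep0[of Z] rep0[of Z'] s t by auto
      have d: "(rep Y + rep0 Z) - (rep Y' + rep0 Z') \<in> A"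
        using eq coset_eq_iff[OF A] by simp
      have "f ((rep Y + rep0 Z) - (rep Y' + rep0 Z')) = f (rep Y) - f (rep Y')"
        using r add_subgroup_add[OF B] by (simp add: f fadd)
      then have "f (rep Y) - f (rep Y') \<in> f ` A" using d by (metis imageI)
      then have Y: "Y = Y'" using coset_eq_iff[OF fA] r by metis
      then have "rep0 Z - rep0 Z' \<in> A" using d by simp
      moreover have "f (rep0 Z - rep0 Z') = 0" using f r by simp
      ultimately have "coset (A \<inter> ?K) (rep0 Z) = coset (A \<inter> ?K) (rep0 Z')"
        using coset_eq_iff[OF AK] by auto
      then show "s = t" using Y r by simp
    qed
    show "?g ` ?S = coset A ` B"
    proof
      show "?g ` ?S \<subseteq> coset A ` B"
      proof (clarify)
        fix Y Z b b' assume "b \<in> B" "b' \<in> B" "f b' = 0"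
        then have "rep (coset (f ` A) (f b)) + rep0 (coset (A \<inter> ?K) b') \<in> B"
          using rep[of "coset (f ` A) (f b)"] rep0[of "coset (A \<inter> ?K) b'"] add_subgroup_add[OF B]
          by auto
        then show "coset A (rep (coset (f ` A) (f b)) + rep0 (coset (A \<inter> ?K) b')) \<in> coset A ` B"
          by blast
      qed
      show "coset A ` B \<subseteq> ?g ` ?S"
      proof
        fix W assume "W \<in> coset A ` B"
        then obtain b where b: "b \<in> B" "W = coset A b" by auto
        let ?Y = "coset (f ` A) (f b)"
        have Y: "?Y \<in> coset (f ` A) ` f ` B" using b by auto
        have "f b - f (rep ?Y) \<in> f ` A" using rep[OF Y] coset_eq_iff[OF fA] by metis
        then obtain a where a: "a \<in> A" "f b - f (rep ?Y) = f a" by auto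
        \<comment> \<open>\<open>b - rep ?Y\<close> need not lie in the kernel, but its image is
          \<open>f a\<close> with \<open>a\<close> in \<open>A\<close>; subtracting \<open>a\<close>
          moves it there within its coset.\<close>
        let ?z = "b - rep ?Y - a"
        have z: "?z \<in> B \<inter> ?K"
          using a b rep[OF Y] AB add_subgroup_diff[OF B] by (auto simp: f)
        let ?Z = "coset (A \<inter> ?K) ?z"
        have Z: "?Z \<in> coset (A \<inter> ?K) ` (B \<inter> ?K)" using z by blast
        have "?z - rep0 ?Z \<in> A" using rep0[OF Z] coset_eq_iff[OF AK] by blast
        then have "b - (rep ?Y + rep0 ?Z) \<in> A"
          using add_subgroup_add[OF A _ a(1), of "?z - rep0 ?Z"] by (simp add: algebra_simps)
        then have "W = ?g (?Y, ?Z)" using b coset_eq_iff[OF A] by simp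
        then show "W \<in> ?g ` ?S" using Y Z by blast
      qed
    qed
  qed
  then show ?thesis
    unfolding index_def by (simp add: bij_betw_same_card[symmetric] card_cartesian_product)
qed

lemma card_fibres_const:
  assumes fin: "finite Y" and im: "h ` X \<subseteq> Y"
    and fib: "\<And>y. y \<in> Y \<Longrightarrow> finite {x\<in>X. h x = y} \<and> real (card {x\<in>X. h x = y}) = c"
  shows "finite X \<and> real (card X) = real (card Y) * c"
proof -
  have X: "X = (\<Union>y\<in>Y. {x\<in>X. h x = y})" using im by auto
  have f: "finite X" by (subst X) (use fin fib in auto)
  have "card (\<Union>y\<in>Y. {x\<in>X. h x = y}) = (\<Sum>y\<in>Y. card {x\<in>X. h x = y})"
    by (rule card_UN_disjoint) (use fin fib in auto)
  then have "real (card X) = (\<Sum>y\<in>Y. real (card {x\<in>X. h x = y}))"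
    using X by simp
  also have "\<dots> = (\<Sum>y\<in>Y. c)" using fib by (intro sum.cong) auto
  finally show ?thesis using f by simp
qed

section \<open>Discrete valuation rings\<close>

lemma smult_vec_apply [simp]: "smult_vec c f i = c * f i"
  by (simp add: smult_vec_def)

lemma smult_vec_smult_vec: "smult_vec c (smult_vec d f) = smult_vec (c * d) f"
  by (simp add: smult_vec_def mult.assoc)

lemma smult_vec_add: "smult_vec c (f + g) = smult_vec c f + smult_vec c g"
  by (simp add: smult_vec_def fun_eq_iff distrib_left)

lemma smult_vec_0 [simp]: "smult_vec c 0 = 0"
  by (simp add: smult_vec_def fun_eq_iff)

lemma smult_vec_one [simp]: "smult_vec 1 f = f"
  by (simp add: smult_vec_def)

lemma smult_vec_cancel: "c \<noteq> 0 \<Longrightarrow> smult_vec c f = smult_vec c g \<Longrightarrow> f = g"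
  by (auto simp: smult_vec_def fun_eq_iff)

lemma zero_in_free_mod [simp]: "0 \<in> free_mod n"
  by (simp add: free_mod_def)

lemma add_in_free_mod: "f \<in> free_mod n \<Longrightarrow> g \<in> free_mod n \<Longrightarrow> f + g \<in> free_mod n"
  by (simp add: free_mod_def)

lemma diff_in_free_mod: "f \<in> free_mod n \<Longrightarrow> g \<in> free_mod n \<Longrightarrow> f - g \<in> free_mod n"
  by (simp add: free_mod_def)

lemma smult_in_free_mod: "f \<in> free_mod n \<Longrightarrow> smult_vec c f \<in> free_mod n"
  by (simp add: free_mod_def)

lemma submodule_free_mod: "submodule n (free_mod n)"
  by (simp add: submodule_def add_in_free_mod smult_in_free_mod)

lemma submodule_subset: "submodule n L \<Longrightarrow> L \<subseteq> free_mod n"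
  by (simp add: submodule_def)

lemma submodule_zero: "submodule n L \<Longrightarrow> 0 \<in> L"
  by (simp add: submodule_def)

lemma submodule_add: "submodule n L \<Longrightarrow> f \<in> L \<Longrightarrow> g \<in> L \<Longrightarrow> f + g \<in> L"
  by (simp add: submodule_def)

lemma submodule_smult: "submodule n L \<Longrightarrow> f \<in> L \<Longrightarrow> smult_vec c f \<in> L"
  by (simp add: submodule_def)

lemma submodule_diff:
  assumes "submodule n L" "f \<in> L" "g \<in> L"
  shows "f - g \<in> L"
proof -
  have "f - g = f + smult_vec (-1) g" by (simp add: smult_vec_def fun_eq_iff)
  then show ?thesis using submodule_add[OF assms(1,2) submodule_smult[OF assms(1,3)]] by metis
qed

lemma submodule_subgroup: "submodule n L \<Longrightarrow> add_subgroup L"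
  by (auto simp: add_subgroup_def submodule_zero submodule_diff)

lemma submodule_scale: "submodule n A \<Longrightarrow> submodule n (smult_vec c ` A)"
  unfolding submodule_def
  apply (intro conjI)
     apply (auto simp: smult_in_free_mod)[1]
    apply (metis image_eqI smult_vec_0)
   apply (clarsimp simp flip: smult_vec_add)
  apply (clarsimp simp: smult_vec_smult_vec)
  by (metis image_eqI mult.commute smult_vec_smult_vec)

locale dvr =
  fixes v :: "'a::idom \<Rightarrow> nat" and q :: nat
  assumes dvr: "discrete_valuation_ring v"
    and residue_finite: "finite (residue_field v)"
    and residue_card: "card (residue_field v) = q"
begin

lemma v_mult: "a \<noteq> 0 \<Longrightarrow> b \<noteq> 0 \<Longrightarrow> v (a * b) = v a + v b"
  using dvr unfolding discrete_valuation_ring_def by blast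

lemma v_dvd: "a \<noteq> 0 \<Longrightarrow> b \<noteq> 0 \<Longrightarrow> v a \<le> v b \<Longrightarrow> a dvd b"
  using dvr unfolding discrete_valuation_ring_def by blast

lemma v_1 [simp]: "v 1 = 0"
  using v_mult[of 1 1] by simp

definition unif :: 'a where
  "unif = (SOME a. a \<noteq> 0 \<and> v a = 1)"

lemma unif: "unif \<noteq> 0" "v unif = 1"
proof -
  have "\<exists>a. a \<noteq> 0 \<and> v a = 1" using dvr unfolding discrete_valuation_ring_def by blast
  then have "unif \<noteq> 0 \<and> v unif = 1" unfolding unif_def by (rule someI_ex)
  then show "unif \<noteq> 0" "v unif = 1" by auto
qed

declare unif(1) [simp]

lemma v_unif_pow [simp]: "v (unif ^ k) = k"
  by (induction k) (auto simp: v_mult unif)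

lemma dvd_iff_v: "a \<noteq> 0 \<Longrightarrow> b \<noteq> 0 \<Longrightarrow> a dvd b \<longleftrightarrow> v a \<le> v b"
  using v_dvd v_mult by (metis dvdE le_add1 mult_zero_right)

text \<open>Divisibility by powers of \<open>unif\<close> absorbs the element 0, whose valuation is
  meaningless, so later arguments rarely need \<open>v\<close>.\<close>

lemma mem_pow_ideal: "c \<in> pow_ideal v k \<longleftrightarrow> unif ^ k dvd c"
  by (cases "c = 0") (auto simp: pow_ideal_def dvd_iff_v)

lemma unif_pow_v: "a \<noteq> 0 \<Longrightarrow> unif ^ v a dvd a" "a \<noteq> 0 \<Longrightarrow> a dvd unif ^ v a"
  by (simp_all add: dvd_iff_v)

lemma dvd_iff_unif_pow: "a \<noteq> 0 \<Longrightarrow> a dvd c \<longleftrightarrow> unif ^ v a dvd c"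
  using unif_pow_v dvd_trans by blast

lemma not_unif_dvd_unit: "\<not> unif dvd c \<Longrightarrow> c dvd 1"
proof -
  assume h: "\<not> unif dvd c"
  then have c: "c \<noteq> 0" by auto
  have "\<not> 1 \<le> v c" using h c unif by (simp add: dvd_iff_v)
  then show ?thesis using c by (simp add: dvd_iff_v)
qed

lemma unif_pow_dvd_iff: "unif ^ j dvd unif ^ k \<longleftrightarrow> j \<le> k"
  by (simp add: dvd_iff_v)

definition multiples :: "'a \<Rightarrow> 'a set" where
  "multiples g = {x. g dvd x}"

lemma subgroup_multiples: "add_subgroup (multiples g)"
  by (simp add: add_subgroup_def multiples_def)

lemma residue_index: "index UNIV (multiples unif) = q"
proof -
  have "residue_field v = coset (multiples unif) ` UNIV"
    unfolding residue_field_def quotient_def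
  proof -
    have "{(a, b). a - b \<in> pow_ideal v 1} `` {x} = coset (multiples unif) x" for x
    proof (rule set_eqI)
      fix y
      have "y \<in> coset (multiples unif) x \<longleftrightarrow> unif dvd y - x"
        unfolding coset_def multiples_def image_iff
        by (metis add_diff_cancel_left' add.commute diff_add_cancel mem_Collect_eq)
      then show "y \<in> {(a, b). a - b \<in> pow_ideal v 1} `` {x} \<longleftrightarrow> y \<in> coset (multiples unif) x"
        using mem_pow_ideal[of "x - y" 1] dvd_minus_iff[of unif "y - x"] by simp
    qed
    then show "(\<Union>x. {{(a, b). a - b \<in> pow_ideal v 1} `` {x}}) = range (coset (multiples unif))"
      by auto
  qed
  then show ?thesis using residue_card by (simp add: index_def)
qed

text \<open>Makes every power of \<open>q\<close> nonzero, which later certifies that coset sets are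
  finite, and lets equal powers of \<open>q\<close> be compared by exponents.\<close>

lemma q_ge_2: "q \<ge> 2"
proof -
  let ?R = "coset (multiples unif) ` UNIV"
  have "coset (multiples unif) 0 \<noteq> coset (multiples unif) 1"
    using coset_eq_iff[OF subgroup_multiples, of unif 0 1] unif dvd_iff_v[of unif 1]
    by (auto simp: multiples_def)
  then have two: "card {coset (multiples unif) 0, coset (multiples unif) 1} = 2" by simp
  have "q \<noteq> 0"
  proof -
    have "residue_field v \<noteq> {}" by (auto simp: residue_field_def quotient_def)
    then show ?thesis using residue_finite residue_card by auto
  qed
  then have "finite ?R" using residue_index by (metis card.infinite index_def)
  then have "card {coset (multiples unif) 0, coset (multiples unif) 1} \<le> card ?R"
    by (intro card_mono) auto
  then show ?thesis using two residue_index by (simp add: index_def)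
qed

lemma index_multiples:
  assumes g: "g \<noteq> 0"
  shows "index (multiples g) (multiples (unif * g)) = q"
proof -
  have m: "multiples g = (*) g ` UNIV" by (auto simp: multiples_def dvd_def)
  have "card ((\<lambda>x. coset (multiples (unif * g)) (g * x)) ` UNIV) = card (coset (multiples unif) ` UNIV)"
  proof (rule card_images_same_kernel)
    fix x y
    have "unif * g dvd g * x - g * y \<longleftrightarrow> unif dvd x - y"
      using g by (metis dvd_mult_cancel_left mult.commute right_diff_distrib)
    then show "coset (multiples (unif * g)) (g * x) = coset (multiples (unif * g)) (g * y) \<longleftrightarrow>
        coset (multiples unif) x = coset (multiples unif) y"
      by (simp add: coset_eq_iff subgroup_multiples) (simp add: multiples_def)
  qed
  then show ?thesis using residue_index by (simp add: index_def m image_image)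
qed

end

section \<open>Leading coefficients of submodules\<close>

text \<open>The flag is chosen to fit upper-triangular matrices: row \<open>i\<close> of such a
  matrix lies in \<open>tail i\<close>, and its diagonal entry is then an element of
  \<open>lead L i\<close>.\<close>

definition tail :: "nat \<Rightarrow> (nat \<Rightarrow> 'a::idom) set" where
  "tail i = {f. \<forall>j<i. f j = 0}"

definition lead :: "(nat \<Rightarrow> 'a::idom) set \<Rightarrow> nat \<Rightarrow> 'a set" where
  "lead L i = (\<lambda>f. f i) ` (L \<inter> tail i)"

lemma tail_Suc: "tail (Suc i) = tail i \<inter> (\<lambda>f. f i) -` {0}"
  by (auto simp: tail_def less_Suc_eq)

lemma tail_mono: "i \<le> j \<Longrightarrow> tail j \<subseteq> tail i"
  by (auto simp: tail_def)

lemma add_in_tail: "f \<in> tail i \<Longrightarrow> g \<in> tail i \<Longrightarrow> f + g \<in> tail i"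
  by (simp add: tail_def)

lemma diff_in_tail: "f \<in> tail i \<Longrightarrow> g \<in> tail i \<Longrightarrow> f - g \<in> tail i"
  by (simp add: tail_def)

lemma smult_in_tail: "f \<in> tail i \<Longrightarrow> smult_vec c f \<in> tail i"
  by (simp add: tail_def)

lemma smult_in_tailD: "smult_vec c f \<in> tail i \<Longrightarrow> c \<noteq> 0 \<Longrightarrow> f \<in> tail i"
  by (simp add: tail_def)

lemma zero_in_tail [simp]: "0 \<in> tail i"
  by (simp add: tail_def)

lemma free_mod_tail_1: "f \<in> free_mod n \<Longrightarrow> f \<in> tail (Suc 0)"
  by (simp add: tail_def free_mod_def)

lemma free_mod_tail_Suc: "f \<in> free_mod n \<Longrightarrow> f \<in> tail (Suc n) \<Longrightarrow> f = 0"
  by (rule ext, rename_tac x, case_tac "x \<le> n") (auto simp: tail_def free_mod_def)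

lemma submodule_tail: "submodule n L \<Longrightarrow> submodule n (L \<inter> tail i)"
  by (auto simp: submodule_def add_in_tail smult_in_tail)

lemma lead_mono: "A \<subseteq> B \<Longrightarrow> lead A i \<subseteq> lead B i"
  by (auto simp: lead_def)

lemma leadI: "f \<in> L \<Longrightarrow> f \<in> tail i \<Longrightarrow> f i \<in> lead L i"
  by (auto simp: lead_def)

lemma leadE: "x \<in> lead L i \<Longrightarrow> (\<And>f. f \<in> L \<Longrightarrow> f \<in> tail i \<Longrightarrow> f i = x \<Longrightarrow> thesis) \<Longrightarrow> thesis"
  by (auto simp: lead_def)

lemma lead_tail: "i \<le> k \<Longrightarrow> lead (L \<inter> tail i) k = lead L k"
  using tail_mono[of i k] by (auto simp: lead_def)

lemma lead_scale:
  assumes "c \<noteq> 0"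
  shows "lead (smult_vec c ` L) i = (*) c ` lead L i"
proof
  show "lead (smult_vec c ` L) i \<subseteq> (*) c ` lead L i"
    using assms by (auto elim!: leadE dest!: smult_in_tailD intro: leadI)
  show "(*) c ` lead L i \<subseteq> lead (smult_vec c ` L) i"
  proof (clarify elim!: leadE)
    fix f assume "f \<in> L" "f \<in> tail i"
    then have "smult_vec c f i \<in> lead (smult_vec c ` L) i"
      by (intro leadI imageI) (auto simp: smult_in_tail simp del: smult_vec_apply)
    then show "c * f i \<in> lead (smult_vec c ` L) i" by simp
  qed
qed

text \<open>Working down from \<open>tail (Suc n)\<close>, a vector of \<open>B\<close> is corrected
  by a vector of \<open>A\<close> with the same leading entry, which pushes it one step further into
  the flag.\<close>

lemma submodule_eqI_lead:
  assumes A: "submodule n A" and B: "submodule n B" and AB: "A \<subseteq> B"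
    and ld: "\<And>i. i \<in> {1..n} \<Longrightarrow> lead B i \<subseteq> lead A i"
  shows "A = B"
proof -
  have "B \<inter> tail (Suc 0) \<subseteq> A"
  proof (rule inc_induct[of "Suc 0" "Suc n" "\<lambda>i. B \<inter> tail i \<subseteq> A"])
    show "Suc 0 \<le> Suc n" by simp
    show "B \<inter> tail (Suc n) \<subseteq> A"
      using free_mod_tail_Suc submodule_subset[OF B] submodule_zero[OF A] by blast
    fix i assume i: "Suc 0 \<le> i" "i < Suc n" and IH: "B \<inter> tail (Suc i) \<subseteq> A"
    show "B \<inter> tail i \<subseteq> A"
    proof
      fix f assume f: "f \<in> B \<inter> tail i"
      then have "f i \<in> lead A i" using ld[of i] i by (auto intro: leadI)
      then obtain g where g: "g \<in> A" "g \<in> tail i" "g i = f i" by (rule leadE)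
      have "f - g \<in> B \<inter> tail (Suc i)"
        using f g AB submodule_diff[OF B] by (auto simp: tail_Suc diff_in_tail)
      then have "f - g \<in> A" using IH by blast
      then have "(f - g) + g \<in> A" using submodule_add[OF A] g by blast
      then show "f \<in> A" by simp
    qed
  qed
  then show ?thesis using AB submodule_subset[OF B] free_mod_tail_1 by blast
qed

definition extend :: "(nat \<Rightarrow> 'a::idom) set \<Rightarrow> (nat \<Rightarrow> 'a) \<Rightarrow> (nat \<Rightarrow> 'a) set" where
  "extend S x = {s + smult_vec c x | s c. s \<in> S}"

lemma extendI: "s \<in> S \<Longrightarrow> s + smult_vec c x \<in> extend S x"
  by (auto simp: extend_def)

lemma extendI': "s \<in> S \<Longrightarrow> f = s + smult_vec c x \<Longrightarrow> f \<in> extend S x"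
  by (auto simp: extend_def)

lemma extendE:
  "f \<in> extend S x \<Longrightarrow> (\<And>s c. s \<in> S \<Longrightarrow> f = s + smult_vec c x \<Longrightarrow> thesis) \<Longrightarrow> thesis"
  by (auto simp: extend_def)

lemma extend_self: "0 \<in> S \<Longrightarrow> x \<in> extend S x"
  by (rule extendI'[of 0 _ _ 1]) auto

lemma extend_superset: "S \<subseteq> extend S x"
  by (auto intro!: extendI'[of _ _ _ 0] simp: smult_vec_def fun_eq_iff)

lemma submodule_extend:
  assumes S: "submodule n S" and x: "x \<in> free_mod n"
  shows "submodule n (extend S x)"
  unfolding submodule_def
proof (intro conjI ballI allI)
  show "extend S x \<subseteq> free_mod n"
    using submodule_subset[OF S] x by (auto elim!: extendE intro!: add_in_free_mod smult_in_free_mod)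
  show "0 \<in> extend S x" using extend_superset submodule_zero[OF S] by blast
  fix f assume f: "f \<in> extend S x"
  then obtain s c where sc: "s \<in> S" "f = s + smult_vec c x" by (rule extendE)
  show "f + g \<in> extend S x" if "g \<in> extend S x" for g
  proof -
    obtain s' c' where "s' \<in> S" "g = s' + smult_vec c' x" using \<open>g \<in> extend S x\<close> by (rule extendE)
    then show ?thesis
      using sc by (intro extendI'[of "s + s'" _ _ "c + c'"])
        (auto simp: submodule_add[OF S] fun_eq_iff algebra_simps)
  qed
  show "smult_vec d f \<in> extend S x" for d
    using sc by (intro extendI'[of "smult_vec d s" _ _ "d * c"])
      (auto simp: submodule_smult[OF S] fun_eq_iff algebra_simps)
qed

lemma extend_subset:
  assumes "submodule n S" "T \<subseteq> S" "x \<in> S"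
  shows "extend T x \<subseteq> S"
proof
  fix f assume "f \<in> extend T x"
  then obtain s c where "s \<in> T" "f = s + smult_vec c x" by (rule extendE)
  then show "f \<in> S" using submodule_add[OF assms(1)] submodule_smult[OF assms(1,3)] assms(2) by blast
qed

lemma extend_Int_tail:
  assumes S: "S \<subseteq> tail (Suc i)" and x: "x i \<noteq> 0"
  shows "extend S x \<inter> tail (Suc i) = S"
proof
  show "extend S x \<inter> tail (Suc i) \<subseteq> S"
  proof
    fix f assume f: "f \<in> extend S x \<inter> tail (Suc i)"
    then obtain s c where sc: "s \<in> S" "f = s + smult_vec c x" by (auto elim: extendE)
    have "f i = 0" "s i = 0" using f sc S by (auto simp: tail_def)
    then have "c = 0" using sc x by simp
    then have "f = s" using sc by (simp add: smult_vec_def fun_eq_iff)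
    then show "f \<in> S" using sc by simp
  qed
  show "S \<subseteq> extend S x \<inter> tail (Suc i)" using S extend_superset by blast
qed

lemma extend_subset_tail:
  assumes S: "S \<subseteq> tail (Suc i)" and x: "x \<in> tail i"
  shows "extend S x \<subseteq> tail i"
  using S x by (auto elim!: extendE simp: tail_Suc intro!: add_in_tail smult_in_tail)

lemma (in dvr) lead_extend:
  assumes S: "S \<subseteq> tail (Suc i)" "0 \<in> S" and x: "x \<in> tail i"
  shows "lead (extend S x) i = multiples (x i)"
proof -
  have S0: "s i = 0" if "s \<in> S" for s using S(1) that by (auto simp: tail_def)
  show ?thesis
  proof
    show "lead (extend S x) i \<subseteq> multiples (x i)"
      by (auto elim!: leadE extendE simp: S0 multiples_def)
    show "multiples (x i) \<subseteq> lead (extend S x) i"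
    proof
      fix y assume "y \<in> multiples (x i)"
      then obtain c where c: "y = x i * c" by (auto simp: multiples_def)
      have "(0 + smult_vec c x) i \<in> lead (extend S x) i"
        by (intro leadI extendI[OF S(2)] add_in_tail smult_in_tail[OF x] zero_in_tail)
      then show "y \<in> lead (extend S x) i" using c by (simp add: mult.commute)
    qed
  qed
qed

lemma lead_extend_above:
  assumes S: "S \<subseteq> tail (Suc i)" and x: "x i \<noteq> 0" and k: "i < k"
  shows "lead (extend S x) k = lead S k"
  using extend_Int_tail[of S i x, OF S x] lead_tail[of "Suc i" k "extend S x"] k by simp

context dvr
begin

lemma multiples_scale: "(*) c ` multiples g = multiples (c * g)"
  by (auto simp: multiples_def mult.assoc elim!: dvdE intro!: image_eqI)

lemma multiples_self [simp]: "g \<in> multiples g"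
  by (simp add: multiples_def)

lemma multiples_unif_neq: "g \<noteq> 0 \<Longrightarrow> multiples (unif * g) \<noteq> multiples g"
proof
  assume g: "g \<noteq> 0" and "multiples (unif * g) = multiples g"
  then have "g \<in> multiples (unif * g)" by simp
  then have "unif * g dvd 1 * g" by (simp add: multiples_def)
  then have "unif dvd 1" using g dvd_mult_cancel_right by blast
  then show False using dvd_iff_v[of unif 1] unif by simp
qed

text \<open>Projection to coordinate \<open>k\<close> splits off one flag step:
  \<open>index_hom\<close> gives the index of the lead ideals times the index of the next step. A
  position contributes \<open>q\<close> if it lies in \<open>J\<close> and 1 otherwise.\<close>

lemma index_submodule:
  assumes A: "submodule n A" and B: "submodule n B" and AB: "A \<subseteq> B"
    and i: "1 \<le> i" "i \<le> Suc n"
    and ld: "\<And>k. k \<in> {i..n} \<Longrightarrow> g k \<noteq> 0 \<and> lead B k = multiples (g k) \<and>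
              lead A k = multiples (if k \<in> J then unif * g k else g k)"
  shows "index (B \<inter> tail i) (A \<inter> tail i) = q ^ card (J \<inter> {i..n})"
  using i(2)
proof (rule inc_induct)
  have "B \<inter> tail (Suc n) = {0}" "A \<inter> tail (Suc n) = {0}"
    using free_mod_tail_Suc submodule_subset[OF B] submodule_subset[OF A]
      submodule_zero[OF B] submodule_zero[OF A] by auto
  then show "index (B \<inter> tail (Suc n)) (A \<inter> tail (Suc n)) = q ^ card (J \<inter> {Suc n..n})"
    by (simp add: index_def)
next
  fix k assume k: "i \<le> k" "k < Suc n"
    and IH: "index (B \<inter> tail (Suc k)) (A \<inter> tail (Suc k)) = q ^ card (J \<inter> {Suc k..n})"
  let ?f = "\<lambda>f. f k"
  have l: "g k \<noteq> 0" "lead B k = multiples (g k)"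
    "lead A k = multiples (if k \<in> J then unif * g k else g k)"
    using ld[of k] k by auto
  have "index (B \<inter> tail k) (A \<inter> tail k) =
      index (?f ` (B \<inter> tail k)) (?f ` (A \<inter> tail k)) *
      index (B \<inter> tail k \<inter> ?f -` {0}) (A \<inter> tail k \<inter> ?f -` {0})"
    by (rule index_hom) (use AB A B in \<open>auto intro: submodule_subgroup submodule_tail\<close>)
  also have "\<dots> = index (lead B k) (lead A k) * index (B \<inter> tail (Suc k)) (A \<inter> tail (Suc k))"
    by (simp add: lead_def tail_Suc Int_assoc)
  also have "index (lead B k) (lead A k) = (if k \<in> J then q else 1)"
    using l index_multiples by (auto simp: index_self subgroup_multiples)
  also have "\<dots> * index (B \<inter> tail (Suc k)) (A \<inter> tail (Suc k)) = q ^ card (J \<inter> {k..n})"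
  proof -
    have "{k..n} = insert k {Suc k..n}" using k by auto
    then show ?thesis using IH by (auto simp: Int_insert_right)
  qed
  finally show "index (B \<inter> tail k) (A \<inter> tail k) = q ^ card (J \<inter> {k..n})" .
qed

end

section \<open>Counting the lattices with a given saturation\<close>

text \<open>Modulo \<^term>\<open>smult_vec unif ` B\<close>, the set \<^term>\<open>B\<close> is a vector space over the residue field
  with a complete flag, and \<^term>\<open>P\<close> is a subspace which jumps in the steps \<^term>\<open>E\<close>. The set
  \<open>partial_complements i\<close> consists of the subspaces of the flag member of index \<open>i\<close> that meet
  \<^term>\<open>P\<close> trivially and jump exactly in the steps outside \<^term>\<open>C\<close>.\<close>

locale flag_count = dvr v q for v :: "'a::idom \<Rightarrow> nat" and q :: nat +
  fixes n :: nat and B P :: "(nat \<Rightarrow> 'a) set" and C E :: "nat set" and \<beta> :: "nat \<Rightarrow> 'a"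
  assumes B: "submodule n B" and P: "submodule n P"
    and scale_B_P: "smult_vec unif ` B \<subseteq> P" and P_B: "P \<subseteq> B"
    and \<beta>_nz: "\<And>k. k \<in> {1..n} \<Longrightarrow> \<beta> k \<noteq> 0"
    and lead_B: "\<And>k. k \<in> {1..n} \<Longrightarrow> lead B k = multiples (\<beta> k)"
    and lead_P: "\<And>k. k \<in> {1..n} \<Longrightarrow>
      lead P k = multiples (if k \<in> E then \<beta> k else unif * \<beta> k)"
begin

definition partial_complements :: "nat \<Rightarrow> (nat \<Rightarrow> 'a) set set" where
  "partial_complements i = {S. submodule n S \<and> S \<subseteq> B \<inter> tail i \<and>
     smult_vec unif ` (B \<inter> tail i) \<subseteq> S \<and> S \<inter> P \<subseteq> smult_vec unif ` B \<and>
     (\<forall>k\<in>{i..n}. lead S k = multiples (if k \<in> C then unif * \<beta> k else \<beta> k))}"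

lemma scale_tail: "smult_vec unif ` B \<inter> tail i = smult_vec unif ` (B \<inter> tail i)"
proof
  show "smult_vec unif ` B \<inter> tail i \<subseteq> smult_vec unif ` (B \<inter> tail i)"
  proof clarify
    fix f assume f: "f \<in> B" "smult_vec unif f \<in> tail i"
    have "f \<in> tail i" by (rule smult_in_tailD[OF f(2) unif(1)])
    then show "smult_vec unif f \<in> smult_vec unif ` (B \<inter> tail i)"
      by (intro imageI IntI f(1))
  qed
qed (auto simp: smult_in_tail)

lemma lead_scale_B: "k \<in> {1..n} \<Longrightarrow> lead (smult_vec unif ` B) k = multiples (unif * \<beta> k)"
  by (simp add: lead_scale lead_B multiples_scale)

lemma restrict_partial:
  assumes i: "i \<in> {1..n}" and S: "S \<in> partial_complements i"
  shows "S \<inter> tail (Suc i) \<in> partial_complements (Suc i)"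
  unfolding partial_complements_def
proof (intro CollectI conjI ballI)
  note S' = S[unfolded partial_complements_def]
  show "submodule n (S \<inter> tail (Suc i))" using S' by (auto intro: submodule_tail)
  show "S \<inter> tail (Suc i) \<subseteq> B \<inter> tail (Suc i)" using S' by auto
  show "smult_vec unif ` (B \<inter> tail (Suc i)) \<subseteq> S \<inter> tail (Suc i)"
    using S' tail_mono[of i "Suc i"] by (force simp: smult_in_tail)
  show "S \<inter> tail (Suc i) \<inter> P \<subseteq> smult_vec unif ` B" using S' by auto
  fix k assume "k \<in> {Suc i..n}"
  then show "lead (S \<inter> tail (Suc i)) k = multiples (if k \<in> C then unif * \<beta> k else \<beta> k)"
    using S' lead_tail[of "Suc i" k S] by auto
qed

text \<open>By linearity one vector \<open>b\<close> whose leading entry generates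
  \<open>lead B i\<close> suffices: subtracting a multiple of it leaves a vector of the next flag
  member, which \<open>S\<close> takes care of.\<close>

lemma scale_in_extend:
  assumes S: "S \<in> partial_complements (Suc i)" and i: "i \<in> {1..n}"
    and b: "b \<in> B" "b \<in> tail i" "b i = \<beta> i" and ub: "smult_vec unif b \<in> extend S x"
    and x: "x \<in> free_mod n"
  shows "smult_vec unif ` (B \<inter> tail i) \<subseteq> extend S x"
proof (clarify)
  fix g assume g: "g \<in> B" "g \<in> tail i"
  have Sm: "submodule n S" and sub: "smult_vec unif ` (B \<inter> tail (Suc i)) \<subseteq> S"
    using S by (auto simp: partial_complements_def)
  have "g i \<in> multiples (\<beta> i)" using leadI[OF g] lead_B[OF i] by simp
  then obtain c where c: "g i = \<beta> i * c" by (auto simp: multiples_def)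
  have "g - smult_vec c b \<in> B \<inter> tail (Suc i)"
    using g b c by (auto simp: tail_Suc diff_in_tail smult_in_tail submodule_diff[OF B] submodule_smult[OF B])
  then have 1: "smult_vec unif (g - smult_vec c b) \<in> extend S x" using sub extend_superset by blast
  have ext: "submodule n (extend S x)" by (rule submodule_extend[OF Sm x])
  have "smult_vec unif (g - smult_vec c b) + smult_vec c (smult_vec unif b) \<in> extend S x"
    using submodule_add[OF ext 1 submodule_smult[OF ext ub]] .
  moreover have "smult_vec unif (g - smult_vec c b) + smult_vec c (smult_vec unif b) = smult_vec unif g"
    by (simp add: fun_eq_iff algebra_simps)
  ultimately show "smult_vec unif g \<in> extend S x" by simp
qed

text \<open>Any vector whose leading entry generates the lead ideal pins \<open>S\<close> down over
  its restriction; fibres are thus counted by such vectors modulo the restriction.\<close>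

lemma eq_extend:
  assumes S: "S \<in> partial_complements i" and i: "i \<in> {1..n}"
    and x: "x \<in> S" "lead S i = multiples (x i)"
  shows "S = extend (S \<inter> tail (Suc i)) x"
proof
  have Sm: "submodule n S" and St: "S \<subseteq> tail i" using S by (auto simp: partial_complements_def)
  show "extend (S \<inter> tail (Suc i)) x \<subseteq> S" by (rule extend_subset[OF Sm]) (use x in auto)
  show "S \<subseteq> extend (S \<inter> tail (Suc i)) x"
  proof
    fix f assume f: "f \<in> S"
    then have "f i \<in> multiples (x i)" using x St by (metis leadI subsetD)
    then obtain c where c: "f i = x i * c" by (auto simp: multiples_def)
    have "f - smult_vec c x \<in> S \<inter> tail (Suc i)"
      using f x St c by (auto simp: tail_Suc submodule_diff[OF Sm] submodule_smult[OF Sm])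
    then show "f \<in> extend (S \<inter> tail (Suc i)) x" by (rule extendI'[of _ _ _ c]) simp
  qed
qed

lemma partial_props:
  assumes "S \<in> partial_complements i"
  shows "submodule n S" "S \<subseteq> B" "S \<subseteq> tail i" "smult_vec unif ` (B \<inter> tail i) \<subseteq> S"
    "S \<inter> P \<subseteq> smult_vec unif ` B" "0 \<in> S"
    "\<And>k. k \<in> {i..n} \<Longrightarrow> lead S k = multiples (if k \<in> C then unif * \<beta> k else \<beta> k)"
  using assms by (auto simp: partial_complements_def submodule_def)

lemma extend_in_partial:
  assumes S: "S \<in> partial_complements (Suc i)" and i: "i \<in> {1..n}"
    and b: "b \<in> B" "b \<in> tail i" "b i = \<beta> i" and ub: "smult_vec unif b \<in> extend S x"
    and x: "x \<in> B" "x \<in> tail i" "x i = (if i \<in> C then unif * \<beta> i else \<beta> i)"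
    and triv: "extend S x \<inter> P \<subseteq> smult_vec unif ` B"
  shows "extend S x \<in> partial_complements i" "extend S x \<inter> tail (Suc i) = S"
proof -
  note Sp = partial_props[OF S]
  have xM: "x \<in> free_mod n" using x submodule_subset[OF B] by auto
  have xi: "x i \<noteq> 0" using x \<beta>_nz[OF i] by auto
  show "extend S x \<inter> tail (Suc i) = S" by (rule extend_Int_tail[of S i x, OF Sp(3) xi])
  show "extend S x \<in> partial_complements i"
    unfolding partial_complements_def
  proof (intro CollectI conjI ballI)
    show "submodule n (extend S x)" by (rule submodule_extend[OF Sp(1) xM])
    show "extend S x \<subseteq> B \<inter> tail i"
      using extend_subset[OF B Sp(2) x(1)] extend_subset_tail[OF Sp(3) x(2)] by blast
    show "smult_vec unif ` (B \<inter> tail i) \<subseteq> extend S x" by (rule scale_in_extend[OF S i b ub xM])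
    show "extend S x \<inter> P \<subseteq> smult_vec unif ` B" by (rule triv)
    fix k assume k: "k \<in> {i..n}"
    show "lead (extend S x) k = multiples (if k \<in> C then unif * \<beta> k else \<beta> k)"
    proof (cases "k = i")
      case True
      then show ?thesis using lead_extend[OF Sp(3,6) x(2)] x(3) by simp
    next
      case False
      then show ?thesis
        using lead_extend_above[of S i x k, OF Sp(3) xi] Sp(7)[of k] k by simp
    qed
  qed
qed

text \<open>At an index of \<open>C\<close> the subspace does not grow:
  \<open>smult_vec unif b\<close> is forced into every extension and its leading entry already
  generates the prescribed lead ideal, so there is no choice.\<close>

lemma fibre_in_C:
  assumes S: "S \<in> partial_complements (Suc i)" and i: "i \<in> {1..n}" and iC: "i \<in> C"
  shows "\<exists>x. {T \<in> partial_complements i. T \<inter> tail (Suc i) = S} = {extend S x}"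
proof -
  note Sp = partial_props[OF S]
  have "\<beta> i \<in> lead B i" using lead_B[OF i] by simp
  then obtain b where b: "b \<in> B" "b \<in> tail i" "b i = \<beta> i" by (rule leadE)
  let ?x = "smult_vec unif b"
  have x: "?x \<in> B" "?x \<in> tail i" "?x i = (if i \<in> C then unif * \<beta> i else \<beta> i)"
    using b iC by (auto simp: submodule_smult[OF B] smult_in_tail)
  have triv: "extend S ?x \<inter> P \<subseteq> smult_vec unif ` B"
  proof
    fix f assume f: "f \<in> extend S ?x \<inter> P"
    then obtain s c where sc: "s \<in> S" "f = s + smult_vec c ?x" by (auto elim: extendE)
    have pB: "submodule n (smult_vec unif ` B)" by (rule submodule_scale[OF B])
    have cx: "smult_vec c ?x \<in> smult_vec unif ` B" using submodule_smult[OF pB] b by blast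
    have "f - smult_vec c ?x \<in> P" using submodule_diff[OF P] f cx scale_B_P by blast
    then have "s \<in> smult_vec unif ` B" using sc Sp(5) by auto
    then show "f \<in> smult_vec unif ` B" using sc submodule_add[OF pB _ cx] by blast
  qed
  have "{T \<in> partial_complements i. T \<inter> tail (Suc i) = S} = {extend S ?x}"
  proof
    show "{extend S ?x} \<subseteq> {T \<in> partial_complements i. T \<inter> tail (Suc i) = S}"
      using extend_in_partial[OF S i b extend_self[OF Sp(6)] x triv] by auto
    show "{T \<in> partial_complements i. T \<inter> tail (Suc i) = S} \<subseteq> {extend S ?x}"
    proof clarify
      fix T assume T: "T \<in> partial_complements i" "S = T \<inter> tail (Suc i)"
      have "?x \<in> T" using partial_props(4)[OF T(1)] b by blast
      moreover have "lead T i = multiples (?x i)"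
        using partial_props(7)[OF T(1), of i] i iC b by simp
      ultimately show "T = extend (T \<inter> tail (Suc i)) ?x" by (rule eq_extend[OF T(1) i])
    qed
  qed
  then show ?thesis by blast
qed

text \<open>These cosets are the possible correction terms for a new generator; the lead ideals of
  \<open>S\<close> and \<open>B\<close> differ exactly at \<open>C\<close>.\<close>

lemma card_cosets_B:
  assumes S: "S \<in> partial_complements (Suc i)" and i: "i \<in> {1..n}"
  shows "card (coset S ` (B \<inter> tail (Suc i))) = q ^ card (C \<inter> {Suc i..n})"
proof -
  note Sp = partial_props[OF S]
  have "index (B \<inter> tail (Suc i)) (S \<inter> tail (Suc i)) = q ^ card (C \<inter> {Suc i..n})"
    by (rule index_submodule[OF Sp(1) B Sp(2), of _ \<beta>])
      (use i Sp(7) lead_B \<beta>_nz in \<open>auto\<close>)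
  moreover have "S \<inter> tail (Suc i) = S" using Sp(3) by blast
  ultimately show ?thesis by (simp add: index_def)
qed

text \<open>Because \<open>S\<close> meets \<open>P\<close> only inside unif \<open>B\<close>,
  vectors of \<open>P\<close> in this flag member agree modulo \<open>S\<close> exactly when they
  agree modulo unif \<open>B\<close>. So this is the size of a piece of \<open>P\<close> modulo unif
  \<open>B\<close>, which jumps at \<open>E\<close>.\<close>

lemma card_cosets_P:
  assumes S: "S \<in> partial_complements (Suc i)" and i: "i \<in> {1..n}"
  shows "card (coset S ` (P \<inter> tail (Suc i))) = q ^ card (E \<inter> {Suc i..n})"
proof -
  note Sp = partial_props[OF S]
  let ?pB = "smult_vec unif ` B"
  have pB: "submodule n ?pB" by (rule submodule_scale[OF B])
  have "index (P \<inter> tail (Suc i)) (?pB \<inter> tail (Suc i)) = q ^ card (E \<inter> {Suc i..n})"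
    by (rule index_submodule[OF pB P scale_B_P, of _ "\<lambda>k. if k \<in> E then \<beta> k else unif * \<beta> k"])
      (use i lead_P lead_scale_B \<beta>_nz in \<open>auto\<close>)
  moreover have "card (coset S ` (P \<inter> tail (Suc i))) = card (coset (?pB \<inter> tail (Suc i)) ` (P \<inter> tail (Suc i)))"
  proof (rule card_images_same_kernel)
    fix x y assume xy: "x \<in> P \<inter> tail (Suc i)" "y \<in> P \<inter> tail (Suc i)"
    have "x - y \<in> P \<inter> tail (Suc i)" using xy by (auto simp: submodule_diff[OF P] diff_in_tail)
    then have "x - y \<in> S \<longleftrightarrow> x - y \<in> ?pB \<inter> tail (Suc i)"
      using Sp(3,4,5) scale_tail[of "Suc i"] by blast
    then show "coset S x = coset S y \<longleftrightarrow>
        coset (?pB \<inter> tail (Suc i)) x = coset (?pB \<inter> tail (Suc i)) y"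
      using coset_eq_iff[OF submodule_subgroup[OF Sp(1)]]
        coset_eq_iff[OF submodule_subgroup[OF submodule_tail[OF pB]]] by blast
  qed
  ultimately show ?thesis by (simp add: index_def)
qed

text \<open>A lift is generated over \<open>S\<close> by \<open>b + w\<close>, with \<open>w\<close>
  in the next flag member and determined modulo \<open>S\<close>. If \<open>i\<close> is in
  \<open>E\<close>, the lift meets \<open>P\<close> nontrivially exactly when \<open>w\<close> is
  congruent to a vector of \<open>P\<close>; otherwise no vector of \<open>P\<close> has a unit
  times \<open>\<beta> i\<close> as leading entry, and every \<open>w\<close> is allowed.\<close>

lemma fibre_not_in_C:
  assumes S: "S \<in> partial_complements (Suc i)" and i: "i \<in> {1..n}" and iC: "i \<notin> C"
  defines "F \<equiv> {T \<in> partial_complements i. T \<inter> tail (Suc i) = S}"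
  shows "finite F \<and> real (card F) = real q ^ card (C \<inter> {Suc i..n}) -
    (if i \<in> E then real q ^ card (E \<inter> {Suc i..n}) else 0)"
proof -
  note Sp = partial_props[OF S]
  note Sg = submodule_subgroup[OF Sp(1)]
  let ?pB = "smult_vec unif ` B"
  let ?B = "B \<inter> tail (Suc i)" and ?P = "P \<inter> tail (Suc i)"
  have pB: "submodule n ?pB" by (rule submodule_scale[OF B])
  \<comment> \<open>Taking \<open>b\<close> inside \<open>P\<close> whenever \<open>P\<close> jumps
    at \<open>i\<close> makes the forbidden \<open>w\<close> those congruent to vectors of
    \<open>P\<close>, with no translation by \<open>b\<close>.\<close>
  have "\<exists>b\<in>B \<inter> tail i. b i = \<beta> i \<and> (i \<in> E \<longrightarrow> b \<in> P)"
  proof (cases "i \<in> E")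
    case True
    then have "\<beta> i \<in> lead P i" using lead_P[OF i] by simp
    then show ?thesis using P_B by (auto elim!: leadE)
  next
    case False
    have "\<beta> i \<in> lead B i" using lead_B[OF i] by simp
    then show ?thesis using False by (auto elim!: leadE)
  qed
  then obtain b where b: "b \<in> B" "b \<in> tail i" "b i = \<beta> i" and bP: "i \<in> E \<Longrightarrow> b \<in> P" by auto
  define bad where "bad = {w \<in> ?B. i \<in> E \<and> coset S w \<in> coset S ` ?P}"
  have bad_iff: "w \<in> bad \<longleftrightarrow> i \<in> E \<and> (\<exists>y\<in>?P. w - y \<in> S)" if "w \<in> ?B" for w
    using that coset_eq_iff[OF Sg] by (auto simp: bad_def image_iff)
  have fib: "F = (\<lambda>w. extend S (b + w)) ` (?B - bad)"
  proof
    show "F \<subseteq> (\<lambda>w. extend S (b + w)) ` (?B - bad)"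
    proof
      fix T assume "T \<in> F"
      then have T: "T \<in> partial_complements i" and TS: "T \<inter> tail (Suc i) = S" by (auto simp: F_def)
      note Tp = partial_props[OF T]
      have lT: "lead T i = multiples (\<beta> i)" using Tp(7)[of i] i iC by simp
      then have "\<beta> i \<in> lead T i" by simp
      then obtain t where t: "t \<in> T" "t \<in> tail i" "t i = \<beta> i" by (rule leadE)
      have w: "t - b \<in> ?B"
        using t b Tp(2) by (auto simp: tail_Suc diff_in_tail submodule_diff[OF B])
      have Te: "T = extend S (b + (t - b))"
        using eq_extend[OF T i t(1)] lT t(3) TS by simp
      have "t - b \<notin> bad"
      proof
        assume "t - b \<in> bad"
        then obtain y where iE: "i \<in> E" and y: "y \<in> ?P" "t - b - y \<in> S"
          using bad_iff[OF w] by blast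
        have "t - (t - b - y) \<in> T" using y TS t submodule_diff[OF Tp(1)] by blast
        then have "b + y \<in> T" by simp
        moreover have "b + y \<in> P" using bP[OF iE] y submodule_add[OF P] by blast
        ultimately have "b + y \<in> ?pB" using Tp(5) by blast
        moreover have "b + y \<in> tail i"
          using b y tail_mono[of i "Suc i"] by (auto intro: add_in_tail)
        ultimately have "(b + y) i \<in> lead ?pB i" by (rule leadI)
        moreover have "y i = 0" using y by (auto simp: tail_def)
        ultimately have "unif * \<beta> i dvd \<beta> i"
          using lead_scale_B[OF i] b by (simp add: multiples_def)
        then have "multiples (unif * \<beta> i) = multiples (\<beta> i)"
          by (auto simp: multiples_def dest: dvd_mult_right dvd_trans)
        then show False using multiples_unif_neq \<beta>_nz[OF i] by blast
      qed
      then show "T \<in> (\<lambda>w. extend S (b + w)) ` (?B - bad)" using Te w by blast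
    qed
    show "(\<lambda>w. extend S (b + w)) ` (?B - bad) \<subseteq> F"
    proof clarify
      fix w assume wB: "w \<in> B" "w \<in> tail (Suc i)" and wg: "w \<notin> bad"
      let ?x = "b + w"
      have x: "?x \<in> B" "?x \<in> tail i" "?x i = (if i \<in> C then unif * \<beta> i else \<beta> i)"
        using b wB iC tail_mono[of i "Suc i"] submodule_add[OF B]
        by (auto intro: add_in_tail simp: tail_Suc)
      have uw: "smult_vec unif w \<in> S" using Sp(4) wB by blast
      have ux: "smult_vec unif ?x \<in> ?pB" using x by blast
      have ub: "smult_vec unif b \<in> extend S ?x"
        by (rule extendI'[of "smult_vec (-1) (smult_vec unif w)" _ _ unif])
          (simp_all add: submodule_smult[OF Sp(1) uw] fun_eq_iff algebra_simps)
      have triv: "extend S ?x \<inter> P \<subseteq> ?pB"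
      proof
        fix f assume f: "f \<in> extend S ?x \<inter> P"
        then obtain s c where sc: "s \<in> S" "f = s + smult_vec c ?x" by (auto elim: extendE)
        \<comment> \<open>Otherwise \<open>c\<close> is a unit, and rescaling \<open>f\<close> to
          the leading entry \<open>\<beta> i\<close> gives an element of \<open>P\<close> that
          exhibits \<open>w\<close> as bad.\<close>
        have "unif dvd c"
        proof (rule ccontr)
          assume "\<not> unif dvd c"
          then have "c dvd 1" by (rule not_unif_dvd_unit)
          then obtain d where d: "c * d = 1" by (auto simp: dvd_def)
          have "f i = c * \<beta> i" "f \<in> tail i"
            using sc x Sp(3) iC tail_mono[of i "Suc i"]
            by (auto simp: tail_Suc intro!: add_in_tail smult_in_tail)
          then have "c * \<beta> i \<in> lead P i" using f by (metis IntD2 leadI)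
          then have iE: "i \<in> E"
          proof (rule contrapos_pp)
            assume "i \<notin> E"
            then have l: "lead P i = multiples (unif * \<beta> i)" using lead_P[OF i] by simp
            show "c * \<beta> i \<notin> lead P i"
            proof
              assume "c * \<beta> i \<in> lead P i"
              then have "unif * \<beta> i dvd c * \<beta> i" by (simp add: l multiples_def)
              then show False using \<beta>_nz[OF i] \<open>\<not> unif dvd c\<close> by simp
            qed
          qed
          have fc: "smult_vec d f - b \<in> P"
            using f bP[OF iE] submodule_diff[OF P] submodule_smult[OF P] by blast
          have dc: "d * (c * z) = z" for z using d by (metis mult.assoc mult.commute mult.left_neutral)
          have e: "smult_vec d f - b = w - smult_vec (- d) s"
            using sc d by (simp add: fun_eq_iff algebra_simps dc[unfolded mult.left_commute[of d]])
          have "smult_vec d f - b \<in> tail (Suc i)"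
            unfolding e using wB Sp(3) sc by (auto intro!: diff_in_tail smult_in_tail)
          moreover have "w - (smult_vec d f - b) \<in> S"
            unfolding e using submodule_smult[OF Sp(1) sc(1)] by simp
          ultimately have "w \<in> bad" using bad_iff[of w] wB iE fc by blast
          then show False using wg by simp
        qed
        then obtain c' where c': "c = unif * c'" by blast
        have cx: "smult_vec c ?x \<in> ?pB"
          using submodule_smult[OF pB ux, of c'] c' by (simp add: smult_vec_smult_vec mult.commute)
        have "f - smult_vec c ?x \<in> P" using submodule_diff[OF P] f cx scale_B_P by blast
        then have "s \<in> ?pB" using sc Sp(5) by auto
        then show "f \<in> ?pB" using sc submodule_add[OF pB _ cx] by blast
      qed
      show "extend S ?x \<in> F"
        using extend_in_partial[OF S i b ub x triv] by (simp add: F_def)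
    qed
  qed
  have ker: "extend S (b + w) = extend S (b + w') \<longleftrightarrow> coset S w = coset S w'"
    if w: "w \<in> ?B - bad" "w' \<in> ?B - bad" for w w'
  proof -
    have sub: "extend S (b + w) \<subseteq> extend S (b + w')"
      if "w - w' \<in> S" "w' \<in> ?B" for w w'
    proof (rule extend_subset)
      have "b + w' \<in> free_mod n" using b that submodule_subset[OF B] by (auto intro: add_in_free_mod)
      then show "submodule n (extend S (b + w'))" by (rule submodule_extend[OF Sp(1)])
      show "S \<subseteq> extend S (b + w')" by (rule extend_superset)
      show "b + w \<in> extend S (b + w')"
        by (rule extendI'[OF that(1), of _ 1]) simp
    qed
    have "w - w' \<in> S" if "extend S (b + w) = extend S (b + w')"
    proof -
      have "b + w \<in> extend S (b + w')" using extend_self[OF Sp(6)] that by blast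
      then obtain s c where sc: "s \<in> S" "b + w = s + smult_vec c (b + w')" by (rule extendE)
      have "w i = 0" "w' i = 0" "s i = 0" using w sc Sp(3) by (auto simp: tail_def)
      then have "\<beta> i = c * \<beta> i" using fun_cong[OF sc(2), of i] b by simp
      then have "c = 1" using \<beta>_nz[OF i] by simp
      then show ?thesis using sc by (simp add: algebra_simps)
    qed
    moreover have "w' - w \<in> S" if "w - w' \<in> S"
      using submodule_smult[OF Sp(1) that, of "-1"] by (simp add: smult_vec_def fun_eq_iff fun_diff_def)
    ultimately show ?thesis
      using sub[of w w'] sub[of w' w] w coset_eq_iff[OF Sg, of w w'] by blast
  qed
  have q0: "q ^ k \<noteq> 0" for k using q_ge_2 by simp
  \<comment> \<open>The coset set is finite since its \<open>card\<close> is a power of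
    \<open>q\<close> and not the value 0 that \<open>card\<close> assigns to infinite sets.\<close>
  have finB: "finite (coset S ` ?B)" using card_cosets_B[OF S i] q0 by (metis card.infinite)
  have cos_diff: "coset S ` (?B - bad) = coset S ` ?B - (if i \<in> E then coset S ` ?P else {})"
    by (auto simp: bad_def)
  have "card F = card (coset S ` (?B - bad))"
    unfolding fib by (rule card_images_same_kernel) (rule ker)
  moreover have "finite F \<longleftrightarrow> finite (coset S ` (?B - bad))"
    unfolding fib by (rule finite_images_same_kernel) (rule ker)
  moreover have "coset S ` ?P \<subseteq> coset S ` ?B" using P_B by blast
  then have "card (coset S ` ?B - coset S ` ?P) = card (coset S ` ?B) - card (coset S ` ?P)"
    "card (coset S ` ?P) \<le> card (coset S ` ?B)"
    using finB by (auto intro!: card_Diff_subset card_mono intro: finite_subset)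
  ultimately show ?thesis
    using card_cosets_B[OF S i] card_cosets_P[OF S i] finB
    by (simp add: cos_diff of_nat_diff)
qed

text \<open>The subspace grows from the zero member of the flag; the fibres of restriction have a
  size depending only on \<open>k\<close>, \<open>C\<close> and \<open>E\<close>, so the sizes
  multiply. A factor 0 means that the fibres are empty.\<close>

lemma card_partial_complements:
  assumes i: "1 \<le> i" "i \<le> Suc n"
  shows "finite (partial_complements i) \<and> real (card (partial_complements i)) =
    (\<Prod>k\<in>{i..n} - C. real q ^ card (C \<inter> {Suc k..n}) -
       (if k \<in> E then real q ^ card (E \<inter> {Suc k..n}) else 0))"
  using i(2)
proof (rule inc_induct)
  have "B \<inter> tail (Suc n) = {0}"
    using free_mod_tail_Suc submodule_subset[OF B] submodule_zero[OF B] by auto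
  moreover have "submodule n {0}" by (auto simp: submodule_def)
  moreover have "0 \<in> smult_vec unif ` B" using submodule_zero[OF submodule_scale[OF B]] .
  ultimately have "{0} \<in> partial_complements (Suc n)" "\<And>S. S \<in> partial_complements (Suc n) \<Longrightarrow> S = {0}"
    by (auto simp: partial_complements_def dest: submodule_zero)
  then have "partial_complements (Suc n) = {{0}}" by blast
  then show "finite (partial_complements (Suc n)) \<and> real (card (partial_complements (Suc n))) =
    (\<Prod>k\<in>{Suc n..n} - C. real q ^ card (C \<inter> {Suc k..n}) -
       (if k \<in> E then real q ^ card (E \<inter> {Suc k..n}) else 0))"
    by simp
next
  fix k assume k: "i \<le> k" "k < Suc n"
  let ?F = "\<lambda>k. real q ^ card (C \<inter> {Suc k..n}) -
       (if k \<in> E then real q ^ card (E \<inter> {Suc k..n}) else 0)"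
  assume IH: "finite (partial_complements (Suc k)) \<and> real (card (partial_complements (Suc k))) =
    prod ?F ({Suc k..n} - C)"
  have k1: "k \<in> {1..n}" using i k by simp
  let ?c = "if k \<in> C then 1 else ?F k"
  have "finite (partial_complements k) \<and>
      real (card (partial_complements k)) = real (card (partial_complements (Suc k))) * ?c"
  proof (rule card_fibres_const[of _ "\<lambda>S. S \<inter> tail (Suc k)"])
    show "finite (partial_complements (Suc k))" using IH by blast
    show "(\<lambda>S. S \<inter> tail (Suc k)) ` partial_complements k \<subseteq> partial_complements (Suc k)"
      using restrict_partial[OF k1] by blast
    fix S assume S: "S \<in> partial_complements (Suc k)"
    show "finite {x \<in> partial_complements k. x \<inter> tail (Suc k) = S} \<and>
      real (card {x \<in> partial_complements k. x \<inter> tail (Suc k) = S}) = ?c"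
    proof (cases "k \<in> C")
      case True
      then show ?thesis using fibre_in_C[OF S k1 True] by auto
    next
      case False
      then show ?thesis using fibre_not_in_C[OF S k1 False] by simp
    qed
  qed
  moreover have "{k..n} = insert k {Suc k..n}" using k by auto
  ultimately show "finite (partial_complements k) \<and>
      real (card (partial_complements k)) = prod ?F ({k..n} - C)"
    using IH by (auto simp: insert_Diff_if mult.commute)
qed

end

section \<open>Lattices, saturation and the associated column sequence\<close>

locale dvr_lattices = dvr v q for v :: "'a::idom \<Rightarrow> nat" and q :: nat +
  fixes n :: nat
begin

text \<open>The working form of a lattice: the uniform exponent is what iterated saturation uses up.
  Equivalence with finite index is \<open>lattice_iff_cofinite\<close>.\<close>

definition cofinite_sub :: "(nat \<Rightarrow> 'a) set \<Rightarrow> bool" where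
  "cofinite_sub L \<longleftrightarrow> submodule n L \<and> (\<exists>N. \<forall>f\<in>free_mod n. smult_vec (unif ^ N) f \<in> L)"

definition sat :: "(nat \<Rightarrow> 'a) set \<Rightarrow> (nat \<Rightarrow> 'a) set" where
  "sat L = {f \<in> free_mod n. smult_vec unif f \<in> L}"

text \<open>An intrinsic description of the Hermite composition that involves no choice of a matrix;
  the identification is \<open>hermite_comp_eq\<close>.\<close>

definition dl :: "(nat \<Rightarrow> 'a) set \<Rightarrow> nat \<Rightarrow> nat" where
  "dl L i = (if i \<in> {1..n} then LEAST k. unif ^ k \<in> lead L i else 0)"

definition col :: "(nat \<Rightarrow> 'a) set \<Rightarrow> nat set" where
  "col L = {i \<in> {1..n}. dl L i \<noteq> dl (sat L) i}"

abbreviation M :: "(nat \<Rightarrow> 'a) set" where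
  "M \<equiv> free_mod n"

lemma cofinite_submodule: "cofinite_sub L \<Longrightarrow> submodule n L"
  by (simp add: cofinite_sub_def)

lemma cofinite_M: "cofinite_sub M"
  by (auto simp: cofinite_sub_def submodule_free_mod smult_in_free_mod)

lemma cofinite_mono:
  assumes "cofinite_sub A" "submodule n B" "A \<subseteq> B"
  shows "cofinite_sub B"
  using assms unfolding cofinite_sub_def by blast

lemma lead_smult: "submodule n L \<Longrightarrow> x \<in> lead L i \<Longrightarrow> c * x \<in> lead L i"
  using submodule_smult leadI[of "smult_vec c f" L i for f] smult_in_tail
  by (metis leadE smult_vec_apply)

text \<open>A multiple of the basis vector at \<open>i\<close> puts a power of \<open>unif\<close>
  into the ideal; the least such power generates it, since a nonzero element is a unit times a power
  of \<open>unif\<close>.\<close>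

lemma lead_cofinite:
  assumes L: "cofinite_sub L" and i: "i \<in> {1..n}"
  shows "lead L i = multiples (unif ^ dl L i)"
proof -
  note Lm = cofinite_submodule[OF L]
  obtain N where N: "\<forall>f\<in>M. smult_vec (unif ^ N) f \<in> L" using L by (auto simp: cofinite_sub_def)
  let ?e = "\<lambda>j. if j = i then 1 else 0 :: 'a"
  have "?e \<in> M" using i by (auto simp: free_mod_def)
  then have "smult_vec (unif ^ N) ?e \<in> L" using N by blast
  moreover have "smult_vec (unif ^ N) ?e \<in> tail i" by (simp add: tail_def)
  ultimately have "smult_vec (unif ^ N) ?e i \<in> lead L i" by (rule leadI)
  then have "unif ^ N \<in> lead L i" by simp
  then have d: "unif ^ dl L i \<in> lead L i" using i unfolding dl_def by (auto intro: LeastI)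
  show ?thesis
  proof
    show "multiples (unif ^ dl L i) \<subseteq> lead L i"
      using lead_smult[OF Lm d] by (auto simp: multiples_def dvd_def mult.commute)
    show "lead L i \<subseteq> multiples (unif ^ dl L i)"
    proof
      fix x assume x: "x \<in> lead L i"
      show "x \<in> multiples (unif ^ dl L i)"
      proof (cases "x = 0")
        case False
        obtain c where "unif ^ v x = x * c" using unif_pow_v(2)[OF False] by (auto simp: dvd_def)
        then have "unif ^ v x \<in> lead L i" using lead_smult[OF Lm x, of c] by (simp add: mult.commute)
        then have "dl L i \<le> v x" using i by (auto simp: dl_def intro: Least_le)
        then show ?thesis using False by (simp add: multiples_def dvd_iff_v)
      qed (simp add: multiples_def)
    qed
  qed
qed

lemma dl_eqI:
  assumes "i \<in> {1..n}" "lead L i = multiples (unif ^ k)"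
  shows "dl L i = k"
  using assms by (auto simp: dl_def multiples_def unif_pow_dvd_iff intro!: Least_equality)

lemma dl_mono:
  assumes A: "cofinite_sub A" and B: "cofinite_sub B" and AB: "A \<subseteq> B"
  shows "dl B i \<le> dl A i"
proof (cases "i \<in> {1..n}")
  case True
  have "unif ^ dl A i \<in> lead B i"
    using lead_cofinite[OF A True] lead_mono[OF AB, of i] by auto
  then show ?thesis
    using lead_cofinite[OF B True] by (simp add: multiples_def unif_pow_dvd_iff)
qed (simp only: dl_def if_False order_refl)

lemma cofinite_scale:
  assumes L: "cofinite_sub L"
  shows "cofinite_sub (smult_vec unif ` L)"
proof -
  obtain N where N: "\<forall>f\<in>M. smult_vec (unif ^ N) f \<in> L" using L by (auto simp: cofinite_sub_def)
  have "smult_vec (unif ^ Suc N) f \<in> smult_vec unif ` L" if "f \<in> M" for f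
  proof -
    have "smult_vec (unif ^ Suc N) f = smult_vec unif (smult_vec (unif ^ N) f)"
      by (simp add: smult_vec_smult_vec)
    then show ?thesis using N that by blast
  qed
  then show ?thesis unfolding cofinite_sub_def
    using submodule_scale[OF cofinite_submodule[OF L]] by blast
qed

lemma dl_scale:
  assumes L: "cofinite_sub L" and i: "i \<in> {1..n}"
  shows "dl (smult_vec unif ` L) i = Suc (dl L i)"
  by (rule dl_eqI[OF i]) (simp add: lead_scale lead_cofinite[OF L i] multiples_scale)

lemma submodule_sat: "submodule n L \<Longrightarrow> submodule n (sat L)"
  unfolding submodule_def sat_def
  by (auto simp: add_in_free_mod smult_in_free_mod smult_vec_add smult_vec_smult_vec mult.commute)
    (metis mult.commute smult_vec_smult_vec)

lemma sat_superset: "submodule n L \<Longrightarrow> L \<subseteq> sat L"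
  using submodule_subset submodule_smult by (auto simp: sat_def)

lemma scale_sat: "smult_vec unif ` sat L \<subseteq> L"
  by (auto simp: sat_def)

lemma sat_M [simp]: "sat M = M"
  by (auto simp: sat_def smult_in_free_mod)

lemma cofinite_sat: "cofinite_sub L \<Longrightarrow> cofinite_sub (sat L)"
  using cofinite_mono cofinite_submodule submodule_sat sat_superset by metis

lemma col_subset: "col L \<subseteq> {1..n}"
  by (auto simp: col_def)

text \<open>\<open>L\<close> lies between unif \<open>sat L\<close> and \<open>sat L\<close>, so
  each exponent drops by at most one under saturation.\<close>

lemma dl_sat:
  assumes L: "cofinite_sub L"
  shows "dl L i = dl (sat L) i + (if i \<in> col L then 1 else 0)"
proof (cases "i \<in> {1..n}")
  case True
  note S = cofinite_sat[OF L]
  have "dl (sat L) i \<le> dl L i"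
    by (rule dl_mono[OF L S sat_superset[OF cofinite_submodule[OF L]]])
  moreover have "dl L i \<le> Suc (dl (sat L) i)"
    using dl_mono[OF cofinite_scale[OF S] L scale_sat] dl_scale[OF S True] by metis
  ultimately show ?thesis using True by (auto simp: col_def)
qed (auto simp: dl_def col_def)

lemma lead_col:
  assumes L: "cofinite_sub L" and i: "i \<in> {1..n}"
  shows "lead L i = multiples (if i \<in> col L then unif * unif ^ dl (sat L) i else unif ^ dl (sat L) i)"
  using lead_cofinite[OF L i] dl_sat[OF L, of i] by simp

lemma Int_tail_1: "submodule n L \<Longrightarrow> L \<inter> tail 1 = L"
  using submodule_subset free_mod_tail_1 by fastforce

lemma index_sat:
  assumes L: "cofinite_sub L"
  shows "index (sat L) L = q ^ card (col L)"
proof -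
  note S = cofinite_sat[OF L]
  have "index (sat L \<inter> tail 1) (L \<inter> tail 1) = q ^ card (col L \<inter> {1..n})"
    by (rule index_submodule[of _ _ _ _ "\<lambda>k. unif ^ dl (sat L) k"])
      (use L S lead_col[OF L] lead_cofinite[OF S] sat_superset
        in \<open>auto simp: cofinite_submodule\<close>)
  then show ?thesis
    using Int_tail_1[OF cofinite_submodule[OF L]] Int_tail_1[OF cofinite_submodule[OF S]]
      col_subset[of L]
    by (simp add: Int_absorb2)
qed

lemma funpow_sat_eq_M:
  assumes "submodule n L" "\<forall>f\<in>M. smult_vec (unif ^ N) f \<in> L"
  shows "(sat ^^ N) L = M"
  using assms
proof (induction N arbitrary: L)
  case 0
  then show ?case using submodule_subset by auto
next
  case (Suc N)
  have "\<forall>f\<in>M. smult_vec (unif ^ N) f \<in> sat L"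
    using Suc.prems by (simp add: sat_def smult_in_free_mod smult_vec_smult_vec del: smult_vec_apply)
  then have "(sat ^^ N) (sat L) = M" using Suc submodule_sat by blast
  then show ?case by (simp add: funpow_swap1)
qed

lemma ex_funpow_sat: "cofinite_sub L \<Longrightarrow> \<exists>l. (sat ^^ l) L = M"
  using funpow_sat_eq_M by (auto simp: cofinite_sub_def)

lemma cofinite_induct [consumes 1, case_names M sat]:
  assumes L: "cofinite_sub L" and M: "P M"
    and sat: "\<And>L. cofinite_sub L \<Longrightarrow> L \<noteq> M \<Longrightarrow> P (sat L) \<Longrightarrow> P L"
  shows "P L"
proof -
  obtain l where "(sat ^^ l) L = M" using ex_funpow_sat[OF L] by blast
  then show ?thesis using L
  proof (induction l arbitrary: L)
    case 0
    then show ?case using M by simp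
  next
    case (Suc l)
    then have "P (sat L)" using cofinite_sat by (simp add: funpow_swap1)
    then show ?case using sat[OF Suc.prems(2)] M by blast
  qed
qed

text \<open>If no exponent changes, equal lead ideals give \<open>L = sat L\<close>; the iteration
  then stays at \<open>L\<close> and yet must arrive at \<open>M\<close>.\<close>

lemma col_empty_iff:
  assumes L: "cofinite_sub L"
  shows "col L = {} \<longleftrightarrow> L = M"
proof
  assume c: "col L = {}"
  have "L = sat L"
  proof (rule submodule_eqI_lead)
    fix i assume "i \<in> {1..n}"
    then show "lead (sat L) i \<subseteq> lead L i"
      using lead_col[OF L] c lead_cofinite[OF cofinite_sat[OF L]] by simp
  qed (use L submodule_sat sat_superset in \<open>auto simp: cofinite_submodule\<close>)
  then have "(sat ^^ l) L = L" for l by (induction l) auto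
  then show "L = M" using ex_funpow_sat[OF L] by auto
qed (auto simp: col_def)

section \<open>Finite index and bounded exponent\<close>

lemma finite_cosets:
  assumes L: "cofinite_sub L"
  shows "finite (coset L ` M)"
  using L
proof (induction rule: cofinite_induct)
  case M
  have "coset M ` M = {coset M 0}"
    using coset_eq_iff[OF submodule_subgroup[OF submodule_free_mod], of n _ 0 for n]
    by (auto simp: image_iff intro!: bexI[of _ 0])
  then show ?case by simp
next
  case (sat L)
  note S = submodule_subgroup[OF submodule_sat[OF cofinite_submodule[OF sat(1)]]]
  have "card (coset L ` sat L) \<noteq> 0"
    using index_sat[OF sat(1)] q_ge_2 by (simp add: index_def)
  then have fin: "finite (coset L ` sat L)" by (meson card.infinite)
  have "coset L ` M \<subseteq> (\<Union>Y\<in>coset (sat L) ` M. coset L ` Y)"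
  proof clarify
    fix m assume m: "m \<in> M"
    have "m \<in> coset (sat L) m"
      using S by (auto simp: coset_def add_subgroup_def image_iff intro!: bexI[of _ 0])
    then show "coset L m \<in> (\<Union>Y\<in>coset (sat L) ` M. coset L ` Y)" using m by blast
  qed
  \<comment> \<open>Inside a coset of \<open>sat L\<close>, the cosets of \<open>L\<close> are
    translates of the finitely many inside \<open>sat L\<close>.\<close>
  moreover have "finite (coset L ` coset (sat L) m)" for m
  proof -
    have "coset L (m + s) = (+) m ` coset L s" for s
      by (auto simp: coset_def image_image add.assoc)
    then have "coset L ` coset (sat L) m = ((`) ((+) m)) ` (coset L ` sat L)"
      unfolding coset_def[of "sat L"] by (simp add: image_image)
    then show ?thesis using fin by simp
  qed
  then have "finite (\<Union>Y\<in>coset (sat L) ` M. coset L ` Y)"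
    by (intro finite_UN_I[OF sat(3)]) blast
  ultimately show ?case by (rule finite_subset)
qed

text \<open>For finite index, the pigeonhole principle yields \<open>j < k\<close> with unif^j f and
  unif^k f congruent; their difference is a unit times unif^j f, which is therefore in
  \<open>L\<close>. The number of classes bounds \<open>j\<close>, so it is an exponent good for all
  \<open>f\<close>. The converse counts cosets along the saturation chain.\<close>

lemma lattice_iff_cofinite: "lattice n L \<longleftrightarrow> cofinite_sub L"
proof
  let ?r = "{(f, g). f \<in> M \<and> g \<in> M \<and> f - g \<in> L}"
  {
    assume "lattice n L"
    then have L: "submodule n L" and fin: "finite (M // ?r)" by (auto simp: lattice_def)
    let ?c = "card (M // ?r)"
    have "smult_vec (unif ^ ?c) f \<in> L" if f: "f \<in> M" for f
    proof -
      let ?g = "\<lambda>k. ?r `` {smult_vec (unif ^ k) f}"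
      have "\<not> inj_on ?g {0..?c}"
      proof
        assume "inj_on ?g {0..?c}"
        moreover have "?g ` {0..?c} \<subseteq> M // ?r"
          using f by (intro image_subsetI quotientI smult_in_free_mod)
        ultimately have "card {0..?c} \<le> ?c" by (rule card_inj_on_le[OF _ _ fin])
        then show False by simp
      qed
      then obtain j k where jk: "j < k" "k \<le> ?c" "?g j = ?g k"
      proof -
        obtain a b where ab: "a \<le> ?c" "b \<le> ?c" "?g a = ?g b" "a \<noteq> b"
          using \<open>\<not> inj_on ?g {0..?c}\<close> unfolding inj_on_def by auto
        show thesis
          using that[of a b] that[of b a] ab by (cases "a < b") auto
      qed
      have "smult_vec (unif ^ k) f \<in> ?g k"
        using f submodule_zero[OF L] by (simp add: smult_in_free_mod)
      then have "smult_vec (unif ^ j) f - smult_vec (unif ^ k) f \<in> L" using jk(3) by auto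
      moreover have "unif ^ j - unif ^ k = unif ^ j * (1 - unif ^ (k - j))"
        using jk(1) by (simp add: right_diff_distrib flip: power_add)
      then have "smult_vec (unif ^ j) f - smult_vec (unif ^ k) f =
          smult_vec (1 - unif ^ (k - j)) (smult_vec (unif ^ j) f)"
        by (simp add: fun_eq_iff) (metis left_diff_distrib mult.assoc mult.commute)
      ultimately have s: "smult_vec (1 - unif ^ (k - j)) (smult_vec (unif ^ j) f) \<in> L" by simp
      have "\<not> unif dvd 1 - unif ^ (k - j)"
      proof
        assume "unif dvd 1 - unif ^ (k - j)"
        moreover have "unif dvd unif ^ (k - j)" using jk(1) by (simp add: dvd_power)
        ultimately have "unif dvd 1" by (metis diff_add_cancel dvd_add)
        then show False using dvd_iff_v[of unif 1] unif by simp
      qed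
      then obtain d where d: "(1 - unif ^ (k - j)) * d = 1"
        using not_unif_dvd_unit by (metis dvd_def)
      have "smult_vec (unif ^ (?c - j) * d) (smult_vec (1 - unif ^ (k - j)) (smult_vec (unif ^ j) f)) \<in> L"
        by (rule submodule_smult[OF L s])
      moreover have "unif ^ (?c - j) * d * ((1 - unif ^ (k - j)) * unif ^ j) = unif ^ ?c"
      proof -
        have "unif ^ (?c - j) * d * ((1 - unif ^ (k - j)) * unif ^ j) =
            ((1 - unif ^ (k - j)) * d) * (unif ^ (?c - j) * unif ^ j)" by (simp only: mult_ac)
        also have "\<dots> = unif ^ ?c" using jk d by (simp flip: power_add)
        finally show ?thesis .
      qed
      ultimately show ?thesis by (simp add: smult_vec_smult_vec)
    qed
    then show "cofinite_sub L" using L by (auto simp: cofinite_sub_def)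
  next
    assume L: "cofinite_sub L"
    note Lm = cofinite_submodule[OF L]
    have "M // ?r = (\<lambda>f. ?r `` {f}) ` M" by (auto simp: quotient_def)
    moreover have "finite ((\<lambda>f. ?r `` {f}) ` M) \<longleftrightarrow> finite (coset L ` M)"
    proof (rule finite_images_same_kernel)
      fix x y assume xy: "x \<in> M" "y \<in> M"
      have "equiv M ?r"
      proof (rule equivI)
        show "refl_on M ?r" using submodule_zero[OF Lm] by (auto simp: refl_on_def)
        show "sym ?r"
          using submodule_diff[OF Lm submodule_zero[OF Lm]]
          by (auto simp: sym_def) (metis diff_0 minus_diff_eq)
        show "trans ?r"
          using submodule_add[OF Lm] by (auto simp: trans_def) (metis diff_add_cancel add_diff_eq)
      qed auto
      then show "?r `` {x} = ?r `` {y} \<longleftrightarrow> coset L x = coset L y"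
        using eq_equiv_class_iff[of M ?r x y] xy coset_eq_iff[OF submodule_subgroup[OF Lm]] by simp
    qed
    ultimately show "lattice n L" using finite_cosets[OF L] Lm by (simp add: lattice_def)
  }
qed

section \<open>Fibres of saturation and sequences of columns\<close>

definition fibre_size :: "nat set \<Rightarrow> nat set \<Rightarrow> real" where
  "fibre_size C D = (\<Prod>k\<in>{1..n} - C. real q ^ card (C \<inter> {Suc k..n}) -
     (if k \<in> D then real q ^ card (D \<inter> {Suc k..n}) else 0))"

text \<open>Translates the fibre into \<open>partial_complements 1\<close>. Trivial intersection
  with \<open>?P\<close> says that \<open>sat L\<close> is no larger than \<open>B\<close>: if unif
  \<open>g\<close> is in \<open>L\<close>, then \<open>g\<close> is in \<open>sat B\<close>, so unif
  \<open>g\<close> also lies in \<open>?P\<close>.\<close>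

lemma card_sat_fibre:
  assumes cof: "cofinite_sub B" and C: "C \<subseteq> {1..n}"
  defines "F \<equiv> {L. cofinite_sub L \<and> sat L = B \<and> col L = C}"
  shows "finite F \<and> real (card F) = fibre_size C (col B)"
proof -
  let ?P = "smult_vec unif ` sat B"
  note Bm = cofinite_submodule[OF cof]
  interpret flag_count v q n B ?P C "col B" "\<lambda>k. unif ^ dl B k"
  proof
    show "smult_vec unif ` B \<subseteq> ?P" using sat_superset[OF Bm] by blast
    fix k assume k: "k \<in> {1..n}"
    show "lead B k = multiples (unif ^ dl B k)" by (rule lead_cofinite[OF cof k])
    show "lead ?P k = multiples (if k \<in> col B then unif ^ dl B k else unif * unif ^ dl B k)"
      using lead_cofinite[OF cofinite_sat[OF cof] k] dl_sat[OF cof, of k]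
      by (simp add: lead_scale multiples_scale)
  qed (auto simp: Bm submodule_scale submodule_sat scale_sat)
  have "F = partial_complements 1"
  proof (intro set_eqI iffI)
    fix L assume "L \<in> F"
    then have L: "cofinite_sub L" and s: "sat L = B" and c: "col L = C" by (auto simp: F_def)
    have "L \<subseteq> B \<inter> tail 1"
      using sat_superset[OF cofinite_submodule[OF L]] s Int_tail_1[OF Bm] by simp
    moreover have "smult_vec unif ` (B \<inter> tail 1) \<subseteq> L" using s by (auto simp: sat_def)
    moreover have "L \<inter> ?P \<subseteq> smult_vec unif ` B"
    proof clarify
      fix g assume "smult_vec unif g \<in> L" "g \<in> sat B"
      then have "g \<in> B" using s by (auto simp: sat_def)
      then show "smult_vec unif g \<in> smult_vec unif ` B" by blast
    qed
    ultimately show "L \<in> partial_complements 1"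
      unfolding partial_complements_def
      using lead_col[OF L] s c cofinite_submodule[OF L] by simp
  next
    fix L assume L: "L \<in> partial_complements 1"
    note Lp = partial_props[OF L]
    have "smult_vec unif ` B \<subseteq> L" using Lp(4) Int_tail_1[OF Bm] by simp
    then have Lc: "cofinite_sub L" by (rule cofinite_mono[OF cofinite_scale[OF cof] Lp(1)])
    have s: "sat L = B"
    proof (intro set_eqI iffI)
      fix g assume "g \<in> sat L"
      then have g: "g \<in> M" "smult_vec unif g \<in> L" by (auto simp: sat_def)
      then have "g \<in> sat B" using Lp(2) by (auto simp: sat_def)
      then have "smult_vec unif g \<in> L \<inter> ?P" using g by blast
      then obtain h where "h \<in> B" "smult_vec unif g = smult_vec unif h" using Lp(5) by blast
      then show "g \<in> B" using smult_vec_cancel[OF unif(1)] by metis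
    next
      fix g assume "g \<in> B"
      then show "g \<in> sat L" using \<open>smult_vec unif ` B \<subseteq> L\<close> submodule_subset[OF Bm] by (auto simp: sat_def)
    qed
    have "dl L i = dl B i + (if i \<in> C then 1 else 0)" if "i \<in> {1..n}" for i
      using Lp(7)[of i] that by (intro dl_eqI) auto
    then have "col L = C" using C by (auto simp: col_def s split: if_splits)
    then show "L \<in> F" using Lc s by (simp add: F_def)
  qed
  then show ?thesis using card_partial_complements[of 1] by (simp add: fibre_size_def)
qed

definition level :: "(nat \<Rightarrow> 'a) set \<Rightarrow> nat" where
  "level L = (LEAST l. (sat ^^ l) L = M)"

text \<open>Columns in the order in which saturation strips them off, stopping at \<open>M\<close>;
  hence all of them are nonempty.\<close>

definition tab :: "(nat \<Rightarrow> 'a) set \<Rightarrow> nat set list" where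
  "tab L = map (\<lambda>j. col ((sat ^^ j) L)) [0..<level L]"

lemma tab_M [simp]: "tab M = []"
proof -
  have "level M = 0" unfolding level_def by (rule Least_eq_0) simp
  then show ?thesis by (simp add: tab_def)
qed

lemma tab_sat:
  assumes L: "cofinite_sub L" "L \<noteq> M"
  shows "tab L = col L # tab (sat L)"
proof -
  obtain l where "(sat ^^ l) L = M" using ex_funpow_sat[OF L(1)] by blast
  then have "level L = Suc (LEAST l. (sat ^^ Suc l) L = M)"
    unfolding level_def by (rule Least_Suc) (use L(2) in simp)
  also have "(LEAST l. (sat ^^ Suc l) L = M) = level (sat L)"
    unfolding level_def by (simp add: funpow_swap1)
  finally have lev: "level L = Suc (level (sat L))" .
  show ?thesis
    unfolding tab_def lev by (simp add: upt_rec[of 0] map_Suc_upt[symmetric] funpow_swap1 del: upt_Suc map_Suc_upt)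
qed

lemma tab_Nil_iff: "cofinite_sub L \<Longrightarrow> tab L = [] \<longleftrightarrow> L = M"
  using tab_sat by force

lemma set_tab:
  assumes "cofinite_sub L" "C \<in> set (tab L)"
  shows "C \<noteq> {} \<and> C \<subseteq> {1..n}"
  using assms
proof (induction rule: cofinite_induct)
  case (sat L)
  then show ?case using tab_sat[of L] col_empty_iff[of L] col_subset[of L] by auto
qed simp

lemma dl_tab:
  assumes "cofinite_sub L"
  shows "dl L i = length (filter (\<lambda>C. i \<in> C) (tab L))"
  using assms
proof (induction rule: cofinite_induct)
  case M
  have "1 \<in> lead M i" if "i \<in> {1..n}"
  proof -
    have "(\<lambda>j. if j = i then 1 else 0 :: 'a) \<in> M \<inter> tail i" using that by (auto simp: free_mod_def tail_def)
    then have "(\<lambda>j. if j = i then 1 else 0 :: 'a) i \<in> lead M i" unfolding lead_def by (rule imageI)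
    then show ?thesis by simp
  qed
  then show ?case by (auto simp: dl_def intro: Least_eq_0)
next
  case (sat L)
  then show ?case using dl_sat[of L i] by (simp add: tab_sat)
qed

text \<open>The default \<open>{}\<close> after the last column is \<open>col M\<close>, since the
  last saturation reaches the full module.\<close>

primrec chain_count :: "nat set list \<Rightarrow> real" where
  "chain_count [] = 1"
| "chain_count (C # Cs) = fibre_size C (case Cs of [] \<Rightarrow> {} | D # _ \<Rightarrow> D) * chain_count Cs"

lemma col_tab:
  assumes "cofinite_sub L"
  shows "col L = (case tab L of [] \<Rightarrow> {} | D # _ \<Rightarrow> D)"
  using assms tab_sat[of L] col_empty_iff[of L] by (cases "L = M") auto

text \<open>Saturation sends lattices with sequence \<open>C # Cs\<close> to those with sequence
  \<open>Cs\<close>; its fibres all have the same size, as they see the target only through its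
  first column.\<close>

lemma card_tab_fibre:
  assumes "\<forall>C\<in>set Cs. C \<noteq> {} \<and> C \<subseteq> {1..n}"
  shows "finite {L. cofinite_sub L \<and> tab L = Cs} \<and>
    real (card {L. cofinite_sub L \<and> tab L = Cs}) = chain_count Cs"
  using assms
proof (induction Cs)
  case Nil
  have "{L. cofinite_sub L \<and> tab L = []} = {M}" using tab_Nil_iff cofinite_M by auto
  then show ?case by simp
next
  case (Cons C Cs)
  let ?X = "{L. cofinite_sub L \<and> tab L = C # Cs}" and ?Y = "{L. cofinite_sub L \<and> tab L = Cs}"
  have C: "C \<noteq> {}" "C \<subseteq> {1..n}" using Cons.prems by auto
  have step: "tab L = C # Cs \<longleftrightarrow> tab (sat L) = Cs \<and> col L = C" if "cofinite_sub L" for L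
    using tab_sat[of L] that C(1) col_empty_iff[of L] by (cases "L = M") auto
  have "finite ?X \<and> real (card ?X) = real (card ?Y) * fibre_size C (case Cs of [] \<Rightarrow> {} | D # _ \<Rightarrow> D)"
  proof (rule card_fibres_const[of _ sat])
    show "finite ?Y" using Cons by simp
    show "sat ` ?X \<subseteq> ?Y" using step cofinite_sat by auto
    fix B assume B: "B \<in> ?Y"
    then have "{L \<in> ?X. sat L = B} = {L. cofinite_sub L \<and> sat L = B \<and> col L = C}"
      using step by auto
    then show "finite {L \<in> ?X. sat L = B} \<and>
        real (card {L \<in> ?X. sat L = B}) = fibre_size C (case Cs of [] \<Rightarrow> {} | D # _ \<Rightarrow> D)"
      using card_sat_fibre[of B C] C(2) B col_tab[of B] by auto
  qed
  then show ?case using Cons by (simp add: mult.commute)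
qed

end

section \<open>Hermite compositions and elementary divisors\<close>

context dvr_lattices
begin

definition comb :: "(nat \<Rightarrow> nat \<Rightarrow> 'a) \<Rightarrow> (nat \<Rightarrow> 'a) \<Rightarrow> nat \<Rightarrow> 'a" where
  "comb A c = (\<lambda>j. \<Sum>i\<in>{1..n}. c i * A i j)"

lemma comb_in:
  assumes L: "submodule n L" and A: "\<And>i. i \<in> {1..n} \<Longrightarrow> A i \<in> L"
  shows "comb A c \<in> L"
proof -
  have "(\<lambda>j. \<Sum>i\<in>I. c i * A i j) \<in> L" if "finite I" "I \<subseteq> {1..n}" for I
    using that
  proof (induction I)
    case empty
    then show ?case using submodule_zero[OF L] by (simp add: zero_fun_def)
  next
    case (insert x I)
    have "(\<lambda>j. \<Sum>i\<in>insert x I. c i * A i j) = smult_vec (c x) (A x) + (\<lambda>j. \<Sum>i\<in>I. c i * A i j)"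
      using insert.hyps by (simp add: fun_eq_iff)
    then show ?case
      using insert submodule_add[OF L submodule_smult[OF L A]] by auto
  qed
  then show ?thesis unfolding comb_def by blast
qed

lemma comb_single: "i \<in> {1..n} \<Longrightarrow> comb A (\<lambda>k. if k = i then d else 0) = smult_vec d (A i)"
  by (simp add: comb_def fun_eq_iff if_distrib[of "\<lambda>x. x * _"] sum.delta cong: if_cong)

lemma submodule_combs:
  assumes "\<And>i. i \<in> {1..n} \<Longrightarrow> A i \<in> M"
  shows "submodule n (range (comb A))"
  unfolding submodule_def
proof (intro conjI ballI allI)
  show "range (comb A) \<subseteq> M" using comb_in[OF submodule_free_mod, of A] assms by blast
  have "comb A 0 = 0" by (simp add: comb_def fun_eq_iff)
  then show "0 \<in> range (comb A)" by (metis rangeI)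
  fix f assume "f \<in> range (comb A)"
  then obtain c where c: "f = comb A c" by blast
  show "f + g \<in> range (comb A)" if g: "g \<in> range (comb A)" for g
  proof -
    obtain d where "g = comb A d" using g by blast
    then have "f + g = comb A (c + d)"
      using c by (simp add: comb_def fun_eq_iff distrib_right sum.distrib)
    then show ?thesis by blast
  qed
  show "smult_vec d f \<in> range (comb A)" for d
  proof -
    have "smult_vec d f = comb A (\<lambda>i. d * c i)"
      using c by (simp add: comb_def fun_eq_iff sum_distrib_left mult.assoc)
    then show ?thesis by blast
  qed
qed

lemma hermite_comp_of_iff: "hermite_comp_of v n L d \<longleftrightarrow> (\<forall>i. i \<notin> {1..n} \<longrightarrow> d i = 0) \<and>
    (\<exists>A. (\<forall>i\<in>{1..n}. A i \<in> M \<and> A i \<in> tail i \<and> d i = v (A i i)) \<and> L = range (comb A))"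
  by (auto simp: hermite_comp_of_def comb_def tail_def full_SetCompr_eq)

text \<open>Vectors of \<open>L\<close> realising the generators of the lead ideals form a
  triangular matrix, whose row space has the lead ideals of \<open>L\<close> and so equals
  \<open>L\<close>.\<close>

lemma hermite_comp_of_dl:
  assumes L: "cofinite_sub L"
  shows "hermite_comp_of v n L (dl L)"
proof -
  note Lm = cofinite_submodule[OF L]
  have "\<forall>i\<in>{1..n}. \<exists>a. a \<in> L \<and> a \<in> tail i \<and> a i = unif ^ dl L i"
    using lead_cofinite[OF L] by (metis leadE multiples_self)
  then obtain A where A: "\<forall>i\<in>{1..n}. A i \<in> L \<and> A i \<in> tail i \<and> A i i = unif ^ dl L i"
    by (auto dest: bchoice)
  have AM: "A i \<in> M" if "i \<in> {1..n}" for i using A that submodule_subset[OF Lm] by blast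
  have "range (comb A) = L"
  proof (rule submodule_eqI_lead[OF submodule_combs[OF AM] Lm])
    show "range (comb A) \<subseteq> L" using comb_in[OF Lm] A by blast
    fix i assume i: "i \<in> {1..n}"
    show "lead L i \<subseteq> lead (range (comb A)) i"
    proof
      fix x assume "x \<in> lead L i"
      then obtain d where d: "x = unif ^ dl L i * d"
        using lead_cofinite[OF L i] by (auto simp: multiples_def)
      have "smult_vec d (A i) \<in> range (comb A)" using comb_single[OF i, of A d] by (metis rangeI)
      moreover have "smult_vec d (A i) \<in> tail i" using A i by (auto intro: smult_in_tail)
      ultimately have "smult_vec d (A i) i \<in> lead (range (comb A)) i" by (rule leadI)
      then show "x \<in> lead (range (comb A)) i" using A i d by (simp add: mult.commute)
    qed
  qed
  moreover have "\<forall>i. i \<notin> {1..n} \<longrightarrow> dl L i = 0" by (auto simp: dl_def)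
  ultimately show ?thesis
    unfolding hermite_comp_of_iff using A AM by (intro conjI exI[of _ A] ballI) simp_all
qed

text \<open>Vanishing of the first coordinates kills the coefficients one after the other. Only
  diagonal entries before \<open>i\<close> are assumed nonzero, so that the lemma is available
  inside the induction which proves this for all of them.\<close>

lemma comb_tail:
  assumes A: "\<And>k. k \<in> {1..n} \<Longrightarrow> A k \<in> tail k" and nz: "\<And>k. k \<in> {1..<i} \<Longrightarrow> A k k \<noteq> 0"
    and i: "i \<in> {1..n}" and t: "comb A c \<in> tail i"
  shows "comb A c i = c i * A i i"
proof -
  have val: "comb A c m = c m * A m m" if m: "m \<in> {1..n}" and z: "\<And>k. k \<in> {1..<m} \<Longrightarrow> c k = 0" for m
  proof -
    have "comb A c m = (\<Sum>k\<in>{1..n}. if k = m then c m * A m m else 0)"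
      unfolding comb_def
    proof (rule sum.cong)
      fix k assume k: "k \<in> {1..n}"
      show "c k * A k m = (if k = m then c m * A m m else 0)"
        using z[of k] A[OF k] k by (cases k m rule: linorder_cases) (auto simp: tail_def)
    qed simp
    then show ?thesis using m by simp
  qed
  have "c k = 0" if "k \<in> {1..<i}" for k
    using that
  proof (induction k rule: less_induct)
    case (less k)
    then have "comb A c k = c k * A k k" using i by (intro val) auto
    then show ?case using t less.prems nz[of k] by (auto simp: tail_def)
  qed
  then show ?thesis using val[OF i] by blast
qed

lemma hermite_comp_of_unique:
  assumes L: "cofinite_sub L" and d: "hermite_comp_of v n L d"
  shows "d = dl L"
proof -
  obtain A where d0: "\<forall>i. i \<notin> {1..n} \<longrightarrow> d i = 0" and
    A: "\<And>i. i \<in> {1..n} \<Longrightarrow> A i \<in> M \<and> A i \<in> tail i \<and> d i = v (A i i)" and LA: "L = range (comb A)"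
    using d unfolding hermite_comp_of_iff by blast
  have lead_in: "lead L i \<subseteq> multiples (A i i)"
    if i: "i \<in> {1..n}" and nz: "\<And>k. k \<in> {1..<i} \<Longrightarrow> A k k \<noteq> 0" for i
  proof
    fix x assume "x \<in> lead L i"
    then obtain c where "comb A c \<in> tail i" "comb A c i = x" using LA by (auto elim!: leadE)
    then have "x = c i * A i i" using comb_tail[of A i c] A nz i by auto
    then show "x \<in> multiples (A i i)" by (simp add: multiples_def)
  qed
  \<comment> \<open>The definition does not exclude zero diagonal entries; they are impossible
    because the nonzero generator of \<open>lead L i\<close> is a multiple of the entry.\<close>
  have nz: "A i i \<noteq> 0" if "i \<in> {1..n}" for i
    using that
  proof (induction i rule: less_induct)
    case (less i)
    have "lead L i \<subseteq> multiples (A i i)" by (rule lead_in) (use less in auto)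
    then have "unif ^ dl L i \<in> multiples (A i i)"
      unfolding lead_cofinite[OF L less.prems] using multiples_self by blast
    then have "A i i dvd unif ^ dl L i" by (simp add: multiples_def)
    then show ?case by auto
  qed
  show ?thesis
  proof
    fix i show "d i = dl L i"
    proof (cases "i \<in> {1..n}")
      case True
      have "comb A (\<lambda>k. if k = i then 1 else 0) = A i" using comb_single[OF True] by simp
      then have "A i \<in> L" using LA by (metis rangeI)
      then have "A i i \<in> lead L i" using A[OF True] by (auto intro: leadI)
      then have "unif ^ dl L i dvd A i i" using lead_cofinite[OF L True] by (simp add: multiples_def)
      moreover have "lead L i \<subseteq> multiples (A i i)" by (rule lead_in[OF True]) (use nz True in auto)
      then have "unif ^ dl L i \<in> multiples (A i i)"
        unfolding lead_cofinite[OF L True] using multiples_self by blast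
      then have "A i i dvd unif ^ dl L i" by (simp add: multiples_def)
      ultimately show ?thesis using nz[OF True] A[OF True] by (simp add: dvd_iff_v)
    next
      case False
      then show ?thesis using d0 by (auto simp: dl_def)
    qed
  qed
qed

lemma hermite_comp_eq: "cofinite_sub L \<Longrightarrow> hermite_comp v n L = dl L"
  unfolding hermite_comp_def
  using hermite_comp_of_dl hermite_comp_of_unique by (intro the_equality) auto

end

section \<open>Existence of the elementary divisor type\<close>

definition supp_in :: "nat set \<Rightarrow> (nat \<Rightarrow> 'a::idom) set" where
  "supp_in I = {f. \<forall>i. i \<notin> I \<longrightarrow> f i = 0}"

lemma supp_in_simps:
  "0 \<in> supp_in I" "f \<in> supp_in I \<Longrightarrow> g \<in> supp_in I \<Longrightarrow> f + g \<in> supp_in I"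
  "f \<in> supp_in I \<Longrightarrow> g \<in> supp_in I \<Longrightarrow> f - g \<in> supp_in I"
  "f \<in> supp_in I \<Longrightarrow> smult_vec c f \<in> supp_in I"
  by (auto simp: supp_in_def)

text \<open>The induction splits off a vector of the submodule whose content is minimal; the
  bound \<^term>\<open>a\<close> on the content of the submodule makes the exponents weakly decreasing.\<close>

lemma (in dvr) smith_normal_form:
  fixes L :: "(nat \<Rightarrow> 'a) set"
  assumes "finite I" "card I = m" "L \<subseteq> supp_in I"
    and "\<And>f g. f \<in> L \<Longrightarrow> g \<in> L \<Longrightarrow> f + g \<in> L" "\<And>c f. f \<in> L \<Longrightarrow> smult_vec c f \<in> L"
    and "\<And>f. f \<in> supp_in I \<Longrightarrow> smult_vec (unif ^ N) f \<in> L"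
    and "\<And>f i. f \<in> L \<Longrightarrow> unif ^ a dvd f i"
  shows "\<exists>\<psi> lam. (\<forall>j. j \<notin> {1..m} \<longrightarrow> lam j = 0) \<and> (\<forall>j\<in>{1..<m}. lam (Suc j) \<le> lam j) \<and>
    (\<forall>j\<in>{1..m}. a \<le> lam j) \<and>
    (\<forall>f\<in>supp_in I. \<forall>g\<in>supp_in I. \<psi> (f + g) = \<psi> f + \<psi> g) \<and>
    (\<forall>c. \<forall>f\<in>supp_in I. \<psi> (smult_vec c f) = smult_vec c (\<psi> f)) \<and>
    \<psi> ` supp_in I = supp_in {1..m} \<and>
    (\<forall>f\<in>supp_in I. f \<in> L \<longleftrightarrow> (\<forall>j\<in>{1..m}. unif ^ lam j dvd \<psi> f j))"
  using assms
proof (induction m arbitrary: I L a)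
  case 0
  then have I: "I = {}" by simp
  have s: "supp_in {} = {0 :: nat \<Rightarrow> 'a}" by (auto simp: supp_in_def)
  have "0 \<in> L" using "0.prems"(6)[OF supp_in_simps(1)] by (simp only: smult_vec_0)
  then show ?case unfolding I
    by (intro exI[of _ "\<lambda>_. 0"] exI[of _ "\<lambda>_. 0"]) (auto simp: s zero_fun_def)
next
  case (Suc m)
  note add = Suc.prems(4) and smult = Suc.prems(5)
  let ?P = "\<lambda>k. \<exists>f\<in>L. \<exists>i\<in>I. f i \<noteq> 0 \<and> v (f i) = k"
  have "\<exists>k. ?P k"
  proof -
    obtain i where i: "i \<in> I" using Suc.prems(2) by (auto dest: card_eq_SucD)
    let ?e = "\<lambda>j. if j = i then 1 else 0 :: 'a"
    have "smult_vec (unif ^ N) ?e \<in> L" using i by (intro Suc.prems(6)) (simp add: supp_in_def)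
    moreover have "smult_vec (unif ^ N) ?e i \<noteq> 0" by simp
    ultimately show ?thesis using i by blast
  qed
  then have "?P (LEAST k. ?P k)" by (rule LeastI_ex)
  then obtain f i where f: "f \<in> L" and i: "i \<in> I" and fi: "f i \<noteq> 0" and
    vf: "v (f i) = (LEAST k. ?P k)" by blast
  define k where "k = v (f i)"
  have min: "f i dvd g j" if g: "g \<in> L" for g j
  proof (cases "g j = 0")
    case False
    then have "j \<in> I" using g Suc.prems(3) by (auto simp: supp_in_def)
    then have "k \<le> v (g j)" unfolding k_def vf using False g by (intro Least_le) blast
    then show ?thesis using fi False by (simp add: dvd_iff_v k_def)
  qed simp
  have fi_k: "f i dvd x \<longleftrightarrow> unif ^ k dvd x" for x
    using dvd_iff_unif_pow[OF fi] by (simp add: k_def)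
  have ak: "a \<le> k"
    using Suc.prems(7)[OF f, of i] fi by (simp add: dvd_iff_v k_def)
  have "\<forall>j. \<exists>u. f i * u = f j" using min[OF f] by (metis dvd_def)
  \<comment> \<open>Dividing \<open>f\<close> by its entry of least valuation gives a vector with
    entry 1 at \<open>i\<close>, which spans a complement of the vectors vanishing at
    \<open>i\<close>.\<close>
  then obtain u where u: "\<And>j. f i * u j = f j" by metis
  have ui: "u i = 1" using u[of i] fi by simp
  have uI: "u \<in> supp_in I"
  proof -
    have "f j = 0" if "j \<notin> I" for j using f Suc.prems(3) that by (auto simp: supp_in_def)
    then show ?thesis using u fi by (simp add: supp_in_def) (metis mult_eq_0_iff)
  qed
  have fu: "smult_vec (f i * c) u = smult_vec c f" for c
    by (simp add: fun_eq_iff u mult.assoc mult.left_commute[of _ c])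
  \<comment> \<open>The place of the minimal entry is arbitrary, which is why the induction runs
    over finite sets \<open>I\<close> and not over initial segments.\<close>
  let ?I = "I - {i}"
  have sub: "supp_in ?I \<subseteq> supp_in I" by (auto simp: supp_in_def)
  have si: "g i = 0" if "g \<in> supp_in ?I" for g :: "nat \<Rightarrow> 'a" using that by (simp add: supp_in_def)
  obtain \<psi> lam where lam0: "\<forall>j. j \<notin> {1..m} \<longrightarrow> lam j = 0" and
    lam1: "\<forall>j\<in>{1..<m}. lam (Suc j) \<le> lam j" and lamk: "\<forall>j\<in>{1..m}. k \<le> lam j" and
    \<psi>add: "\<forall>f\<in>supp_in ?I. \<forall>g\<in>supp_in ?I. \<psi> (f + g) = \<psi> f + \<psi> g" and
    \<psi>smult: "\<forall>c. \<forall>f\<in>supp_in ?I. \<psi> (smult_vec c f) = smult_vec c (\<psi> f)" and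
    \<psi>im: "\<psi> ` supp_in ?I = supp_in {1..m}" and
    \<psi>L: "\<forall>f\<in>supp_in ?I. f \<in> L \<inter> supp_in ?I \<longleftrightarrow> (\<forall>j\<in>{1..m}. unif ^ lam j dvd \<psi> f j)"
  proof -
    have "\<exists>\<psi> lam. (\<forall>j. j \<notin> {1..m} \<longrightarrow> lam j = 0) \<and> (\<forall>j\<in>{1..<m}. lam (Suc j) \<le> lam j) \<and>
      (\<forall>j\<in>{1..m}. k \<le> lam j) \<and>
      (\<forall>f\<in>supp_in ?I. \<forall>g\<in>supp_in ?I. \<psi> (f + g) = \<psi> f + \<psi> g) \<and>
      (\<forall>c. \<forall>f\<in>supp_in ?I. \<psi> (smult_vec c f) = smult_vec c (\<psi> f)) \<and>
      \<psi> ` supp_in ?I = supp_in {1..m} \<and>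
      (\<forall>f\<in>supp_in ?I. f \<in> L \<inter> supp_in ?I \<longleftrightarrow> (\<forall>j\<in>{1..m}. unif ^ lam j dvd \<psi> f j))"
    proof (rule Suc.IH)
      show "finite ?I" "card ?I = m" using Suc.prems(1,2) i by auto
      show "unif ^ k dvd g j" if "g \<in> L \<inter> supp_in ?I" for g j using min[of g j] fi_k that by blast
      show "smult_vec (unif ^ N) g \<in> L \<inter> supp_in ?I" if "g \<in> supp_in ?I" for g
        using Suc.prems(6)[of g] sub that supp_in_simps(4) by blast
      show "g + h \<in> L \<inter> supp_in ?I" if "g \<in> L \<inter> supp_in ?I" "h \<in> L \<inter> supp_in ?I" for g h
        using add supp_in_simps(2) that by blast
      show "smult_vec c g \<in> L \<inter> supp_in ?I" if "g \<in> L \<inter> supp_in ?I" for c g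
        using smult supp_in_simps(4) that by blast
    qed blast
    then show thesis by (elim exE conjE) (rule that; assumption)
  qed
  define \<rho> where "\<rho> w = w - smult_vec (w i) u" for w
  have \<rho>I: "\<rho> w \<in> supp_in ?I" if "w \<in> supp_in I" for w
    using that uI ui by (auto simp: \<rho>_def supp_in_def)
  \<comment> \<open>\<open>L\<close> splits along \<open>u\<close>: in that direction it consists of
    the multiples of \<open>unif ^ k\<close>, because \<open>f\<close> is \<open>f i\<close> times
    \<open>u\<close> and \<open>f i\<close> has valuation \<open>k\<close>.\<close>
  have \<rho>L: "w \<in> L \<longleftrightarrow> unif ^ k dvd w i \<and> \<rho> w \<in> L" for w
  proof
    assume w: "w \<in> L"
    then obtain c where c: "w i = f i * c" using min by (auto simp: dvd_def)
    have "w + smult_vec (-c) f \<in> L" using w f add smult by blast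
    moreover have "smult_vec (w i) u = smult_vec c f" unfolding c by (rule fu)
    then have "w + smult_vec (-c) f = \<rho> w" unfolding \<rho>_def by (simp add: fun_eq_iff)
    ultimately show "unif ^ k dvd w i \<and> \<rho> w \<in> L" using min[OF w] fi_k by auto
  next
    assume w: "unif ^ k dvd w i \<and> \<rho> w \<in> L"
    then obtain c where c: "w i = f i * c" using fi_k by (auto simp: dvd_def)
    have "\<rho> w + smult_vec c f \<in> L" using w f add smult by blast
    moreover have "smult_vec (w i) u = smult_vec c f" unfolding c by (rule fu)
    then have "\<rho> w + smult_vec c f = w" unfolding \<rho>_def by simp
    ultimately show "w \<in> L" by simp
  qed
  \<comment> \<open>The new coordinate goes last: its exponent \<open>k\<close> is minimal, all
    others being at least \<open>k\<close> by the bound handed to the induction hypothesis.\<close>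
  let ?\<psi> = "\<lambda>w j. if j = Suc m then w i else \<psi> (\<rho> w) j"
  let ?lam = "lam(Suc m := k)"
  show ?case
  proof (intro exI conjI)
    show "\<forall>j. j \<notin> {1..Suc m} \<longrightarrow> ?lam j = 0" using lam0 by auto
    show "\<forall>j\<in>{1..<Suc m}. ?lam (Suc j) \<le> ?lam j" using lam1 lamk by auto
    show "\<forall>j\<in>{1..Suc m}. a \<le> ?lam j"
    proof
      fix j assume "j \<in> {1..Suc m}"
      then show "a \<le> ?lam j" using bspec[OF lamk, of j] ak by (cases "j = Suc m") auto
    qed
    show "\<forall>f\<in>supp_in I. \<forall>g\<in>supp_in I. ?\<psi> (f + g) = ?\<psi> f + ?\<psi> g"
    proof (intro ballI)
      fix f g :: "nat \<Rightarrow> 'a" assume fg: "f \<in> supp_in I" "g \<in> supp_in I"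
      have "\<rho> (f + g) = \<rho> f + \<rho> g" by (simp add: \<rho>_def fun_eq_iff algebra_simps)
      then have "\<psi> (\<rho> (f + g)) = \<psi> (\<rho> f) + \<psi> (\<rho> g)" using \<psi>add \<rho>I fg by simp
      then show "?\<psi> (f + g) = ?\<psi> f + ?\<psi> g" by (simp add: fun_eq_iff)
    qed
    show "\<forall>c. \<forall>f\<in>supp_in I. ?\<psi> (smult_vec c f) = smult_vec c (?\<psi> f)"
    proof (intro allI ballI)
      fix c and f :: "nat \<Rightarrow> 'a" assume f: "f \<in> supp_in I"
      have "\<rho> (smult_vec c f) = smult_vec c (\<rho> f)" by (simp add: \<rho>_def fun_eq_iff algebra_simps)
      then have "\<psi> (\<rho> (smult_vec c f)) = smult_vec c (\<psi> (\<rho> f))" using \<psi>smult \<rho>I f by simp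
      then show "?\<psi> (smult_vec c f) = smult_vec c (?\<psi> f)" by (simp add: fun_eq_iff)
    qed
    show "?\<psi> ` supp_in I = supp_in {1..Suc m}"
    proof
      show "?\<psi> ` supp_in I \<subseteq> supp_in {1..Suc m}"
      proof clarify
        fix w :: "nat \<Rightarrow> 'a" assume "w \<in> supp_in I"
        then have "\<psi> (\<rho> w) \<in> supp_in {1..m}" using \<rho>I \<psi>im by blast
        then show "?\<psi> w \<in> supp_in {1..Suc m}" by (auto simp: supp_in_def)
      qed
      show "supp_in {1..Suc m} \<subseteq> ?\<psi> ` supp_in I"
      proof
        fix t :: "nat \<Rightarrow> 'a" assume t: "t \<in> supp_in {1..Suc m}"
        then have "t(Suc m := 0) \<in> supp_in {1..m}" by (auto simp: supp_in_def)
        then obtain w' where w': "w' \<in> supp_in ?I" "\<psi> w' = t(Suc m := 0)" using \<psi>im by (metis imageE)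
        let ?w = "w' + smult_vec (t (Suc m)) u"
        have wi: "?w i = t (Suc m)" using si[OF w'(1)] ui by simp
        then have "\<rho> ?w = w'" by (simp add: \<rho>_def)
        then have e: "\<psi> (\<rho> ?w) = t(Suc m := 0)" using w'(2) by (simp only:)
        have eq: "?\<psi> ?w = t" by (rule ext) (simp only: e wi fun_upd_apply split: if_split, simp)
        have wI: "?w \<in> supp_in I" using w' sub uI by (intro supp_in_simps) auto
        show "t \<in> ?\<psi> ` supp_in I" by (rule image_eqI[of t ?\<psi> ?w, OF eq[symmetric] wI])
      qed
    qed
    show "\<forall>f\<in>supp_in I. f \<in> L \<longleftrightarrow> (\<forall>j\<in>{1..Suc m}. unif ^ ?lam j dvd ?\<psi> f j)"
    proof
      fix w :: "nat \<Rightarrow> 'a" assume "w \<in> supp_in I"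
      then have "\<rho> w \<in> L \<longleftrightarrow> (\<forall>j\<in>{1..m}. unif ^ lam j dvd \<psi> (\<rho> w) j)" using \<psi>L \<rho>I by blast
      moreover have "{1..Suc m} = insert (Suc m) {1..m}" by auto
      ultimately show "w \<in> L \<longleftrightarrow> (\<forall>j\<in>{1..Suc m}. unif ^ ?lam j dvd ?\<psi> w j)" using \<rho>L[of w] by auto
    qed
  qed
qed

context dvr_lattices
begin

lemma ex_elem_div_type:
  assumes L: "cofinite_sub L"
  shows "\<exists>lam. elem_div_type v n L lam"
proof -
  note Lm = cofinite_submodule[OF L]
  obtain N where N: "\<forall>f\<in>M. smult_vec (unif ^ N) f \<in> L" using L by (auto simp: cofinite_sub_def)
  have M: "supp_in {1..n} = M" by (auto simp: supp_in_def free_mod_def)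
  have "\<exists>\<psi> lam. (\<forall>j. j \<notin> {1..n} \<longrightarrow> lam j = 0) \<and> (\<forall>j\<in>{1..<n}. lam (Suc j) \<le> lam j) \<and>
    (\<forall>j\<in>{1..n}. 0 \<le> lam j) \<and>
    (\<forall>f\<in>supp_in {1..n}. \<forall>g\<in>supp_in {1..n}. \<psi> (f + g) = \<psi> f + \<psi> g) \<and>
    (\<forall>c. \<forall>f\<in>supp_in {1..n}. \<psi> (smult_vec c f) = smult_vec c (\<psi> f)) \<and>
    \<psi> ` supp_in {1..n} = supp_in {1..n} \<and>
    (\<forall>f\<in>supp_in {1..n}. f \<in> L \<longleftrightarrow> (\<forall>j\<in>{1..n}. unif ^ lam j dvd \<psi> f j))"
    by (rule smith_normal_form[where N = N])
      (use N submodule_subset[OF Lm] submodule_add[OF Lm] submodule_smult[OF Lm] in \<open>simp_all only: M, auto\<close>)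
  then obtain \<psi> lam where lam: "\<forall>j. j \<notin> {1..n} \<longrightarrow> lam j = 0" "\<forall>j\<in>{1..<n}. lam (Suc j) \<le> lam j"
    and add: "\<forall>f\<in>M. \<forall>g\<in>M. \<psi> (f + g) = \<psi> f + \<psi> g"
    and smult: "\<forall>c. \<forall>f\<in>M. \<psi> (smult_vec c f) = smult_vec c (\<psi> f)"
    and im: "\<psi> ` M = M" and \<psi>L: "\<forall>f\<in>M. f \<in> L \<longleftrightarrow> (\<forall>j\<in>{1..n}. unif ^ lam j dvd \<psi> f j)"
    unfolding M by (elim exE conjE) (rule that; assumption)
  have "elem_div_type v n L lam"
    unfolding elem_div_type_def
  proof (intro conjI exI)
    show "mod_linear n \<psi>" using im add smult by (auto simp: mod_linear_def)
    show "\<forall>w\<in>M. \<exists>u\<in>M. w - \<psi> u \<in> diag_sub v n lam"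
    proof
      fix w assume "w \<in> M"
      then obtain u where "u \<in> M" "w = \<psi> u" using im by (metis imageE)
      then show "\<exists>u\<in>M. w - \<psi> u \<in> diag_sub v n lam"
        by (intro bexI[of _ u]) (auto simp: diag_sub_def pow_ideal_def)
    qed
    have "\<psi> u \<in> M" if "u \<in> M" for u using im that by blast
    then show "{u \<in> M. \<psi> u \<in> diag_sub v n lam} = L"
      using \<psi>L submodule_subset[OF Lm] by (auto simp: diag_sub_def mem_pow_ideal)
  qed (use lam in auto)
  then show ?thesis by blast
qed

section \<open>Uniqueness of the type and the conjugate partition\<close>

lemma diag_sub_iff: "w \<in> diag_sub v n lam \<longleftrightarrow> w \<in> M \<and> (\<forall>i\<in>{1..n}. unif ^ lam i dvd w i)"
  by (simp add: diag_sub_def mem_pow_ideal)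

lemma submodule_diag_sub: "submodule n (diag_sub v n lam)"
  by (auto simp: submodule_def diag_sub_iff add_in_free_mod smult_in_free_mod)

lemma diag_sub_mono: "(\<And>i. lam i \<le> mu i) \<Longrightarrow> diag_sub v n mu \<subseteq> diag_sub v n lam"
  by (auto simp: diag_sub_iff) (meson atLeastAtMost_iff dvd_trans unif_pow_dvd_iff)

lemma lead_diag_sub:
  assumes i: "i \<in> {1..n}"
  shows "lead (diag_sub v n lam) i = multiples (unif ^ lam i)"
proof
  show "lead (diag_sub v n lam) i \<subseteq> multiples (unif ^ lam i)"
    using i by (auto elim!: leadE simp: diag_sub_iff multiples_def)
  show "multiples (unif ^ lam i) \<subseteq> lead (diag_sub v n lam) i"
  proof
    fix x assume x: "x \<in> multiples (unif ^ lam i)"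
    let ?f = "\<lambda>j. if j = i then x else 0"
    have "?f i \<in> lead (diag_sub v n lam) i"
      by (rule leadI) (use x i in \<open>auto simp: diag_sub_iff multiples_def tail_def free_mod_def\<close>)
    then show "x \<in> lead (diag_sub v n lam) i" by simp
  qed
qed

text \<open>Truncated subtraction of \<open>j\<close> describes the j-fold saturation of the
  diagonal lattice; the next saturation lowers exactly the exponents with
  \<open>j < lam i\<close>.\<close>

lemma index_diag_sub:
  "index (diag_sub v n (\<lambda>i. lam i - Suc j)) (diag_sub v n (\<lambda>i. lam i - j)) =
    q ^ card {i \<in> {1..n}. j < lam i}"
proof -
  let ?D = "\<lambda>j. diag_sub v n (\<lambda>i. lam i - j)"
  have "index (?D (Suc j) \<inter> tail 1) (?D j \<inter> tail 1) = q ^ card ({i \<in> {1..n}. j < lam i} \<inter> {1..n})"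
  proof (rule index_submodule[of _ _ _ _ "\<lambda>i. unif ^ (lam i - Suc j)"])
    show "?D j \<subseteq> ?D (Suc j)" by (rule diag_sub_mono) simp
    fix k assume k: "k \<in> {1..n}"
    have "unif ^ (lam k - j) = (if k \<in> {i \<in> {1..n}. j < lam i} then unif * unif ^ (lam k - Suc j)
        else unif ^ (lam k - Suc j))"
      using k by (auto simp: Suc_diff_Suc simp flip: power_Suc)
    then show "unif ^ (lam k - Suc j) \<noteq> 0 \<and>
      lead (?D (Suc j)) k = multiples (unif ^ (lam k - Suc j)) \<and>
      lead (?D j) k = multiples (if k \<in> {i \<in> {1..n}. j < lam i} then unif * unif ^ (lam k - Suc j)
        else unif ^ (lam k - Suc j))"
      using lead_diag_sub[OF k] by simp
  qed (auto simp: submodule_diag_sub)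
  moreover have "{i \<in> {1..n}. j < lam i} \<inter> {1..n} = {i \<in> {1..n}. j < lam i}" by auto
  ultimately show ?thesis
    using Int_tail_1[OF submodule_diag_sub] by simp
qed

text \<open>\<open>\<psi>\<close> pulls the saturations of the diagonal lattice back to those of
  \<open>L\<close> and identifies their successive quotients. The left side does not involve
  \<open>\<psi>\<close> or \<open>lam\<close>, which is the source of the uniqueness of the
  type.\<close>

lemma card_col_elem_div:
  assumes L: "cofinite_sub L" and e: "elem_div_type v n L lam"
  shows "card (col ((sat ^^ j) L)) = card {i \<in> {1..n}. j < lam i}"
proof -
  let ?D = "\<lambda>j. diag_sub v n (\<lambda>i. lam i - j)"
  let ?S = "\<lambda>j. (sat ^^ j) L"
  obtain \<psi> where lin: "mod_linear n \<psi>" and surj: "\<forall>w\<in>M. \<exists>u\<in>M. w - \<psi> u \<in> diag_sub v n lam"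
    and ker: "{u \<in> M. \<psi> u \<in> diag_sub v n lam} = L"
    using e unfolding elem_div_type_def by blast
  have \<psi>M: "\<psi> u \<in> M" if "u \<in> M" for u using lin that by (auto simp: mod_linear_def)
  have \<psi>diff: "\<psi> (x - y) = \<psi> x - \<psi> y" if "x \<in> M" "y \<in> M" for x y
  proof -
    have "\<psi> ((x - y) + y) = \<psi> (x - y) + \<psi> y"
      using lin that diff_in_free_mod unfolding mod_linear_def by blast
    then show ?thesis by (simp add: algebra_simps)
  qed
  have S: "?S j = {u \<in> M. \<psi> u \<in> ?D j}" for j
  proof (induction j)
    case 0
    then show ?case using ker by simp
  next
    case (Suc j)
    have "smult_vec unif w \<in> ?D j \<longleftrightarrow> w \<in> ?D (Suc j)" if "w \<in> M" for w
    proof -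
      have "unif ^ (lam i - j) dvd unif * w i \<longleftrightarrow> unif ^ (lam i - Suc j) dvd w i" for i
      proof (cases "j < lam i")
        case True
        then have "unif ^ (lam i - j) = unif * unif ^ (lam i - Suc j)"
          by (simp add: Suc_diff_Suc flip: power_Suc)
        then show ?thesis by simp
      qed simp
      then show ?thesis using that smult_in_free_mod[of w n] by (simp add: diag_sub_iff)
    qed
    moreover have "\<psi> (smult_vec unif u) = smult_vec unif (\<psi> u)" if "u \<in> M" for u
      using lin that by (simp add: mod_linear_def)
    ultimately show ?case using Suc \<psi>M by (auto simp: sat_def smult_in_free_mod)
  qed
  have cof: "cofinite_sub (?S j)" for j by (induction j) (auto simp: L cofinite_sat)
  have Dg: "add_subgroup (?D j)" for j by (rule submodule_subgroup[OF submodule_diag_sub])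
  have D0: "diag_sub v n lam \<subseteq> ?D j" for j by (rule diag_sub_mono) simp
  have "index (?S (Suc j)) (?S j) = card ((\<lambda>u. coset (?D j) (\<psi> u)) ` ?S (Suc j))"
    unfolding index_def
  proof (rule card_images_same_kernel)
    fix x y assume xy: "x \<in> ?S (Suc j)" "y \<in> ?S (Suc j)"
    then have M: "x \<in> M" "y \<in> M" using submodule_subset[OF cofinite_submodule[OF cof]] by blast+
    then have "x - y \<in> ?S j \<longleftrightarrow> \<psi> x - \<psi> y \<in> ?D j"
      using S[of j] \<psi>diff diff_in_free_mod[OF M] by simp
    then show "coset (?S j) x = coset (?S j) y \<longleftrightarrow> coset (?D j) (\<psi> x) = coset (?D j) (\<psi> y)"
      using coset_eq_iff[OF Dg] coset_eq_iff[OF submodule_subgroup[OF cofinite_submodule[OF cof]]]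
      by blast
  qed
  also have "(\<lambda>u. coset (?D j) (\<psi> u)) ` ?S (Suc j) = coset (?D j) ` ?D (Suc j)"
  proof
    show "(\<lambda>u. coset (?D j) (\<psi> u)) ` ?S (Suc j) \<subseteq> coset (?D j) ` ?D (Suc j)"
      using S[of "Suc j"] by auto
    show "coset (?D j) ` ?D (Suc j) \<subseteq> (\<lambda>u. coset (?D j) (\<psi> u)) ` ?S (Suc j)"
    proof clarify
      fix w assume w: "w \<in> ?D (Suc j)"
      then obtain u where u: "u \<in> M" "w - \<psi> u \<in> diag_sub v n lam"
        using surj by (auto simp: diag_sub_iff)
      \<comment> \<open>\<open>\<psi>\<close> is onto only modulo the diagonal lattice of
        \<open>lam\<close>, but that lattice is contained in all its saturations, so the error is
        harmless.\<close>
      have "w - (w - \<psi> u) \<in> ?D (Suc j)"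
        using submodule_diff[OF submodule_diag_sub w] D0[of "Suc j"] u by blast
      then have "u \<in> ?S (Suc j)" using S[of "Suc j"] u by simp
      moreover have "coset (?D j) w = coset (?D j) (\<psi> u)"
        using coset_eq_iff[OF Dg] D0[of j] u by blast
      ultimately show "coset (?D j) w \<in> (\<lambda>u. coset (?D j) (\<psi> u)) ` ?S (Suc j)" by blast
    qed
  qed
  also have "card (coset (?D j) ` ?D (Suc j)) = q ^ card {i \<in> {1..n}. j < lam i}"
    using index_diag_sub[of lam j] by (simp add: index_def)
  finally have "q ^ card (col (?S j)) = q ^ card {i \<in> {1..n}. j < lam i}"
    using index_sat[OF cof[of j]] by simp
  then show ?thesis using q_ge_2 by (simp add: power_inject_exp)
qed

text \<open>The column sizes form the partition conjugate to \<open>lam\<close>, and conjugating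
  once more recovers \<open>lam\<close>.\<close>

lemma elem_div_type_tab:
  assumes L: "cofinite_sub L" and e: "elem_div_type v n L lam"
  shows "lam = (\<lambda>i. if i \<in> {1..n} then length (filter (\<lambda>C. i \<le> card C) (tab L)) else 0)"
proof
  fix i
  have lam0: "\<forall>i. i \<notin> {1..n} \<longrightarrow> lam i = 0" and dec: "\<forall>i\<in>{1..<n}. lam (Suc i) \<le> lam i"
    using e by (auto simp: elem_div_type_def)
  have antimono: "lam b \<le> lam a" if "1 \<le> a" "a \<le> b" "b \<le> n" for a b
    using that(2,3)
  proof (induction b rule: dec_induct)
    case (step b)
    then have "lam (Suc b) \<le> lam b" using dec that(1) by simp
    then show ?case using step by simp
  qed simp
  show "lam i = (if i \<in> {1..n} then length (filter (\<lambda>C. i \<le> card C) (tab L)) else 0)"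
  proof (cases "i \<in> {1..n}")
    case True
    \<comment> \<open>Since \<open>lam\<close> is weakly decreasing, \<open>?A\<close> is an initial
      segment, so its size decides whether it contains \<open>i\<close>.\<close>
    have lt: "j < lam i \<longleftrightarrow> i \<le> card (col ((sat ^^ j) L))" for j
    proof -
      let ?A = "{i \<in> {1..n}. j < lam i}"
      have A: "card (col ((sat ^^ j) L)) = card ?A" by (rule card_col_elem_div[OF L e])
      show ?thesis
      proof
        assume "j < lam i"
        then have "{1..i} \<subseteq> ?A" using True antimono[of _ i] by fastforce
        then have "card {1..i} \<le> card ?A" by (intro card_mono) auto
        then show "i \<le> card (col ((sat ^^ j) L))" using A by simp
      next
        assume "i \<le> card (col ((sat ^^ j) L))"
        show "j < lam i"
        proof (rule ccontr)
          assume "\<not> j < lam i"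
          have "?A \<subseteq> {1..<i}"
          proof clarify
            fix b assume b: "b \<in> {1..n}" "j < lam b"
            then show "b \<in> {1..<i}"
              using True antimono[of i b] \<open>\<not> j < lam i\<close> by (cases "i \<le> b") auto
          qed
          then have "card ?A \<le> card {1..<i}" by (intro card_mono) auto
          then show False using A \<open>i \<le> card (col ((sat ^^ j) L))\<close> True by auto
        qed
      qed
    qed
    have stab: "(sat ^^ j) L = M" if "level L \<le> j" for j
    proof -
      have "(sat ^^ level L) L = M" unfolding level_def using ex_funpow_sat[OF L] by (rule LeastI_ex)
      moreover have "(sat ^^ k) M = M" for k by (induction k) auto
      ultimately have "(sat ^^ (j - level L + level L)) L = M" by (simp add: funpow_add)
      then show ?thesis using that by simp
    qed
    have "col M = {}" by (simp add: col_empty_iff cofinite_M)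
    then have lev: "j < level L" if "i \<le> card (col ((sat ^^ j) L))" for j
      using that stab[of j] True by (cases "j < level L") auto
    have "length (filter (\<lambda>C. i \<le> card C) (tab L)) = card {j. j < level L \<and> i \<le> card (col ((sat ^^ j) L))}"
      unfolding length_filter_conv_card tab_def by (rule arg_cong[where f = card]) auto
    also have "{j. j < level L \<and> i \<le> card (col ((sat ^^ j) L))} = {..<lam i}"
      using lt lev by auto
    finally show ?thesis using True by simp
  next
    case False
    then show ?thesis using lam0 by auto
  qed
qed

lemma lattice_type_tab:
  assumes L: "cofinite_sub L"
  shows "lattice_type v n L = (\<lambda>i. if i \<in> {1..n} then length (filter (\<lambda>C. i \<le> card C) (tab L)) else 0)"
proof -
  obtain lam where "elem_div_type v n L lam" using ex_elem_div_type[OF L] by blast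
  then have "lattice_type v n L = lam" unfolding lattice_type_def
    using elem_div_type_tab[OF L] by (intro the_equality) auto
  then show ?thesis using elem_div_type_tab[OF L] \<open>elem_div_type v n L lam\<close> by simp
qed

text \<open>Differences of consecutive parts of a conjugate partition count the columns of one exact
  size; hence a column \<open>C\<close> contributes the variable x with index
  \<open>card C\<close>.\<close>

lemma inc_lattice_type:
  assumes L: "cofinite_sub L"
  shows "inc n (lattice_type v n L) k = length (filter (\<lambda>C. card C = k) (tab L))"
proof -
  have "1 \<le> card C \<and> card C \<le> n" if "C \<in> set (tab L)" for C
  proof -
    have "C \<noteq> {}" "C \<subseteq> {1..n}" using set_tab[OF L that] by auto
    then show ?thesis
      using card_mono[of "{1..n}" C] finite_subset[of C "{1..n}"] by (auto simp: Suc_le_eq card_gt_0_iff)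
  qed
  then have c: "\<forall>C\<in>set (tab L). 1 \<le> card C \<and> card C \<le> n" by blast
  have none: "filter (\<lambda>C. k \<le> card C) (tab L) = []" if "n < k"
    using c that by (auto simp: filter_empty_conv)
  have eq: "length (filter (\<lambda>C. k \<le> card C) Cs) - length (filter (\<lambda>C. Suc k \<le> card C) Cs) =
      length (filter (\<lambda>C. card C = k) Cs)" for Cs :: "nat set list"
  proof -
    have "length (filter (\<lambda>C. k \<le> card C) Cs) =
        length (filter (\<lambda>C. Suc k \<le> card C) Cs) + length (filter (\<lambda>C. card C = k) Cs)"
      by (induction Cs) auto
    then show ?thesis by simp
  qed
  show ?thesis
  proof (cases "k \<in> {1..n}")
    case True
    have "lattice_type v n L (Suc k) = length (filter (\<lambda>C. Suc k \<le> card C) (tab L))"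
    \<comment> \<open>For \<open>k = n\<close> the partition vanishes outside its range, in
      agreement with the absence of columns of size \<open>Suc n\<close>.\<close>
    proof (cases "Suc k \<le> n")
      case False
      then have "filter (\<lambda>C. Suc k \<le> card C) (tab L) = []"
        using c by (fastforce simp: filter_empty_conv)
      then show ?thesis using False by (simp add: lattice_type_tab[OF L])
    qed (simp add: lattice_type_tab[OF L])
    then show ?thesis using True eq[of "tab L"] by (simp add: inc_def lattice_type_tab[OF L])
  next
    case False
    then have "filter (\<lambda>C. card C = k) (tab L) = []" using c by (auto simp: filter_empty_conv)
    then show ?thesis using False by (auto simp: inc_def)
  qed
qed

end

section \<open>Expanding the substituted series over sequences of columns\<close>

text \<open>Exponents are arbitrary functions, so infinite supports, where sums over the support or
  over smaller monomials collapse to 0, have to be treated apart.\<close>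

definition fin_mon :: "mon \<Rightarrow> bool" where
  "fin_mon m \<longleftrightarrow> finite {i. fst m i \<noteq> 0} \<and> finite {i. snd m i \<noteq> 0}"

definition mon_le :: "mon \<Rightarrow> mon \<Rightarrow> bool" where
  "mon_le m m' \<longleftrightarrow> fst m \<le> fst m' \<and> snd m \<le> snd m'"

definition mon_times :: "nat \<Rightarrow> mon \<Rightarrow> mon" where
  "mon_times k m = (\<lambda>i. k * fst m i, \<lambda>i. k * snd m i)"

lemma finite_fun_le:
  fixes a :: "nat \<Rightarrow> nat"
  assumes "finite {i. a i \<noteq> 0}"
  shows "finite {f. f \<le> a}"
proof (rule finite_subset)
  let ?S = "{i. a i \<noteq> 0}" and ?N = "{..\<Sum>i\<in>{i. a i \<noteq> 0}. a i}"
  show "{f. f \<le> a} \<subseteq> {f. \<forall>x. (x \<in> ?S \<longrightarrow> f x \<in> ?N) \<and> (x \<notin> ?S \<longrightarrow> f x = 0)}"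
  proof clarify
    fix f x assume f: "f \<le> a"
    have "f x \<le> sum a ?S" if "x \<in> ?S"
      using member_le_sum[OF that, of a] assms le_funD[OF f, of x] by simp
    moreover have "f x = 0" if "x \<notin> ?S" using le_funD[OF f, of x] that by simp
    ultimately show "(x \<in> ?S \<longrightarrow> f x \<in> ?N) \<and> (x \<notin> ?S \<longrightarrow> f x = 0)" by simp
  qed
  show "finite {f. \<forall>x. (x \<in> ?S \<longrightarrow> f x \<in> ?N) \<and> (x \<notin> ?S \<longrightarrow> f x = 0)}"
    using assms by (intro finite_set_of_finite_funs) auto
qed

lemma infinite_fun_le:
  fixes a :: "nat \<Rightarrow> nat"
  assumes "infinite {i. a i \<noteq> 0}"
  shows "infinite {f. f \<le> a}"
proof
  assume fin: "finite {f. f \<le> a}"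
  have "inj_on xvar {i. a i \<noteq> 0}"
    by (auto simp: inj_on_def xvar_def fun_eq_iff split: if_splits)
  moreover have "xvar ` {i. a i \<noteq> 0} \<subseteq> {f. f \<le> a}"
    by (auto simp: le_fun_def xvar_def)
  ultimately show False using assms fin by (meson finite_imageD finite_subset)
qed

lemma below_eq: "{(a1, d1). a1 \<le> a \<and> d1 \<le> d} = {a1. a1 \<le> a} \<times> {d1. d1 \<le> d}" for a d :: "nat \<Rightarrow> nat"
  by auto

lemma finite_mon_below: "fin_mon (a, d) \<Longrightarrow> finite {(a1, d1). a1 \<le> a \<and> d1 \<le> d}"
  unfolding below_eq by (simp add: fin_mon_def finite_fun_le)

lemma ser_mult_alt: "ser_mult F G m = (\<Sum>m1\<in>{m1. mon_le m1 m}. F m1 * G (m - m1))"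
  by (cases m) (auto simp: ser_mult_def mon_le_def case_prod_beta intro!: sum.cong)

lemma finite_mon_le: "fin_mon m \<Longrightarrow> finite {m1. mon_le m1 m}"
  using finite_mon_below[of "fst m" "snd m"] by (simp add: mon_le_def case_prod_beta')

text \<open>If \<^term>\<open>m\<close> has infinite support, the convolution sum ranges over an infinite set,
  hence is 0.\<close>

lemma ser_mult_infinite:
  assumes "\<not> fin_mon m"
  shows "ser_mult F G m = 0"
proof -
  have e: "{m1. mon_le m1 m} = {a1. a1 \<le> fst m} \<times> {d1. d1 \<le> snd m}"
    by (auto simp: mon_le_def)
  have "fst m \<in> {a1. a1 \<le> fst m}" "snd m \<in> {d1. d1 \<le> snd m}" by auto
  then have "infinite {m1. mon_le m1 m}"
    using assms infinite_fun_le unfolding e fin_mon_def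
    by (metis empty_iff finite_cartesian_productD1 finite_cartesian_productD2)
  then show ?thesis by (simp add: ser_mult_alt)
qed

lemma mon_le_refl [simp]: "mon_le m m"
  by (simp add: mon_le_def)

lemma fin_mon_le: "mon_le m m' \<Longrightarrow> fin_mon m' \<Longrightarrow> fin_mon m"
  unfolding fin_mon_def mon_le_def le_fun_def
  by (metis (mono_tags, lifting) finite_subset le_zero_eq mem_Collect_eq subsetI)

lemma mon_le_diff_add: "mon_le m0 m \<Longrightarrow> m0 + (m - m0) = m"
  by (auto simp: mon_le_def prod_eq_iff fun_eq_iff le_fun_def)

lemma mon_add_diff: "(m0 + m) - m0 = (m :: mon)"
  by (auto simp: prod_eq_iff fun_eq_iff)

lemma mon_le_add [simp]: "mon_le m0 (m0 + m)"
  by (auto simp: mon_le_def le_fun_def)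

lemma mon_diff_le: "mon_le (m - m0) m"
  by (auto simp: mon_le_def le_fun_def)

lemma mon_le_trans: "mon_le a b \<Longrightarrow> mon_le b c \<Longrightarrow> mon_le a c"
  by (auto simp: mon_le_def)

lemma mon_deg_superset:
  assumes "finite S" "{i. fst m i \<noteq> 0} \<subseteq> S" "{i. snd m i \<noteq> 0} \<subseteq> S"
  shows "mon_deg m = sum (fst m) S + sum (snd m) S"
  unfolding mon_deg_def using assms by (auto intro!: arg_cong2[where f = "(+)"] sum.mono_neutral_left)

lemma fin_mon_add: "fin_mon m \<Longrightarrow> fin_mon m' \<Longrightarrow> fin_mon (m + m')"
  by (simp add: fin_mon_def Collect_disj_eq)

lemma mon_deg_add:
  assumes "fin_mon m" "fin_mon m'"
  shows "mon_deg (m + m') = mon_deg m + mon_deg m'"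
proof -
  let ?S = "{i. fst m i \<noteq> 0} \<union> {i. snd m i \<noteq> 0} \<union> {i. fst m' i \<noteq> 0} \<union> {i. snd m' i \<noteq> 0}"
  have S: "finite ?S" using assms by (simp add: fin_mon_def)
  have "mon_deg (m + m') = sum (fst (m + m')) ?S + sum (snd (m + m')) ?S"
    by (rule mon_deg_superset[OF S]) auto
  moreover have "mon_deg m = sum (fst m) ?S + sum (snd m) ?S"
    by (rule mon_deg_superset[OF S]) auto
  moreover have "mon_deg m' = sum (fst m') ?S + sum (snd m') ?S"
    by (rule mon_deg_superset[OF S]) auto
  ultimately show ?thesis by (simp add: sum.distrib)
qed

lemma mon_deg_0 [simp]: "mon_deg 0 = 0"
  by (simp add: mon_deg_def)

lemma mon_deg_pos: "fin_mon m \<Longrightarrow> m \<noteq> 0 \<Longrightarrow> 1 \<le> mon_deg m"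
  by (auto simp: mon_deg_def fin_mon_def prod_eq_iff fun_eq_iff Suc_le_eq intro!: sum_pos2)

lemma mon_times_0: "mon_times 0 m = 0"
  by (simp add: mon_times_def zero_prod_def fun_eq_iff zero_fun_def)

lemma mon_times_Suc: "mon_times (Suc k) m = m + mon_times k m"
  by (simp add: mon_times_def prod_eq_iff fun_eq_iff)

lemma fin_mon_times: "fin_mon m \<Longrightarrow> fin_mon (mon_times k m)"
  by (auto simp: fin_mon_def mon_times_def elim: rev_finite_subset)

lemma mon_deg_times: "fin_mon m \<Longrightarrow> mon_deg (mon_times k m) = k * mon_deg m"
  by (induction k) (auto simp: mon_times_0 mon_times_Suc mon_deg_add fin_mon_times)

lemma eq_mon_times_Suc:
  "m = mon_times (Suc k) m0 \<longleftrightarrow> mon_le m0 m \<and> m - m0 = mon_times k m0"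
  unfolding mon_times_Suc by (metis mon_add_diff mon_le_add mon_le_diff_add)

lemma ser_mult_mon_ser:
  assumes "fin_mon m"
  shows "ser_mult (mon_ser c m0) G m = (if mon_le m0 m then c * G (m - m0) else 0)"
proof -
  have "ser_mult (mon_ser c m0) G m =
      (\<Sum>m1\<in>{m1. mon_le m1 m}. if m1 = m0 then c * G (m - m0) else 0)"
    unfolding ser_mult_alt by (rule sum.cong) (auto simp: mon_ser_def)
  then show ?thesis using finite_mon_le[OF assms] by simp
qed

lemma power_mon_ser:
  assumes m0: "fin_mon m0"
  shows "(ser_mult (mon_ser c m0) ^^ k) ser_one m = (if m = mon_times k m0 then c ^ k else 0)"
proof (induction k arbitrary: m)
  case 0
  then show ?case by (simp add: ser_one_def mon_times_0 zero_prod_def)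
next
  case (Suc k)
  show ?case
  proof (cases "fin_mon m")
    case True
    then show ?thesis
      using Suc by (simp add: ser_mult_mon_ser eq_mon_times_Suc)
  next
    case False
    then have "m \<noteq> mon_times (Suc k) m0" using fin_mon_times[OF m0] by metis
    then show ?thesis using False by (simp add: ser_mult_infinite)
  qed
qed

section \<open>Geometric series of columns and their products\<close>

locale column_monomial =
  fixes c :: "nat set \<Rightarrow> real" and \<mu> :: "nat set \<Rightarrow> mon"
  assumes fin_\<mu>: "fin_mon (\<mu> C)" and \<mu>_nz: "\<mu> C \<noteq> 0"
begin

abbreviation geo :: "nat set \<Rightarrow> ser" where
  "geo C \<equiv> ser_frac (mon_ser (c C) (\<mu> C))"

text \<open>The k-th power has degree at least k, so a larger cut-off adds only zeros. The freedom
  in \<open>N\<close> makes the coefficients at \<open>m\<close> and \<open>m - \<mu> C\<close>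
  comparable although their degrees differ.\<close>

lemma geo_bound:
  assumes "fin_mon m" "mon_deg m \<le> N"
  shows "geo C m = (\<Sum>k\<in>{1..N}. if m = mon_times k (\<mu> C) then c C ^ k else 0)"
proof -
  have "geo C m = (\<Sum>k\<in>{1..mon_deg m}. if m = mon_times k (\<mu> C) then c C ^ k else 0)"
    by (simp add: ser_frac_def power_mon_ser[OF fin_\<mu>])
  also have "\<dots> = (\<Sum>k\<in>{1..N}. if m = mon_times k (\<mu> C) then c C ^ k else 0)"
  proof (rule sum.mono_neutral_left)
    show "\<forall>k\<in>{1..N} - {1..mon_deg m}. (if m = mon_times k (\<mu> C) then c C ^ k else 0) = 0"
    proof
      fix k assume k: "k \<in> {1..N} - {1..mon_deg m}"
      have "k \<le> mon_deg (mon_times k (\<mu> C))"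
        using mon_deg_pos[OF fin_\<mu> \<mu>_nz, of C] by (simp add: mon_deg_times fin_\<mu>)
      then show "(if m = mon_times k (\<mu> C) then c C ^ k else 0) = 0" using k by auto
    qed
  qed (use assms in auto)
  finally show ?thesis .
qed

text \<open>Coefficient form of F/(1-F) = F + F F/(1-F), obtained by splitting one factor off each
  power.\<close>

lemma geo_rec:
  assumes m: "fin_mon m"
  shows "geo C m = (if mon_le (\<mu> C) m
    then c C * ((if m - \<mu> C = 0 then 1 else 0) + geo C (m - \<mu> C)) else 0)"
proof -
  let ?N = "mon_deg m"
  have "geo C m = (\<Sum>k\<in>{1..Suc ?N}. if m = mon_times k (\<mu> C) then c C ^ k else 0)"
    by (rule geo_bound[OF m]) simp
  also have "\<dots> = (\<Sum>k\<in>{0..?N}. if m = mon_times (Suc k) (\<mu> C) then c C ^ Suc k else 0)"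
    using sum.shift_bounds_cl_Suc_ivl[of "\<lambda>k. if m = mon_times k (\<mu> C) then c C ^ k else 0" 0 ?N] by simp
  also have "\<dots> = (if mon_le (\<mu> C) m
      then c C * (\<Sum>k\<in>{0..?N}. if m - \<mu> C = mon_times k (\<mu> C) then c C ^ k else 0) else 0)"
    unfolding eq_mon_times_Suc by (auto simp: sum_distrib_left intro!: sum.cong)
  also have "(\<Sum>k\<in>{0..?N}. if m - \<mu> C = mon_times k (\<mu> C) then c C ^ k else 0) =
      (if m - \<mu> C = 0 then 1 else 0) + (\<Sum>k\<in>{1..?N}. if m - \<mu> C = mon_times k (\<mu> C) then c C ^ k else 0)"
    by (simp add: sum.atLeast_Suc_atMost mon_times_0)
  finally have e: "geo C m = (if mon_le (\<mu> C) m then c C * ((if m - \<mu> C = 0 then 1 else 0) +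
      (\<Sum>k\<in>{1..?N}. if m - \<mu> C = mon_times k (\<mu> C) then c C ^ k else 0)) else 0)" .
  have "mon_le (\<mu> C) m \<Longrightarrow>
      (\<Sum>k\<in>{1..?N}. if m - \<mu> C = mon_times k (\<mu> C) then c C ^ k else 0) = geo C (m - \<mu> C)"
  proof -
    assume le: "mon_le (\<mu> C) m"
    have f: "fin_mon (m - \<mu> C)" using fin_mon_le[OF mon_diff_le m] .
    have "mon_deg m = mon_deg (\<mu> C) + mon_deg (m - \<mu> C)"
      using mon_deg_add[OF fin_\<mu>[of C] f] mon_le_diff_add[OF le] by simp
    then show ?thesis using geo_bound[OF f, of ?N] by simp
  qed
  then show ?thesis using e by simp
qed

text \<open>The recursion of \<open>geo_rec\<close> carried through the convolution with
  \<open>G\<close> by shifting the summation index by \<open>\<mu> C\<close>, so that associativity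
  of \<open>ser_mult\<close> does not enter.\<close>

lemma geo_mult_rec:
  assumes m: "fin_mon m"
  shows "ser_mult (geo C) G m = (if mon_le (\<mu> C) m
    then c C * (G (m - \<mu> C) + ser_mult (geo C) G (m - \<mu> C)) else 0)"
proof (cases "mon_le (\<mu> C) m")
  case False
  have "ser_mult (geo C) G m = 0"
    unfolding ser_mult_alt
  proof (rule sum.neutral, clarify)
    fix a d assume "mon_le (a, d) m"
    then have "\<not> mon_le (\<mu> C) (a, d)" "fin_mon (a, d)"
      using False mon_le_trans fin_mon_le[OF _ m] by blast+
    then show "geo C (a, d) * G (m - (a, d)) = 0" using geo_rec by simp
  qed
  then show ?thesis using False by simp
next
  case True
  let ?m = "m - \<mu> C"
  have fm: "fin_mon ?m" by (rule fin_mon_le[OF mon_diff_le m])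
  have "ser_mult (geo C) G m = (\<Sum>m1\<in>{m1. mon_le m1 m \<and> mon_le (\<mu> C) m1}. geo C m1 * G (m - m1))"
    unfolding ser_mult_alt
  proof (rule sum.mono_neutral_right)
    show "\<forall>i\<in>{m1. mon_le m1 m} - {m1. mon_le m1 m \<and> mon_le (\<mu> C) m1}. geo C i * G (m - i) = 0"
      using geo_rec fin_mon_le[OF _ m] by simp
  qed (use finite_mon_le[OF m] in auto)
  also have "\<dots> = (\<Sum>m2\<in>{m2. mon_le m2 ?m}. geo C (\<mu> C + m2) * G (m - (\<mu> C + m2)))"
  proof (rule sum.reindex_bij_witness[of _ "\<lambda>m2. \<mu> C + m2" "\<lambda>m1. m1 - \<mu> C"])
    fix m1 assume "m1 \<in> {m1. mon_le m1 m \<and> mon_le (\<mu> C) m1}"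
    then show "\<mu> C + (m1 - \<mu> C) = m1" "m1 - \<mu> C \<in> {m2. mon_le m2 ?m}"
      "geo C (\<mu> C + (m1 - \<mu> C)) * G (m - (\<mu> C + (m1 - \<mu> C))) = geo C m1 * G (m - m1)"
      by (auto simp: mon_le_diff_add) (auto simp: mon_le_def le_fun_def diff_le_mono)
  next
    fix m2 assume "m2 \<in> {m2. mon_le m2 ?m}"
    then show "\<mu> C + m2 - \<mu> C = m2" "\<mu> C + m2 \<in> {m1. mon_le m1 m \<and> mon_le (\<mu> C) m1}"
      using True by (auto simp: mon_add_diff) (auto simp: mon_le_def le_fun_def le_diff_conv2 add.commute)
  qed
  also have "\<dots> = (\<Sum>m2\<in>{m2. mon_le m2 ?m}.
      c C * ((if m2 = 0 then G (?m - m2) else 0) + geo C m2 * G (?m - m2)))"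
  proof (rule sum.cong)
    fix m2 assume "m2 \<in> {m2. mon_le m2 ?m}"
    then have "fin_mon (\<mu> C + m2)" using fin_mon_add[OF fin_\<mu>] fin_mon_le[OF _ fm] by blast
    then have "geo C (\<mu> C + m2) = c C * ((if m2 = 0 then 1 else 0) + geo C m2)"
      using geo_rec[of "\<mu> C + m2" C] by (simp add: mon_add_diff)
    moreover have "m - (\<mu> C + m2) = ?m - m2" by (auto simp: prod_eq_iff fun_eq_iff)
    ultimately show "geo C (\<mu> C + m2) * G (m - (\<mu> C + m2)) =
        c C * ((if m2 = 0 then G (?m - m2) else 0) + geo C m2 * G (?m - m2))"
      by (simp add: algebra_simps)
  qed simp
  also have "\<dots> = c C * (G ?m + ser_mult (geo C) G ?m)"
  proof -
    have "mon_le 0 ?m" "?m - 0 = ?m" by (auto simp: mon_le_def le_fun_def prod_eq_iff fun_eq_iff)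
    then show ?thesis
      unfolding ser_mult_alt sum_distrib_left[symmetric] sum.distrib
      using finite_mon_le[OF fm] by (simp add: sum.delta')
  qed
  finally show ?thesis using True by simp
qed

definition list_mon :: "nat set list \<Rightarrow> mon" where
  "list_mon Cs = sum_list (map \<mu> Cs)"

definition list_coeff :: "nat set list \<Rightarrow> real" where
  "list_coeff Cs = prod_list (map c Cs)"

lemma fin_list_mon: "fin_mon (list_mon Cs)"
  by (induction Cs) (auto simp: list_mon_def fin_mon_add fin_\<mu>, simp add: fin_mon_def)

text \<open>Columns have positive degree, so only finitely many sequences over a finite set of
  columns share a monomial.\<close>

lemma length_le_deg: "length Cs \<le> mon_deg (list_mon Cs)"
proof (induction Cs)
  case (Cons C Cs)
  have "mon_deg (list_mon (C # Cs)) = mon_deg (\<mu> C) + mon_deg (list_mon Cs)"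
    using mon_deg_add[OF fin_\<mu> fin_list_mon] by (simp add: list_mon_def)
  then show ?case using Cons mon_deg_pos[OF fin_\<mu> \<mu>_nz, of C] by simp
qed simp

lemma finite_list_mon:
  assumes "finite A"
  shows "finite {Cs. set Cs \<subseteq> A \<and> list_mon Cs = m}"
proof (rule finite_subset)
  show "{Cs. set Cs \<subseteq> A \<and> list_mon Cs = m} \<subseteq> {Cs. set Cs \<subseteq> A \<and> length Cs \<le> mon_deg m}"
    using length_le_deg by auto
  show "finite {Cs. set Cs \<subseteq> A \<and> length Cs \<le> mon_deg m}"
    using assms by (rule finite_lists_length_le)
qed

text \<open>Either the block of equal columns \<open>C\<close> ends with this entry or it goes on;
  the condition keeps \<open>T\<close> from being merged with that block.\<close>

lemma remdups_adj_Cons_eq: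
  assumes "T = [] \<or> hd T \<noteq> C"
  shows "remdups_adj (x # xs) = C # T \<longleftrightarrow> x = C \<and> (remdups_adj xs = T \<or> remdups_adj xs = C # T)"
  using assms by (cases "remdups_adj xs") (auto simp: remdups_adj_Cons)

text \<open>Both sides satisfy \<open>H m = c C * (G (m - \<mu> C) + H (m - \<mu> C))\<close>: a sequence that reduces to
  \<open>C # T\<close> starts with \<open>C\<close>, and what follows reduces to \<open>T\<close> or again to \<open>C # T\<close>.\<close>

lemma ser_prod_geo:
  assumes "distinct T"
  shows "ser_prod_list (map geo T) m =
    (\<Sum>Cs\<in>{Cs. remdups_adj Cs = T \<and> list_mon Cs = m}. list_coeff Cs)"
  using assms
proof (induction T arbitrary: m)
  case Nil
  have "{Cs. remdups_adj Cs = [] \<and> list_mon Cs = m} = (if m = 0 then {[]} else {})"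
    by (auto simp: list_mon_def)
  then show ?case by (simp add: ser_prod_list_def ser_one_def list_coeff_def zero_prod_def)
next
  case (Cons C T)
  let ?S = "\<lambda>T m. {Cs. remdups_adj Cs = T \<and> list_mon Cs = m}"
  let ?G = "ser_prod_list (map geo T)"
  have H: "ser_prod_list (map geo (C # T)) = ser_mult (geo C) ?G" by (simp add: ser_prod_list_def)
  have T: "T = [] \<or> hd T \<noteq> C" using Cons.prems by (cases T) auto
  have finS: "finite (?S T m)" for T m
    by (rule finite_subset[OF _ finite_list_mon[of "set T" m]]) (auto dest: arg_cong[where f = set])
  show ?case unfolding H
  \<comment> \<open>The recursion refers to the same product at \<open>m - \<mu> C\<close>, so the
    degree is the measure.\<close>
  proof (induction "mon_deg m" arbitrary: m rule: less_induct)
    case less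
    show ?case
    proof (cases "fin_mon m \<and> mon_le (\<mu> C) m")
      case False
      have "?S (C # T) m = {}"
      proof (rule ccontr)
        assume "?S (C # T) m \<noteq> {}"
        then obtain Cs where Cs: "remdups_adj Cs = C # T" "list_mon Cs = m" by auto
        then obtain x xs where "Cs = x # xs" by (cases Cs) auto
        then have "Cs = C # xs" using Cs remdups_adj_Cons_eq[OF T] by simp
        then have "m = \<mu> C + list_mon xs" using Cs by (simp add: list_mon_def)
        then show False using False Cs fin_list_mon by (metis mon_le_add)
      qed
      moreover have "ser_mult (geo C) ?G m = 0"
        using False geo_mult_rec[of m C ?G] ser_mult_infinite[of m] by (cases "fin_mon m") auto
      ultimately show ?thesis by (simp only: sum.empty)
    next
      case True
      let ?m = "m - \<mu> C"
      have f: "fin_mon ?m" using fin_mon_le[OF mon_diff_le] True by blast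
      have "mon_deg m = mon_deg (\<mu> C) + mon_deg ?m"
        using mon_deg_add[OF fin_\<mu>[of C] f] mon_le_diff_add True by metis
      then have lt: "mon_deg ?m < mon_deg m" using mon_deg_pos[OF fin_\<mu> \<mu>_nz, of C] by simp
      have S: "?S (C # T) m = (#) C ` (?S T ?m \<union> ?S (C # T) ?m)"
      proof (intro set_eqI iffI)
        fix Cs assume "Cs \<in> ?S (C # T) m"
        then have Cs: "remdups_adj Cs = C # T" "list_mon Cs = m" by auto
        then obtain x xs where xs: "Cs = x # xs" by (cases Cs) auto
        then have x: "x = C" "remdups_adj xs = T \<or> remdups_adj xs = C # T"
          using Cs remdups_adj_Cons_eq[OF T] by auto
        have "list_mon xs = ?m" using Cs xs x by (auto simp: list_mon_def mon_add_diff)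
        then show "Cs \<in> (#) C ` (?S T ?m \<union> ?S (C # T) ?m)" using x xs by auto
      next
        fix Cs assume "Cs \<in> (#) C ` (?S T ?m \<union> ?S (C # T) ?m)"
        then obtain xs where xs: "Cs = C # xs" "remdups_adj xs = T \<or> remdups_adj xs = C # T"
          "list_mon xs = ?m" by auto
        have "list_mon Cs = m" using xs True mon_le_diff_add[of "\<mu> C" m] by (simp add: list_mon_def)
        then show "Cs \<in> ?S (C # T) m" using xs remdups_adj_Cons_eq[OF T] by auto
      qed
      have "(\<Sum>Cs\<in>?S (C # T) m. list_coeff Cs) =
          (\<Sum>Cs\<in>?S T ?m \<union> ?S (C # T) ?m. c C * list_coeff Cs)"
        unfolding S by (subst sum.reindex) (auto simp: list_coeff_def)
      also have "\<dots> = (\<Sum>Cs\<in>?S T ?m. c C * list_coeff Cs) + (\<Sum>Cs\<in>?S (C # T) ?m. c C * list_coeff Cs)"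
        using T by (intro sum.union_disjoint finS) auto
      also have "\<dots> = c C * (?G ?m + ser_mult (geo C) ?G ?m)"
        using Cons.IH[of ?m] Cons.prems less[OF lt] by (simp add: sum_distrib_left distrib_left)
      finally show ?thesis using geo_mult_rec[of m C ?G] True by simp
    qed
  qed
qed

end

section \<open>Tableaux as chains of column sets\<close>

text \<open>The Gale order, extended to sets of different sizes: \<open>B\<close> may stand to the
  right of \<open>A\<close> in a semistandard tableau (\<open>gale_iff_entries\<close>). The form
  with counts is the one that fibre sizes see.\<close>

definition gale :: "nat set \<Rightarrow> nat set \<Rightarrow> bool" where
  "gale A B \<longleftrightarrow> (\<forall>k. card (B \<inter> {..k}) \<le> card (A \<inter> {..k}))"

text \<open>The leg factors of two adjacent columns, indexed by the entries of the right column
  missing from the left one; under \<open>gale A B\<close> the exponent is a true difference, namely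
  the leg length in the row of \<open>k\<close>.\<close>

definition pair_weight :: "real \<Rightarrow> nat set \<Rightarrow> nat set \<Rightarrow> real" where
  "pair_weight Y A B = (\<Prod>k\<in>B - A. 1 - Y ^ (card (A \<inter> {..<k}) - card (B \<inter> {..<k})))"

primrec chain_weight :: "real \<Rightarrow> nat set list \<Rightarrow> real" where
  "chain_weight Y [] = 1"
| "chain_weight Y (A # As) = pair_weight Y A (case As of [] \<Rightarrow> {} | B # _ \<Rightarrow> B) * chain_weight Y As"

lemma gale_refl [simp]: "gale A A"
  by (simp add: gale_def)

lemma gale_trans: "gale A B \<Longrightarrow> gale B C \<Longrightarrow> gale A C"
  unfolding gale_def by (meson order_trans)

lemma gale_empty [simp]: "gale A {}"
  by (simp add: gale_def)

lemma card_Int_atMost: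
  fixes k :: nat
  assumes A: "finite A"
  shows "card (A \<inter> {..k}) = card (A \<inter> {..<k}) + (if k \<in> A then 1 else 0)"
proof -
  have "{..k} = insert k {..<k}" by auto
  then show ?thesis using A by (auto simp: Int_insert_right)
qed

lemma gale_less:
  assumes "gale A B"
  shows "card (B \<inter> {..<k}) \<le> card (A \<inter> {..<k})"
proof (cases k)
  case (Suc j)
  then show ?thesis using assms by (simp add: gale_def lessThan_Suc_atMost)
qed simp

lemma gale_antisym:
  assumes A: "finite A" and B: "finite B" and g: "gale A B" "gale B A"
  shows "A = B"
proof (rule set_eqI)
  fix k
  have "card (A \<inter> {..<k}) = card (B \<inter> {..<k})" "card (A \<inter> {..k}) = card (B \<inter> {..k})"
    using gale_less g by (auto simp: gale_def intro: antisym)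
  then show "k \<in> A \<longleftrightarrow> k \<in> B"
    using card_Int_atMost[OF A, of k] card_Int_atMost[OF B, of k] by (auto split: if_splits)
qed

text \<open>At the first place where the Gale order fails, the two counts below are equal, so that a
  factor of \<open>fibre_size\<close> vanishes.\<close>

lemma not_gale_witness:
  assumes A: "finite A" and B: "finite B" and ng: "\<not> gale A B"
  shows "\<exists>k\<in>B - A. card (A \<inter> {..<k}) = card (B \<inter> {..<k})"
proof -
  let ?P = "\<lambda>k. card (A \<inter> {..k}) < card (B \<inter> {..k})"
  have "\<exists>k. ?P k" using ng by (auto simp: gale_def not_le)
  then obtain k where P: "?P k" and least: "\<And>j. j < k \<Longrightarrow> \<not> ?P j"
    using exists_least_iff[of ?P] by blast
  have le: "card (B \<inter> {..<k}) \<le> card (A \<inter> {..<k})"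
  proof (cases k)
    case (Suc j)
    then show ?thesis using least[of j] by (simp add: lessThan_Suc_atMost)
  qed simp
  have "k \<in> B" "k \<notin> A" "card (A \<inter> {..<k}) = card (B \<inter> {..<k})"
    using P le card_Int_atMost[OF A, of k] card_Int_atMost[OF B, of k] by (auto split: if_splits)
  then show ?thesis by blast
qed

lemma pair_weight_self [simp]: "pair_weight Y A A = 1"
  by (simp add: pair_weight_def)

lemma pair_weight_empty [simp]: "pair_weight Y A {} = 1"
  by (simp add: pair_weight_def)

text \<open>Equal neighbours contribute an empty product, so multiplicities of columns do not affect
  the weight.\<close>

lemma chain_weight_remdups_adj: "chain_weight Y (remdups_adj As) = chain_weight Y As"
proof (induction As rule: remdups_adj.induct)
  case (3 x y xs)
  have "(case remdups_adj (y # xs) of [] \<Rightarrow> {} | B # _ \<Rightarrow> B) = y"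
    by (metis hd_remdups_adj list.case(2) list.exhaust_sel list.sel(1) remdups_adj_Nil_iff list.distinct(1))
  then show ?case using 3 by auto
qed auto

lemma chain_weight_nth:
  "chain_weight Y As = (\<Prod>j\<in>{j. Suc j < length As}. pair_weight Y (As ! j) (As ! Suc j))"
proof (induction As)
  case (Cons A As)
  show ?case
  proof (cases As)
    case (Cons B Bs)
    let ?J = "{j. Suc j < length As}" and ?J' = "{j. Suc j < length (A # As)}"
    let ?f = "\<lambda>As j. pair_weight Y (As ! j) (As ! Suc j)"
    have fin: "finite ?J" by (rule finite_subset[of _ "{..<length As}"]) auto
    have "j \<in> ?J' \<longleftrightarrow> j \<in> insert 0 (Suc ` ?J)" for j using Cons by (cases j) auto
    then have "?J' = insert 0 (Suc ` ?J)" by blast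
    then have "prod (?f (A # As)) ?J' = prod (?f (A # As)) (insert 0 (Suc ` ?J))" by (rule arg_cong)
    also have "\<dots> = ?f (A # As) 0 * prod (?f (A # As)) (Suc ` ?J)"
      using fin by (intro prod.insert) auto
    also have "prod (?f (A # As)) (Suc ` ?J) = prod (?f As) ?J"
      by (subst prod.reindex) auto
    finally have "prod (?f (A # As)) ?J' = ?f (A # As) 0 * prod (?f As) ?J" .
    then show ?thesis using Cons.IH Cons by simp
  qed simp
qed simp

section \<open>Entries of columns in terms of counts\<close>

lemma entry_props:
  assumes C: "finite C" and i: "i \<in> {1..card C}"
  shows "entry C i \<in> C" "card (C \<inter> {..<entry C i}) = i - 1"
proof -
  let ?xs = "sorted_list_of_set C"
  have len: "length ?xs = card C" by simp
  have sw: "sorted_wrt (<) ?xs" by (rule strict_sorted_list_of_set)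
  have set: "set ?xs = C" using C by simp
  have il: "i - 1 < length ?xs" using i by auto
  have e: "entry C i = ?xs ! (i - 1)" by (simp add: entry_def)
  show "entry C i \<in> C" unfolding e using nth_mem[OF il] set by simp
  have "C \<inter> {..<entry C i} = (!) ?xs ` {..<i - 1}"
  proof (intro set_eqI iffI)
    fix x assume x: "x \<in> C \<inter> {..<entry C i}"
    then obtain j where j: "j < length ?xs" "x = ?xs ! j" using set by (metis IntD1 in_set_conv_nth)
    have "j < i - 1"
    proof (rule ccontr)
      assume "\<not> j < i - 1"
      then have "?xs ! (i - 1) \<le> ?xs ! j"
        using sorted_wrt_nth_less[OF sw, of "i - 1" j] j(1) by (cases "j = i - 1") auto
      then show False using x j(2) e by simp
    qed
    then show "x \<in> (!) ?xs ` {..<i - 1}" using j by blast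
  next
    fix x assume "x \<in> (!) ?xs ` {..<i - 1}"
    then obtain j where j: "j < i - 1" "x = ?xs ! j" by auto
    then have "x < entry C i" unfolding e using sorted_wrt_nth_less[OF sw j(1) il] by simp
    moreover have "x \<in> C" using j il set by (metis less_trans nth_mem)
    ultimately show "x \<in> C \<inter> {..<entry C i}" by simp
  qed
  moreover have "inj_on ((!) ?xs) {..<i - 1}"
    using il by (intro inj_on_nth) (auto intro: less_trans)
  ultimately show "card (C \<inter> {..<entry C i}) = i - 1" by (simp add: card_image)
qed

lemma entry_card:
  assumes C: "finite C" and x: "x \<in> C"
  shows "Suc (card (C \<inter> {..<x})) \<in> {1..card C}" "entry C (Suc (card (C \<inter> {..<x}))) = x"
proof -
  let ?i = "Suc (card (C \<inter> {..<x}))"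
  have "card (C \<inter> {..<x}) < card C" using C x by (intro psubset_card_mono) auto
  then show i: "?i \<in> {1..card C}" by simp
  have m: "card (C \<inter> {..<y}) < card (C \<inter> {..<z})" if "y < z" "y \<in> C" for y z
    by (rule psubset_card_mono) (use C that in auto)
  show "entry C ?i = x"
    using entry_props[OF C i] m[of x "entry C ?i"] m[of "entry C ?i" x] x
    by (cases x "entry C ?i" rule: linorder_cases) auto
qed

text \<open>Exchanges entries for counting functions, turning the rowwise comparison of columns into
  the comparison of counts.\<close>

lemma entry_le_iff:
  assumes C: "finite C" and i: "i \<in> {1..card C}"
  shows "entry C i \<le> k \<longleftrightarrow> i \<le> card (C \<inter> {..k})"
proof
  note e = entry_props[OF C i]
  show "i \<le> card (C \<inter> {..k})" if "entry C i \<le> k"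
  proof -
    have "i = card (C \<inter> {..entry C i})" using e i by (simp add: card_Int_atMost[OF C])
    also have "\<dots> \<le> card (C \<inter> {..k})" using that C by (intro card_mono) auto
    finally show ?thesis .
  qed
  show "entry C i \<le> k" if k: "i \<le> card (C \<inter> {..k})"
  proof (rule ccontr)
    assume "\<not> entry C i \<le> k"
    then have "card (C \<inter> {..k}) \<le> card (C \<inter> {..<entry C i})" using C by (intro card_mono) auto
    then show False using k e i by auto
  qed
qed

lemma gale_iff_entries:
  assumes A: "finite A" and B: "finite B"
  shows "card B \<le> card A \<and> (\<forall>i\<in>{1..card B}. entry A i \<le> entry B i) \<longleftrightarrow> gale A B"
proof
  assume h: "card B \<le> card A \<and> (\<forall>i\<in>{1..card B}. entry A i \<le> entry B i)"
  show "gale A B"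
    unfolding gale_def
  proof
    fix k
    let ?i = "card (B \<inter> {..k})"
    show "?i \<le> card (A \<inter> {..k})"
    proof (cases "?i = 0")
      case False
      have "?i \<le> card B" using B by (intro card_mono) auto
      moreover have "1 \<le> ?i" using False by linarith
      ultimately have i: "?i \<in> {1..card B}" "?i \<in> {1..card A}" using h by simp_all
      have "entry B ?i \<le> k" using entry_le_iff[OF B i(1)] by simp
      then have "entry A ?i \<le> k" using h i(1) by (meson order_trans)
      then show ?thesis using entry_le_iff[OF A i(2)] by simp
    qed simp
  qed
next
  assume g: "gale A B"
  \<comment> \<open>At a common bound \<open>m\<close> the counts become the cardinalities, which
    yields \<open>card B \<le> card A\<close>.\<close>
  obtain m where m: "A \<union> B \<subseteq> {..m}" using A B finite_nat_iff_bounded_le[of "A \<union> B"] by auto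
  have AB: "card B \<le> card A"
    using g[unfolded gale_def, rule_format, of m] m by (simp add: Int_absorb2)
  have "entry A i \<le> entry B i" if i: "i \<in> {1..card B}" for i
  proof -
    have "i \<le> card (B \<inter> {..entry B i})" using entry_le_iff[OF B i, of "entry B i"] by simp
    also have "\<dots> \<le> card (A \<inter> {..entry B i})" using g by (simp add: gale_def)
    finally show ?thesis using entry_le_iff[OF A, of i "entry B i"] i AB by simp
  qed
  then show "card B \<le> card A \<and> (\<forall>i\<in>{1..card B}. entry A i \<le> entry B i)" using AB by simp
qed

lemma ssyt_iff:
  "ssyt n T \<longleftrightarrow> (\<forall>C\<in>set T. C \<noteq> {} \<and> C \<subseteq> {1..n}) \<and> successively gale T"
proof (cases "\<forall>C\<in>set T. C \<noteq> {} \<and> C \<subseteq> {1..n}")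
  case True
  then have "finite (T ! j)" if "j < length T" for j
    using that by (meson finite_atLeastAtMost nth_mem finite_subset)
  then show ?thesis
    using True by (simp add: ssyt_def successively_conv_nth gale_iff_entries[symmetric])
next
  case False
  then show ?thesis unfolding ssyt_def by blast
qed

text \<open>Row \<open>i\<close> corresponds to the element \<open>entry B i\<close>. Its leg
  consists of the elements of \<open>A\<close> below that entry except the first
  \<open>i - 1\<close>, and \<open>i - 1\<close> is also the number of elements of \<open>B\<close>
  below it.\<close>

lemma prod_leg_column:
  assumes A: "finite A" and B: "finite B" and g: "gale A B"
  shows "(\<Prod>i\<in>{i \<in> {1..card B}. entry B i \<notin> A}. 1 - Y ^ card (A \<inter> {entry A i..entry B i})) =
    pair_weight Y A B"
  unfolding pair_weight_def
proof (rule prod.reindex_bij_witness[of _ "\<lambda>x. Suc (card (B \<inter> {..<x}))" "entry B"])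
  fix i assume "i \<in> {i \<in> {1..card B}. entry B i \<notin> A}"
  then have i: "i \<in> {1..card B}" and n: "entry B i \<notin> A" by auto
  have iA: "i \<in> {1..card A}" using i gale_iff_entries[OF A B] g by auto
  have le: "entry A i \<le> entry B i" using i gale_iff_entries[OF A B] g by auto
  show "Suc (card (B \<inter> {..<entry B i})) = i" using entry_props[OF B i] i by simp
  show "entry B i \<in> B - A" using entry_props[OF B i] n by simp
  have "A \<inter> {entry A i..entry B i} = A \<inter> {..<entry B i} - A \<inter> {..<entry A i}"
    using n by (auto simp: le_less)
  also have "card \<dots> = card (A \<inter> {..<entry B i}) - card (A \<inter> {..<entry A i})"
    using A le by (intro card_Diff_subset) auto
  finally show "1 - Y ^ (card (A \<inter> {..<entry B i}) - card (B \<inter> {..<entry B i})) =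
      1 - Y ^ card (A \<inter> {entry A i..entry B i})"
    using entry_props[OF A iA] entry_props[OF B i] by simp
next
  fix x assume "x \<in> B - A"
  then show "entry B (Suc (card (B \<inter> {..<x}))) = x"
    "Suc (card (B \<inter> {..<x})) \<in> {i \<in> {1..card B}. entry B i \<notin> A}"
    using entry_card[OF B, of x] by auto
qed

lemma Phi_eq_chain_weight:
  assumes T: "ssyt n T"
  shows "Phi T Y = chain_weight Y T"
proof -
  let ?J = "{j. Suc j < length T}"
  let ?I = "\<lambda>j. {i \<in> {1..card (T ! Suc j)}. entry (T ! Suc j) i \<notin> T ! j}"
  have fin: "finite (T ! j)" if "j < length T" for j
    using T that unfolding ssyt_iff by (meson finite_atLeastAtMost nth_mem finite_subset)
  have g: "gale (T ! j) (T ! Suc j)" if "Suc j < length T" for j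
    using T that unfolding ssyt_iff by (auto simp: successively_conv_nth)
  have leg: "leg_plus T i j = (if Suc j < length T \<and> i \<in> ?I j
      then T ! j \<inter> {entry (T ! j) i..entry (T ! Suc j) i} else {})" for i j
    using gale_iff_entries[OF fin fin, of j "Suc j"] g[of j] by (auto simp: leg_plus_def)
  \<comment> \<open>Such a leg contains at least the left entry of its row, so requiring nonempty
    legs in \<open>Phi\<close> removes only the default case.\<close>
  have ne: "T ! j \<inter> {entry (T ! j) i..entry (T ! Suc j) i} \<noteq> {}" if "Suc j < length T" "i \<in> ?I j" for i j
  proof -
    have "card (T ! Suc j) \<le> card (T ! j)" "entry (T ! j) i \<le> entry (T ! Suc j) i"
      using gale_iff_entries[OF fin fin, of j "Suc j"] g[of j] that by auto
    then show ?thesis using entry_props(1)[OF fin, of j i] that by fastforce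
  qed
  have set: "{(i, j). leg_plus T i j \<noteq> {}} = prod.swap ` (SIGMA j:?J. ?I j)"
    using leg ne by (auto simp: image_iff)
  have "Phi T Y = (\<Prod>(j, i)\<in>(SIGMA j:?J. ?I j). 1 - Y ^ card (leg_plus T i j))"
    unfolding Phi_def set by (subst prod.reindex) (auto intro!: prod.cong)
  also have "\<dots> = (\<Prod>j\<in>?J. \<Prod>i\<in>?I j. 1 - Y ^ card (leg_plus T i j))"
  proof (rule prod.Sigma[symmetric])
    show "finite ?J" by (rule finite_subset[of _ "{..<length T}"]) auto
  qed auto
  also have "\<dots> = (\<Prod>j\<in>?J. pair_weight Y (T ! j) (T ! Suc j))"
  proof (rule prod.cong)
    fix j assume j: "j \<in> ?J"
    have "(\<Prod>i\<in>?I j. 1 - Y ^ card (leg_plus T i j)) =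
        (\<Prod>i\<in>?I j. 1 - Y ^ card (T ! j \<inter> {entry (T ! j) i..entry (T ! Suc j) i}))"
      using j by (intro prod.cong) (auto simp: leg)
    then show "(\<Prod>i\<in>?I j. 1 - Y ^ card (leg_plus T i j)) = pair_weight Y (T ! j) (T ! Suc j)"
      using prod_leg_column[OF fin fin g] j by simp
  qed simp
  finally show ?thesis by (simp add: chain_weight_nth)
qed

text \<open>An index \<open>k\<close> counts the integers from 1 to \<open>k\<close>. Those outside
  \<open>A\<close> contribute the rank of \<open>k\<close> in the complement, and these ranks add up
  to the binomial coefficient in \<open>sigma\<close>; what remains is the exponent of q pulled out
  of a fibre size.\<close>

lemma sigma_eq:
  assumes A: "A \<subseteq> {1..n}"
  shows "sigma n A = int (\<Sum>k\<in>{1..n} - A. card (A \<inter> {..<k}))"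
proof -
  have rank: "(\<Sum>k\<in>D. Suc (card (D \<inter> {..<k}))) = (card D + 1) choose 2" if "finite D" for D :: "nat set"
    using that
  proof (induction D rule: finite_linorder_max_induct)
    case (insert b D)
    have "insert b D \<inter> {..<k} = D \<inter> {..<k}" if "k \<in> D" for k using insert.hyps that by auto
    moreover have "insert b D \<inter> {..<b} = D" using insert.hyps by auto
    moreover have "b \<notin> D" using insert.hyps by auto
    ultimately have "(\<Sum>k\<in>insert b D. Suc (card (insert b D \<inter> {..<k}))) =
        Suc (card D) + (\<Sum>k\<in>D. Suc (card (D \<inter> {..<k})))"
      using insert.hyps by simp
    also have "\<dots> = (card (insert b D) + 1) choose 2"
      using insert \<open>b \<notin> D\<close> by (simp add: numeral_2_eq_2)
    finally show ?case .
  qed (simp add: numeral_2_eq_2)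
  let ?D = "{1..n} - A"
  have cD: "card ?D = n - card A" using A finite_subset[of A "{1..n}"] by (simp add: card_Diff_subset)
  have "k = card (A \<inter> {..<k}) + Suc (card (?D \<inter> {..<k}))" if "k \<in> ?D" for k
  proof -
    have "{1..<k} = (A \<inter> {..<k}) \<union> (?D \<inter> {..<k})" using A that by auto
    then have "card {1..<k} = card (A \<inter> {..<k}) + card (?D \<inter> {..<k})"
      by (subst card_Un_disjoint[symmetric]) (auto intro: arg_cong[where f = card])
    then show ?thesis using that by auto
  qed
  then have "(\<Sum>k\<in>?D. k) = (\<Sum>k\<in>?D. card (A \<inter> {..<k}) + Suc (card (?D \<inter> {..<k})))"
    by (rule sum.cong[OF refl])
  also have "\<dots> = (\<Sum>k\<in>?D. card (A \<inter> {..<k})) + ((card ?D + 1) choose 2)"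
    using rank[of ?D] by (simp only: sum.distrib finite_Diff finite_atLeastAtMost)
  finally show ?thesis unfolding sigma_def cD by simp
qed

section \<open>Reversal of the index set\<close>

lemma star_set_subset: "A \<subseteq> {1..n} \<Longrightarrow> star_set n A \<subseteq> {1..n}"
  by (fastforce simp: star_set_def)

lemma mem_star_set:
  assumes A: "A \<subseteq> {1..n}" and k: "k \<in> {1..n}"
  shows "k \<in> star_set n A \<longleftrightarrow> n + 1 - k \<in> A"
proof
  assume "k \<in> star_set n A"
  then obtain i where i: "i \<in> A" "k = n - i + 1" by (auto simp: star_set_def)
  then have "n + 1 - k = i" using subsetD[OF A i(1)] by auto
  then show "n + 1 - k \<in> A" using i by simp
next
  assume h: "n + 1 - k \<in> A"
  have "k = n - (n + 1 - k) + 1" using k by auto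
  then show "k \<in> star_set n A" using h unfolding star_set_def by (rule image_eqI)
qed

lemma star_set_star_set:
  assumes A: "A \<subseteq> {1..n}"
  shows "star_set n (star_set n A) = A"
proof -
  have "n - (n - i + 1) + 1 = i" if "i \<in> A" for i using subsetD[OF A that] by auto
  then show ?thesis by (simp add: star_set_def image_image cong: image_cong)
qed

lemma card_star_set:
  assumes A: "A \<subseteq> {1..n}"
  shows "card (star_set n A) = card A"
proof -
  have "inj_on (\<lambda>i. n - i + 1) A"
  proof (rule inj_onI)
    fix x y assume "x \<in> A" "y \<in> A" "n - x + 1 = n - y + 1"
    then show "x = y" using subsetD[OF A, of x] subsetD[OF A, of y] by auto
  qed
  then show ?thesis unfolding star_set_def by (rule card_image)
qed

text \<open>Fibre sizes count the indices above a given one, as the flag is built from the top;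
  reversal makes these the counts below that the Gale order uses.\<close>

lemma card_star_set_above:
  assumes A: "A \<subseteq> {1..n}" and k: "k \<in> {1..n}"
  shows "card (star_set n A \<inter> {Suc (n + 1 - k)..n}) = card (A \<inter> {..<k})"
proof -
  have "n - i + 1 \<in> {Suc (n + 1 - k)..n} \<longleftrightarrow> i < k" if "i \<in> A" for i
    using subsetD[OF A that] k by auto
  then have "star_set n A \<inter> {Suc (n + 1 - k)..n} = star_set n (A \<inter> {..<k})"
    unfolding star_set_def by blast
  moreover have "A \<inter> {..<k} \<subseteq> {1..n}" using A by auto
  ultimately show ?thesis using card_star_set by metis
qed

section \<open>Fibre sizes as tableau weights\<close>

context dvr_lattices
begin

lemma fibre_size_star:
  assumes A: "A \<subseteq> {1..n}" and B: "B \<subseteq> {1..n}"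
  shows "fibre_size (star_set n A) (star_set n B) =
    (\<Prod>k\<in>{1..n} - A. real q ^ card (A \<inter> {..<k}) - (if k \<in> B then real q ^ card (B \<inter> {..<k}) else 0))"
  unfolding fibre_size_def
proof (rule prod.reindex_bij_witness[of _ "\<lambda>k. n + 1 - k" "\<lambda>k. n + 1 - k"])
  fix k assume k: "k \<in> {1..n} - star_set n A"
  have k': "n + 1 - k \<in> {1..n}" "n + 1 - (n + 1 - k) = k" using k by auto
  show "n + 1 - (n + 1 - k) = k" by (rule k')
  show "n + 1 - k \<in> {1..n} - A" using k mem_star_set[OF A, of k] by auto
  have "k \<in> star_set n B \<longleftrightarrow> n + 1 - k \<in> B" using k mem_star_set[OF B, of k] by auto
  then show "real q ^ card (A \<inter> {..<n + 1 - k}) -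
      (if n + 1 - k \<in> B then real q ^ card (B \<inter> {..<n + 1 - k}) else 0) =
    real q ^ card (star_set n A \<inter> {Suc k..n}) -
      (if k \<in> star_set n B then real q ^ card (star_set n B \<inter> {Suc k..n}) else 0)"
    using card_star_set_above[OF A k'(1)] card_star_set_above[OF B k'(1)] k'(2) by simp
next
  fix k assume k: "k \<in> {1..n} - A"
  have k': "n + 1 - k \<in> {1..n}" using k by auto
  show "n + 1 - (n + 1 - k) = k" using k by auto
  then show "n + 1 - k \<in> {1..n} - star_set n A" using k k' mem_star_set[OF A k'] by auto
qed

text \<open>Pulling a power of q out of each factor leaves 1 outside \<open>B\<close> and a leg
  factor on \<open>B - A\<close>; the exponents add up by \<open>sigma_eq\<close>. If the Gale order
  fails, \<open>not_gale_witness\<close> provides a factor with two equal powers.\<close>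

lemma fibre_size_weight:
  assumes A: "A \<subseteq> {1..n}" and B: "B \<subseteq> {1..n}"
  shows "fibre_size (star_set n A) (star_set n B) =
    (if gale A B then real q powi sigma n A * pair_weight (1 / real q) A B else 0)"
proof -
  have fin: "finite A" "finite B" using A B finite_subset by blast+
  have q0: "real q \<noteq> 0" using q_ge_2 by simp
  let ?a = "\<lambda>k. card (A \<inter> {..<k})" and ?b = "\<lambda>k. card (B \<inter> {..<k})"
  show ?thesis
  proof (cases "gale A B")
    case True
    have "fibre_size (star_set n A) (star_set n B) =
        (\<Prod>k\<in>{1..n} - A. real q ^ ?a k * (if k \<in> B then 1 - (1 / real q) ^ (?a k - ?b k) else 1))"
      unfolding fibre_size_star[OF A B]
    proof (rule prod.cong)
      fix k
      have "?a k = ?b k + (?a k - ?b k)" using gale_less[OF True, of k] by simp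
      then obtain d where "?a k = ?b k + d" "?a k - ?b k = d" by blast
      then have "real q ^ ?a k * (1 / real q) ^ (?a k - ?b k) = real q ^ ?b k"
        using q0 by (simp add: power_add power_one_over)
      then show "real q ^ ?a k - (if k \<in> B then real q ^ ?b k else 0) =
          real q ^ ?a k * (if k \<in> B then 1 - (1 / real q) ^ (?a k - ?b k) else 1)"
        by (simp add: right_diff_distrib)
    qed simp
    also have "\<dots> = (\<Prod>k\<in>{1..n} - A. real q ^ ?a k) *
        (\<Prod>k\<in>{1..n} - A. if k \<in> B then 1 - (1 / real q) ^ (?a k - ?b k) else 1)"
      by (rule prod.distrib)
    also have "(\<Prod>k\<in>{1..n} - A. real q ^ ?a k) = real q powi sigma n A"
      by (simp only: sigma_eq[OF A] power_int_of_nat power_sum)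
    also have "(\<Prod>k\<in>{1..n} - A. if k \<in> B then 1 - (1 / real q) ^ (?a k - ?b k) else 1) =
        pair_weight (1 / real q) A B"
    proof -
      have e: "B - A = {k \<in> {1..n} - A. k \<in> B}" using B by auto
      show ?thesis unfolding pair_weight_def e by (rule prod.inter_filter[symmetric]) simp
    qed
    finally show ?thesis using True by simp
  next
    case False
    then obtain k where k: "k \<in> B - A" "?a k = ?b k" using not_gale_witness[OF fin] by blast
    have "fibre_size (star_set n A) (star_set n B) = 0"
      unfolding fibre_size_star[OF A B]
      by (rule prod_zero) (use k B in \<open>auto intro!: bexI[of _ k]\<close>)
    then show ?thesis using False by simp
  qed
qed

lemma chain_count_star:
  assumes "\<forall>A\<in>set As. A \<subseteq> {1..n}"
  shows "chain_count (map (star_set n) As) = (if successively gale As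
    then chain_weight (1 / real q) As * prod_list (map (\<lambda>A. real q powi sigma n A) As) else 0)"
  using assms
proof (induction As)
  case (Cons A As)
  let ?B = "case As of [] \<Rightarrow> {} | B # _ \<Rightarrow> B"
  have B: "?B \<subseteq> {1..n}" "A \<subseteq> {1..n}" using Cons.prems by (auto split: list.splits)
  \<comment> \<open>The default \<open>{}\<close> is fixed by reversal, and every set is in Gale
    order with it, so the end of the chain needs no separate treatment.\<close>
  have "(case map (star_set n) As of [] \<Rightarrow> {} | D # _ \<Rightarrow> D) = star_set n ?B"
    by (auto simp: star_set_def split: list.splits)
  moreover have "successively gale (A # As) \<longleftrightarrow> gale A ?B \<and> successively gale As"
    by (cases As) auto
  ultimately show ?case
    using Cons fibre_size_weight[OF B(2,1)] by auto
qed simp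

end

section \<open>Comparison of coefficients\<close>

abbreviation column_mon :: "nat \<Rightarrow> nat set \<Rightarrow> mon" where
  "column_mon n C \<equiv> (xvar (card C), yset (star_set n C))"

lemma column_monomial: "column_monomial (column_mon n)"
proof
  fix C
  have "star_set n C \<subseteq> {..Suc n}" by (auto simp: star_set_def)
  then have "finite (star_set n C)" by (rule finite_subset) simp
  then show "fin_mon (column_mon n C)"
    by (simp add: fin_mon_def xvar_def yset_def)
  have "xvar (card C) (card C) \<noteq> 0" by (simp add: xvar_def)
  then show "column_mon n C \<noteq> 0" by (auto simp: prod_eq_iff)
qed

context dvr_lattices
begin

interpretation column_monomial "\<lambda>C. real q powi sigma n C" "column_mon n"
  by (rule column_monomial)

lemma list_mon_eq: "list_mon As =
  (\<lambda>k. length (filter (\<lambda>A. card A = k) As), \<lambda>i. length (filter (\<lambda>A. i \<in> star_set n A) As))"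
proof (induction As)
  case Nil
  show ?case by (simp add: list_mon_def zero_prod_def zero_fun_def)
next
  case (Cons A As)
  have "list_mon (A # As) = column_mon n A + list_mon As" by (simp add: list_mon_def)
  then show ?case unfolding Cons.IH by (auto simp: prod_eq_iff fun_eq_iff xvar_def yset_def)
qed

lemma star_tab:
  assumes L: "cofinite_sub L"
  shows "map (star_set n) (map (star_set n) (tab L)) = tab L"
  using set_tab[OF L] star_set_star_set by (simp add: map_idI)

text \<open>The tableau of \<open>L\<close> has the reversed columns of \<open>tab L\<close>; the
  y-part of \<open>column_mon\<close> reverses again and so sees the original ones, as
  \<open>dl_tab\<close> requires.\<close>

lemma lattice_mon:
  assumes L: "cofinite_sub L"
  shows "(inc n (lattice_type v n L), hermite_comp v n L) = list_mon (map (star_set n) (tab L))"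
proof -
  have "filter (\<lambda>A. card (star_set n A) = k) (tab L) = filter (\<lambda>A. card A = k) (tab L)" for k
    using set_tab[OF L] card_star_set by (intro filter_cong) auto
  moreover have "filter (\<lambda>A. i \<in> star_set n (star_set n A)) (tab L) = filter (\<lambda>A. i \<in> A) (tab L)" for i
    using set_tab[OF L] star_set_star_set by (intro filter_cong) auto
  ultimately show ?thesis
    by (simp add: list_mon_eq fun_eq_iff inc_lattice_type[OF L] hermite_comp_eq[OF L] dl_tab[OF L]
      filter_map comp_def)
qed

definition column_lists :: "mon \<Rightarrow> nat set list set" where
  "column_lists m = {As. set As \<subseteq> Pow {1..n} - {{}} \<and> list_mon As = m}"

lemma finite_column_lists: "finite (column_lists m)"
  unfolding column_lists_def by (rule finite_list_mon) simp

text \<open>The lattices with a given monomial are sorted by their column sequences; as reversal is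
  an involution, different \<open>As\<close> give disjoint classes.\<close>

lemma HS_eq: "HS v n m = (\<Sum>As\<in>column_lists m. chain_count (map (star_set n) As))"
proof -
  let ?L = "\<lambda>As. {L. cofinite_sub L \<and> tab L = map (star_set n) As}"
  have star: "set (map (star_set n) As) \<subseteq> Pow {1..n} - {{}}" if "set As \<subseteq> Pow {1..n} - {{}}" for As
    using that star_set_subset by (fastforce simp: star_set_def)
  have inv: "map (star_set n) (map (star_set n) As) = As" if "set As \<subseteq> Pow {1..n} - {{}}" for As
  proof -
    have "star_set n (star_set n A) = A" if "A \<in> set As" for A
      using that \<open>set As \<subseteq> Pow {1..n} - {{}}\<close> by (intro star_set_star_set) blast
    then show ?thesis by (simp add: map_idI)
  qed
  have "{L. lattice n L \<and> (inc n (lattice_type v n L), hermite_comp v n L) = m} =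
      (\<Union>As\<in>column_lists m. ?L As)"
  proof (intro set_eqI iffI)
    fix L assume "L \<in> {L. lattice n L \<and> (inc n (lattice_type v n L), hermite_comp v n L) = m}"
    then have L: "cofinite_sub L" and m: "list_mon (map (star_set n) (tab L)) = m"
      using lattice_mon[of L] by (auto simp: lattice_iff_cofinite)
    have "set (tab L) \<subseteq> Pow {1..n} - {{}}" using set_tab[OF L] by blast
    then have "map (star_set n) (tab L) \<in> column_lists m"
      using star[of "tab L"] m by (simp add: column_lists_def)
    moreover have "L \<in> ?L (map (star_set n) (tab L))" using star_tab[OF L] L by simp
    ultimately show "L \<in> (\<Union>As\<in>column_lists m. ?L As)" by blast
  next
    fix L assume "L \<in> (\<Union>As\<in>column_lists m. ?L As)"
    then obtain As where As: "As \<in> column_lists m" "cofinite_sub L" "tab L = map (star_set n) As" by auto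
    then have "list_mon (map (star_set n) (tab L)) = m" using inv[of As] by (simp add: column_lists_def)
    then show "L \<in> {L. lattice n L \<and> (inc n (lattice_type v n L), hermite_comp v n L) = m}"
      using lattice_mon[OF As(2)] As(2) by (simp add: lattice_iff_cofinite)
  qed
  moreover have fib: "finite (?L As) \<and> real (card (?L As)) = chain_count (map (star_set n) As)"
    if "As \<in> column_lists m" for As
    using card_tab_fibre[of "map (star_set n) As"] star[of As] that by (auto simp: column_lists_def)
  moreover have "card (\<Union>As\<in>column_lists m. ?L As) = (\<Sum>As\<in>column_lists m. card (?L As))"
  proof (rule card_UN_disjoint[OF finite_column_lists])
    show "\<forall>As\<in>column_lists m. finite (?L As)" using fib by blast
    have "As = Bs" if "As \<in> column_lists m" "Bs \<in> column_lists m" "L \<in> ?L As" "L \<in> ?L Bs" for As Bs L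
    proof -
      have "map (star_set n) As = map (star_set n) Bs" using that by simp
      then show ?thesis using inv[of As] inv[of Bs] that(1,2) by (simp add: column_lists_def)
    qed
    then show "\<forall>As\<in>column_lists m. \<forall>Bs\<in>column_lists m. As \<noteq> Bs \<longrightarrow> ?L As \<inter> ?L Bs = {}"
      by blast
  qed
  ultimately show ?thesis by (simp add: HS_def)
qed

lemma finite_rSSYT: "finite (rSSYT n)"
proof (rule finite_subset)
  show "rSSYT n \<subseteq> {T. set T \<subseteq> Pow {1..n} \<and> distinct T}"
    by (auto simp: rSSYT_def ssyt_def)
  show "finite {T. set T \<subseteq> Pow {1..n} \<and> distinct T}" by (rule finite_subset_distinct) simp
qed

text \<open>The Gale order being antisymmetric, equal columns of a chain are adjacent.\<close>

lemma remdups_adj_in_rSSYT: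
  assumes As: "set As \<subseteq> Pow {1..n} - {{}}" and g: "successively gale As"
  shows "remdups_adj As \<in> rSSYT n"
proof -
  let ?T = "remdups_adj As"
  have g': "successively gale ?T" using g by (simp add: successively_remdups_adj_iff)
  have fin: "finite A" if "A \<in> set As" for A using As that by (meson Diff_iff PowD finite_atLeastAtMost finite_subset subsetD)
  have "successively (\<lambda>A B. gale A B \<and> A \<noteq> B) ?T"
    using g' distinct_adj_remdups_adj[of As] by (simp add: successively_conv_nth distinct_adj_def)
  then have "sorted_wrt (\<lambda>A B. gale A B \<and> A \<noteq> B) ?T"
  proof (subst (asm) successively_iff_sorted_wrt_strong)
    fix A B C assume "A \<in> set ?T" "B \<in> set ?T" "C \<in> set ?T" and
      h: "gale A B \<and> A \<noteq> B" "gale B C \<and> B \<noteq> C"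
    then have "finite A" "finite B" using fin by auto
    then show "gale A C \<and> A \<noteq> C" using h gale_trans gale_antisym by blast
  qed
  then have "sorted_wrt (\<noteq>) ?T" by (rule sorted_wrt_mono_rel[rotated]) blast
  moreover have "distinct xs" if "sorted_wrt (\<noteq>) xs" for xs :: "nat set list"
    using that by (induction xs) auto
  ultimately have "distinct ?T" by blast
  then show ?thesis using As g' by (auto simp: rSSYT_def ssyt_iff)
qed

text \<open>A reduced tableau stands for all sequences that contract to it: the geometric series
  supply the multiplicities, and contraction changes neither the weight nor the Gale condition. The
  Gale chains are grouped by their contraction.\<close>

lemma HLS_eq: "HLS n (1 / real q) (\<lambda>C. mon_ser (real q powi sigma n C) (column_mon n C)) m =
  (\<Sum>As\<in>{As\<in>column_lists m. successively gale As}. chain_weight (1 / real q) As * list_coeff As)"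
proof -
  let ?S = "{As\<in>column_lists m. successively gale As}"
  let ?w = "\<lambda>As. chain_weight (1 / real q) As * list_coeff As"
  have "HLS n (1 / real q) (\<lambda>C. mon_ser (real q powi sigma n C) (column_mon n C)) m =
      (\<Sum>T\<in>rSSYT n. \<Sum>As\<in>{As\<in>?S. remdups_adj As = T}. ?w As)"
    unfolding HLS_def
  proof (rule sum.cong)
    fix T assume T: "T \<in> rSSYT n"
    then have Tp: "ssyt n T" "distinct T" by (auto simp: rSSYT_def)
    have "{As. remdups_adj As = T \<and> list_mon As = m} = {As\<in>?S. remdups_adj As = T}"
    proof (intro set_eqI iffI)
      fix As assume As: "As \<in> {As. remdups_adj As = T \<and> list_mon As = m}"
      then have "set As = set T" "successively gale (remdups_adj As)"
        using Tp by (auto simp: ssyt_iff)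
      then show "As \<in> {As\<in>?S. remdups_adj As = T}"
        using As Tp by (auto simp: ssyt_iff column_lists_def successively_remdups_adj_iff)
    qed (auto simp: column_lists_def)
    then have "ser_prod_list (map geo T) m = (\<Sum>As\<in>{As\<in>?S. remdups_adj As = T}. list_coeff As)"
      using ser_prod_geo[OF Tp(2), of m] by simp
    moreover have "Phi T (1 / real q) = chain_weight (1 / real q) As" if "remdups_adj As = T" for As
      using Phi_eq_chain_weight[OF Tp(1)] chain_weight_remdups_adj that by metis
    then have "(\<Sum>As\<in>{As\<in>?S. remdups_adj As = T}. ?w As) =
        (\<Sum>As\<in>{As\<in>?S. remdups_adj As = T}. Phi T (1 / real q) * list_coeff As)"
      by (intro sum.cong) auto
    ultimately show "Phi T (1 / real q) * ser_prod_list (map geo T) m =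
        (\<Sum>As\<in>{As\<in>?S. remdups_adj As = T}. ?w As)"
      by (simp only: sum_distrib_left)
  qed simp
  also have "\<dots> = (\<Sum>As\<in>?S. ?w As)"
  proof (rule sum.group)
    show "finite ?S" using finite_column_lists by simp
    show "finite (rSSYT n)" by (rule finite_rSSYT)
    show "remdups_adj ` ?S \<subseteq> rSSYT n"
      using remdups_adj_in_rSSYT by (auto simp: column_lists_def)
  qed
  finally show ?thesis .
qed

lemma HS_eq_HLS: "HS v n = HLS n (1 / real q) (\<lambda>C. mon_ser (real q powi sigma n C) (column_mon n C))"
proof
  fix m
  have "HS v n m = (\<Sum>As\<in>column_lists m.
      if successively gale As then chain_weight (1 / real q) As * list_coeff As else 0)"
    unfolding HS_eq
  proof (rule sum.cong)
    fix As assume "As \<in> column_lists m"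
    then have "\<forall>A\<in>set As. A \<subseteq> {1..n}" by (auto simp: column_lists_def)
    then show "chain_count (map (star_set n) As) =
        (if successively gale As then chain_weight (1 / real q) As * list_coeff As else 0)"
      by (simp only: chain_count_star list_coeff_def)
  qed simp
  also have "\<dots> = HLS n (1 / real q) (\<lambda>C. mon_ser (real q powi sigma n C) (column_mon n C)) m"
    unfolding HLS_eq using finite_column_lists by (simp add: sum.inter_filter)
  finally show "HS v n m = HLS n (1 / real q) (\<lambda>C. mon_ser (real q powi sigma n C) (column_mon n C)) m" .
qed

end

theorem theoremD:
  fixes v :: "'a::idom \<Rightarrow> nat" and n q :: nat
  assumes "discrete_valuation_ring v"
    and "compact_space (padic_topology v)"
    and "finite (residue_field v)" and "card (residue_field v) = q"
  shows "HS v n =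
    HLS n (1 / real q)
      (\<lambda>C. mon_ser (real q powi sigma n C) (xvar (card C), yset (star_set n C)))"
proof -
  interpret dvr_lattices v q n
    using assms by unfold_locales
  show ?thesis by (rule HS_eq_HLS)
qed

end
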